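(* For every complex Banach space $X$, the following assertions are equivalent: (i) $X$ is $H^1$-projective. (ii) There exists $\lambda>0$ such that every $v\in\mathcal{L}(H^1,X^* )$ has an extension $\bar v\in\mathcal{L}(L^1,X^* )$, i.e. $\bar v|_{H^1}=v$, with $\|\bar v\|\le\lambda\|v\|$. (iii) There exists $\lambda>0$ such that every $v\in\mathcal{L}_F(H^1,X^* )$ has an extension $\bar v\in\mathcal{L}_F(L^1,X^* )$, i.e. $\bar v|_{H^1}=v$, with $\|\bar v\|\le\lambda\|v\|$. Moreover, the smallest constant $\lambda$ satisfying (ii) (resp. (iii)) is equal to $\eta(X)$.
   Context: All Banach spaces are complex. Let $\mathbb{T}$ be the unit circle with normalized Haar measure $dm$ and $L^1=L^1(\mathbb{T},dm)$. For a Banach space $X$, $X^*$ is its dual, and $\widetilde H^1(X)$ is the closure in the Bochner space $L^1(\mathbb{T};X)$ of the set of $X$-valued analytic polynomials $\sum_{k=0}^n z^k x_k$ ($n\in\mathbb{N}$, $x_k\in X$), with the $L^1(\mathbb{T};X)$-norm; $H^1=\widetilde H^1(\mathbb{C})\subset L^1$ is the scalar Hardy space. $\hat\otimes$ denotes the (completed) projective tensor product. There is a canonical norm-one inclusion map $H^1\hat\otimes X\hookrightarrow\widetilde H^1(X)$ sending $h\otimes x$ to $h(\cdot)x$. $X$ is called $H^1$-projective if this map is surjective; equivalently, if there is a constant $c$ such that $\|F\|_{H^1\hat\otimes X}\le c\,\|F\|_{\widetilde H^1(X)}$ for all $F\in H^1\hat\otimes X$. The smallest such $c$ is denoted $\eta(X)$.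 $\mathcal{L}(E,Z)$ is the space of bounded linear operators from $E$ to $Z$. $\mathcal{L}_F(L^1,Z)$ (resp. $\mathcal{L}_F(H^1,Z)$) is the set of $u\in\mathcal{L}(L^1,Z)$ (resp. $u\in\mathcal{L}(H^1,Z)$) for which there is a positive integer $k_u$ such that $u(e^{in(\cdot)})=0$ for every integer $n\notin[-k_u,k_u]$ (resp. for every $n>k_u$).
   Formalization: For H^1-projective X: "smallest λ" in (iii) is proved as the infimum, since it need not be attained (e.g. X = ℂ, λ = 1 fails); in (ii) η(X) is admissible and ≤ every admissible λ > 0 (for X = 0, η = 0). *)

theory Defs
  imports "HOL-Analysis.Analysis"
begin

section \<open>Complex normed spaces\<close>

class complex_normed_vector = real_normed_vector +
  fixes scaleC :: "complex \<Rightarrow> 'a \<Rightarrow> 'a"  (infixr \<open>*\<^sub>C\<close> 75)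
  assumes scaleC_add_right: "c *\<^sub>C (x + y) = c *\<^sub>C x + c *\<^sub>C y"
    and scaleC_add_left: "(c + d) *\<^sub>C x = c *\<^sub>C x + d *\<^sub>C x"
    and scaleC_scaleC: "c *\<^sub>C d *\<^sub>C x = (c * d) *\<^sub>C x"
    and scaleC_of_real: "complex_of_real r *\<^sub>C x = r *\<^sub>R x"
    and norm_scaleC: "norm (c *\<^sub>C x) = cmod c * norm x"

class complex_banach = complex_normed_vector + banach

instantiation complex :: complex_banach
begin
definition scaleC_complex :: "complex \<Rightarrow> complex \<Rightarrow> complex"
  where "scaleC_complex c x = c * x"
instance
  by standard (auto simp: scaleC_complex_def algebra_simps norm_mult scaleR_conv_of_real)
end

lemma scaleC_one [simp]: "1 *\<^sub>C (x::'a::complex_normed_vector) = x"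
  using scaleC_of_real[of 1 x] by simp

lemma scaleC_zero_left [simp]: "0 *\<^sub>C (x::'a::complex_normed_vector) = 0"
  using scaleC_of_real[of 0 x] by simp

lemma scaleC_minus_one: "(-1) *\<^sub>C (x::'a::complex_normed_vector) = - x"
  using scaleC_of_real[of "-1" x] by simp

lemma scaleC_zero_right [simp]: "c *\<^sub>C (0::'a::complex_normed_vector) = 0"
  using norm_scaleC[of c "0::'a"] by simp

lemma scaleC_minus_right: "c *\<^sub>C (- x) = - (c *\<^sub>C (x::'a::complex_normed_vector))"
  using scaleC_add_right[of c x "- x"] by (simp add: eq_neg_iff_add_eq_0 add.commute)

lemma scaleC_diff_right: "c *\<^sub>C (x - y) = c *\<^sub>C x - c *\<^sub>C (y::'a::complex_normed_vector)"
  using scaleC_add_right[of c x "- y"] by (simp add: scaleC_minus_right)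

lemma scaleC_diff_left: "(c - d) *\<^sub>C x = c *\<^sub>C x - d *\<^sub>C (x::'a::complex_normed_vector)"
  using scaleC_add_left[of "c - d" d x] by simp

lemma vector_space_scaleC: "vector_space (scaleC :: complex \<Rightarrow> 'a::complex_normed_vector \<Rightarrow> 'a)"
  by unfold_locales (auto simp: scaleC_add_right scaleC_add_left scaleC_scaleC)

lemma tendsto_scaleC:
  fixes f :: "'i \<Rightarrow> complex" and g :: "'i \<Rightarrow> 'a::complex_normed_vector"
  assumes "(f \<longlongrightarrow> c) F" "(g \<longlongrightarrow> x) F"
  shows "((\<lambda>i. f i *\<^sub>C g i) \<longlongrightarrow> c *\<^sub>C x) F"
proof -
  have "bounded_bilinear (scaleC :: complex \<Rightarrow> 'a \<Rightarrow> 'a)"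
  proof
    fix a b :: complex and x y :: 'a and r :: real
    show "(a + b) *\<^sub>C x = a *\<^sub>C x + b *\<^sub>C x" by (rule scaleC_add_left)
    show "a *\<^sub>C (x + y) = a *\<^sub>C x + a *\<^sub>C y" by (rule scaleC_add_right)
    show "(r *\<^sub>R a) *\<^sub>C x = r *\<^sub>R a *\<^sub>C x"
      by (metis scaleC_of_real scaleC_scaleC scaleR_conv_of_real)
    show "a *\<^sub>C r *\<^sub>R x = r *\<^sub>R a *\<^sub>C x"
      by (metis mult.commute scaleC_of_real scaleC_scaleC)
    show "\<exists>K. \<forall>(a::complex) (x::'a). norm (a *\<^sub>C x) \<le> norm a * norm x * K"
      by (rule exI[of _ 1]) (simp add: norm_scaleC)
  qed
  then show ?thesis using assms by (rule bounded_bilinear.tendsto)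
qed

text \<open>\<open>bounded_ops\<close> is \<open>\<L>(E, Z)\<close>: the type \<^typ>\<open>'a \<Rightarrow>\<^sub>L 'b\<close> only guarantees real linearity;
  the operator norm is that of \<^typ>\<open>'a \<Rightarrow>\<^sub>L 'b\<close>.\<close>

definition bounded_ops :: "('a::complex_normed_vector \<Rightarrow>\<^sub>L 'b::complex_normed_vector) set"
  where "bounded_ops = {u. \<forall>c x. blinfun_apply u (c *\<^sub>C x) = c *\<^sub>C blinfun_apply u x}"

typedef (overloaded) ('a::complex_normed_vector) dual = "bounded_ops :: ('a \<Rightarrow>\<^sub>L complex) set"
  morphisms blinfun_of_dual dual_of_blinfun
  by (rule exI[of _ 0]) (simp add: bounded_ops_def)

setup_lifting type_definition_dual

instantiation dual :: (complex_normed_vector) complex_normed_vector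
begin

lift_definition norm_dual :: "'a dual \<Rightarrow> real" is norm .

lift_definition minus_dual :: "'a dual \<Rightarrow> 'a dual \<Rightarrow> 'a dual" is minus
  by (simp add: bounded_ops_def blinfun.diff_left scaleC_diff_right)

lift_definition uminus_dual :: "'a dual \<Rightarrow> 'a dual" is uminus
  by (simp add: bounded_ops_def blinfun.minus_left scaleC_minus_right)

lift_definition zero_dual :: "'a dual" is 0
  by (simp add: bounded_ops_def)

lift_definition plus_dual :: "'a dual \<Rightarrow> 'a dual \<Rightarrow> 'a dual" is plus
  by (simp add: bounded_ops_def blinfun.add_left scaleC_add_right)

lift_definition scaleR_dual :: "real \<Rightarrow> 'a dual \<Rightarrow> 'a dual" is scaleR
  by (simp add: bounded_ops_def blinfun.scaleR_left scaleC_complex_def)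

lift_definition scaleC_dual :: "complex \<Rightarrow> 'a dual \<Rightarrow> 'a dual"
  is "\<lambda>c f. Blinfun (\<lambda>x. c * blinfun_apply f x)"
  by (simp add: bounded_ops_def scaleC_complex_def bounded_linear_Blinfun_apply
      bounded_linear_const_mult blinfun.bounded_linear_right)

definition dist_dual :: "'a dual \<Rightarrow> 'a dual \<Rightarrow> real"
  where "dist_dual f g = norm (f - g)"

definition sgn_dual :: "'a dual \<Rightarrow> 'a dual"
  where "sgn_dual f = inverse (norm f) *\<^sub>R f"

definition uniformity_dual :: "('a dual \<times> 'a dual) filter"
  where "uniformity_dual = (INF e\<in>{0 <..}. principal {(x, y). dist x y < e})"

definition open_dual :: "'a dual set \<Rightarrow> bool"
  where "open_dual S = (\<forall>x\<in>S. \<forall>\<^sub>F (x', y) in uniformity. x' = x \<longrightarrow> y \<in> S)"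

instance
proof
  have app: "blinfun_apply (Blinfun (\<lambda>x. c * blinfun_apply f x)) = (\<lambda>x. c * blinfun_apply f x)"
    for c and f :: "'a \<Rightarrow>\<^sub>L complex"
    by (simp add: bounded_linear_Blinfun_apply bounded_linear_const_mult
        blinfun.bounded_linear_right)
  fix f g h :: "'a dual" and r s :: real and c d :: complex
  show "f + g + h = f + (g + h)" by transfer (simp add: add.assoc)
  show "f + g = g + f" by transfer (simp add: add.commute)
  show "0 + f = f" by transfer simp
  show "- f + f = 0" by transfer simp
  show "f - g = f + - g" by transfer simp
  show "r *\<^sub>R (f + g) = r *\<^sub>R f + r *\<^sub>R g" by transfer (simp add: scaleR_add_right)
  show "(r + s) *\<^sub>R f = r *\<^sub>R f + s *\<^sub>R f" by transfer (simp add: scaleR_add_left)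
  show "r *\<^sub>R s *\<^sub>R f = (r * s) *\<^sub>R f" by transfer simp
  show "1 *\<^sub>R f = f" by transfer simp
  show "dist f g = norm (f - g)" by (rule dist_dual_def)
  show "sgn f = inverse (norm f) *\<^sub>R f" by (rule sgn_dual_def)
  show "uniformity = (INF e\<in>{0 <..}. principal {(x, y::'a dual). dist x y < e})"
    by (rule uniformity_dual_def)
  show "open S = (\<forall>x\<in>S. \<forall>\<^sub>F (x', y) in uniformity. x' = x \<longrightarrow> y \<in> S)" for S :: "'a dual set"
    by (rule open_dual_def)
  show "norm f = 0 \<longleftrightarrow> f = 0" by transfer simp
  show "norm (f + g) \<le> norm f + norm g" by transfer (rule norm_triangle_ineq)
  show "norm (r *\<^sub>R f) = \<bar>r\<bar> * norm f" by transfer simp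
  show "c *\<^sub>C (f + g) = c *\<^sub>C f + c *\<^sub>C g"
    by transfer (rule blinfun_eqI, subst blinfun.add_left, simp only: app, simp only: blinfun.add_left distrib_left)
  show "(c + d) *\<^sub>C f = c *\<^sub>C f + d *\<^sub>C f"
    by transfer (rule blinfun_eqI, subst blinfun.add_left, simp only: app, simp only: distrib_right)
  show "c *\<^sub>C d *\<^sub>C f = (c * d) *\<^sub>C f"
    by transfer (rule blinfun_eqI, simp only: app mult.assoc)
  show "complex_of_real r *\<^sub>C f = r *\<^sub>R f"
    by transfer (rule blinfun_eqI, simp only: app blinfun.scaleR_left scaleR_conv_of_real)
  show "norm (c *\<^sub>C f) = cmod c * norm f"
  proof (transfer fixing: c)
    fix f :: "'a \<Rightarrow>\<^sub>L complex"
    have le: "norm (Blinfun (\<lambda>x. c * blinfun_apply f x)) \<le> cmod c * norm f"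
      for c and f :: "'a \<Rightarrow>\<^sub>L complex"
      by (rule norm_blinfun_bound)
        (auto simp: app norm_mult mult.assoc intro!: mult_left_mono norm_blinfun)
    show "norm (Blinfun (\<lambda>x. c * blinfun_apply f x)) = cmod c * norm f"
    proof (cases "c = 0")
      case True
      then show ?thesis using le[of c f] by simp
    next
      case False
      have "f = Blinfun (\<lambda>x. inverse c * blinfun_apply (Blinfun (\<lambda>x. c * blinfun_apply f x)) x)"
        by (rule blinfun_eqI, subst app, subst app) (use False in simp)
      then have "norm f \<le> cmod (inverse c) * norm (Blinfun (\<lambda>x. c * blinfun_apply f x))"
        using le by metis
      then have "cmod c * norm f \<le> norm (Blinfun (\<lambda>x. c * blinfun_apply f x))"
        using False by (simp add: norm_inverse norm_divide field_simps)
      then show ?thesis using le[of c f] by linarith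
    qed
  qed
qed

end


section \<open>The Bochner space of integrable functions on the circle\<close>

text \<open>Normalised Haar measure on the unit circle, as the image of \<open>dt / 2\<pi>\<close> under \<open>t \<mapsto> e^{it}\<close>.\<close>

definition circle :: "complex measure"
  where "circle = distr (uniform_measure lborel {0..<2*pi}) (restrict_space borel (sphere 0 1)) cis"

lemma space_circle [simp]: "space circle = sphere 0 1"
  by (simp add: circle_def space_restrict_space)

lemma emeasure_circle_space: "emeasure circle (space circle) = 1"
proof -
  have cis: "cis \<in> uniform_measure lborel {0..<2*pi} \<rightarrow>\<^sub>M restrict_space borel (sphere 0 1)"
  proof (rule measurable_restrict_space2)
    have "cis \<in> borel_measurable borel"
      by (intro borel_measurable_continuous_onI continuous_intros)
    also have "borel_measurable borel = borel_measurable (uniform_measure lborel {0..<2*pi})"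
      by (intro measurable_cong_sets) auto
    finally show "cis \<in> borel_measurable (uniform_measure lborel {0..<2*pi})" .
  qed simp
  have "emeasure circle (space circle) = emeasure (uniform_measure lborel {0..<2*pi}) UNIV"
    unfolding space_circle unfolding circle_def
    by (subst emeasure_distr[OF cis])
      (auto simp: sets_restrict_space vimage_def intro!: arg_cong2[where f=emeasure])
  also have "\<dots> = emeasure lborel {0..<2*pi} / emeasure lborel {0..<2*pi}"
    by (subst emeasure_uniform_measure) auto
  also have "\<dots> = 1"
    by (simp add: ennreal_divide_self)
  finally show ?thesis .
qed

lemma finite_measure_circle: "finite_measure circle"
  by standard (simp add: emeasure_circle_space del: space_circle)

text \<open>Bochner integrability with values in an arbitrary, possibly nonseparable, space: the
  library's \<^const>\<open>integrable\<close> requires a second countable codomain.  Every class modulo null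
  sets of a.e. limits of simple functions contains an everywhere limit of simple functions, so
  requiring convergence everywhere on the circle does not change \<open>L\<^sup>1\<close>.\<close>

definition strongly_measurable :: "(complex \<Rightarrow> 'a::complex_normed_vector) \<Rightarrow> bool"
  where "strongly_measurable f \<longleftrightarrow>
    (\<exists>s. (\<forall>n. simple_function circle (s n)) \<and> (\<forall>z\<in>space circle. (\<lambda>n. s n z) \<longlonglongrightarrow> f z))"

definition bochner_integrable :: "(complex \<Rightarrow> 'a::complex_normed_vector) \<Rightarrow> bool"
  where "bochner_integrable f \<longleftrightarrow> strongly_measurable f \<and> integrable circle (\<lambda>z. norm (f z))"

lemma strongly_measurable_borel:
  assumes "strongly_measurable f"
  shows "f \<in> borel_measurable circle"
proof -
  obtain s where s: "\<And>n. simple_function circle (s n)"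
    and lim: "\<And>z. z \<in> space circle \<Longrightarrow> (\<lambda>n. s n z) \<longlonglongrightarrow> f z"
    using assms unfolding strongly_measurable_def by blast
  show ?thesis
    by (rule borel_measurable_LIMSEQ_metric[OF borel_measurable_simple_function[OF s] lim])
qed

lemma strongly_measurable_norm:
  "strongly_measurable f \<Longrightarrow> (\<lambda>z. norm (f z)) \<in> borel_measurable circle"
  by (rule measurable_compose[OF strongly_measurable_borel])
    (auto intro!: borel_measurable_continuous_onI continuous_intros)

lemma strongly_measurable_const: "strongly_measurable (\<lambda>z. x)"
  unfolding strongly_measurable_def by (rule exI[of _ "\<lambda>n z. x"]) auto

lemma strongly_measurable_compose2:
  assumes "strongly_measurable f" "strongly_measurable g"
    and "\<And>u v x y. u \<longlonglongrightarrow> x \<Longrightarrow> v \<longlonglongrightarrow> y \<Longrightarrow> (\<lambda>n. h (u n) (v n)) \<longlonglongrightarrow> h x y"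
  shows "strongly_measurable (\<lambda>z. h (f z) (g z))"
proof -
  obtain s t where s: "\<And>n. simple_function circle (s n)" and t: "\<And>n. simple_function circle (t n)"
    and f: "\<And>z. z \<in> space circle \<Longrightarrow> (\<lambda>n. s n z) \<longlonglongrightarrow> f z"
    and g: "\<And>z. z \<in> space circle \<Longrightarrow> (\<lambda>n. t n z) \<longlonglongrightarrow> g z"
    using assms(1,2) unfolding strongly_measurable_def by blast
  have "simple_function circle (\<lambda>z. h (s n z) (t n z))" for n
    by (rule simple_function_compose2[OF s t])
  moreover have "(\<lambda>n. h (s n z) (t n z)) \<longlonglongrightarrow> h (f z) (g z)" if "z \<in> space circle" for z
    by (rule assms(3)[OF f[OF that] g[OF that]])
  ultimately show ?thesis
    unfolding strongly_measurable_def by (intro exI[of _ "\<lambda>n z. h (s n z) (t n z)"]) blast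
qed

lemma strongly_measurable_add:
  "strongly_measurable f \<Longrightarrow> strongly_measurable g \<Longrightarrow> strongly_measurable (\<lambda>z. f z + g z)"
  by (rule strongly_measurable_compose2[where h = "(+)", OF _ _ tendsto_add])

lemma strongly_measurable_scaleC:
  "strongly_measurable f \<Longrightarrow> strongly_measurable g \<Longrightarrow> strongly_measurable (\<lambda>z. f z *\<^sub>C g z)"
  by (rule strongly_measurable_compose2[where h = "(*\<^sub>C)", OF _ _ tendsto_scaleC])

lemma strongly_measurable_sum:
  "(\<And>i. i \<in> I \<Longrightarrow> strongly_measurable (f i)) \<Longrightarrow> strongly_measurable (\<lambda>z. \<Sum>i\<in>I. f i z)"
  by (induction I rule: infinite_finite_induct)
    (auto intro: strongly_measurable_add strongly_measurable_const)

lemma strongly_measurable_complex: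
  fixes f :: "complex \<Rightarrow> complex"
  assumes "f \<in> borel_measurable circle"
  shows "strongly_measurable f"
proof -
  from borel_measurable_implies_sequence_metric[OF assms, of 0] obtain s
    where "\<And>n. simple_function circle (s n)" "\<And>z. z \<in> space circle \<Longrightarrow> (\<lambda>n. s n z) \<longlonglongrightarrow> f z"
    by blast
  then show ?thesis
    unfolding strongly_measurable_def by blast
qed

lemma bochner_integrable_zero: "bochner_integrable (\<lambda>z. 0)"
  by (simp add: bochner_integrable_def strongly_measurable_const)

lemma bochner_integrable_add:
  assumes "bochner_integrable f" "bochner_integrable g"
  shows "bochner_integrable (\<lambda>z. f z + g z)"
  unfolding bochner_integrable_def
proof
  show *: "strongly_measurable (\<lambda>z. f z + g z)"
    using assms by (auto simp: bochner_integrable_def intro: strongly_measurable_add)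
  have int: "integrable circle (\<lambda>z. norm (f z) + norm (g z))"
    using assms by (auto simp: bochner_integrable_def)
  have "norm (norm (f z + g z)) \<le> norm (norm (f z) + norm (g z))" for z
    using norm_triangle_ineq[of "f z" "g z"] by simp
  then show "integrable circle (\<lambda>z. norm (f z + g z))"
    by (rule Bochner_Integration.integrable_bound[OF int strongly_measurable_norm[OF *] AE_I2])
qed

lemma bochner_integrable_scaleC:
  assumes "bochner_integrable f"
  shows "bochner_integrable (\<lambda>z. c *\<^sub>C f z)"
  using assms
  by (auto simp: bochner_integrable_def norm_scaleC
      intro: strongly_measurable_scaleC strongly_measurable_const)

lemma bochner_integrable_scaleC_const:
  fixes h :: "complex \<Rightarrow> complex"
  assumes "bochner_integrable h"
  shows "bochner_integrable (\<lambda>z. h z *\<^sub>C x)"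
  using assms
  by (auto simp: bochner_integrable_def norm_scaleC
      intro: strongly_measurable_scaleC strongly_measurable_const)

lemma bochner_integrable_scaleR:
  assumes "bochner_integrable f"
  shows "bochner_integrable (\<lambda>z. r *\<^sub>R f z)"
  using bochner_integrable_scaleC[OF assms, of "complex_of_real r"] by (simp add: scaleC_of_real)

lemma bochner_integrable_uminus:
  assumes "bochner_integrable f"
  shows "bochner_integrable (\<lambda>z. - f z)"
  using bochner_integrable_scaleC[OF assms, of "-1"] by (simp add: scaleC_minus_one)

lemma bochner_integrable_diff:
  assumes "bochner_integrable f" "bochner_integrable g"
  shows "bochner_integrable (\<lambda>z. f z - g z)"
  using bochner_integrable_add[OF assms(1) bochner_integrable_uminus[OF assms(2)]] by simp

lemma bochner_integrable_bounded:
  assumes f: "strongly_measurable f" and bound: "\<And>z. z \<in> sphere 0 1 \<Longrightarrow> norm (f z) \<le> C"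
  shows "bochner_integrable f"
proof -
  interpret finite_measure circle by (rule finite_measure_circle)
  have "integrable circle (\<lambda>z. norm (f z))"
    by (rule integrable_const_bound[where B = C])
      (use bound in \<open>auto intro!: AE_I2 strongly_measurable_norm f\<close>)
  with f show ?thesis by (simp add: bochner_integrable_def)
qed

text \<open>On the circle, \<open>z powi n\<close> is \<open>e^{int}\<close> for \<open>z = e^{it}\<close>.\<close>

lemma bochner_integrable_power: "bochner_integrable (\<lambda>z::complex. z powi n)"
proof (rule bochner_integrable_bounded[where C = 1])
  have "continuous_on (sphere 0 1) (\<lambda>z::complex. z powi n)"
    by (intro continuous_intros) auto
  then have "(\<lambda>z::complex. z powi n) \<in> borel_measurable (restrict_space borel (sphere 0 1))"
    by (intro borel_measurable_continuous_on_restrict)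
  then show "strongly_measurable (\<lambda>z::complex. z powi n)"
    by (intro strongly_measurable_complex) (simp add: circle_def)
qed (simp add: norm_power_int)

lemma bochner_integrable_sum:
  "(\<And>i. i \<in> I \<Longrightarrow> bochner_integrable (f i)) \<Longrightarrow> bochner_integrable (\<lambda>z. \<Sum>i\<in>I. f i z)"
  by (induction I rule: infinite_finite_induct)
    (auto intro: bochner_integrable_add bochner_integrable_zero)

definition L1_rel :: "(complex \<Rightarrow> 'a::complex_normed_vector) \<Rightarrow> (complex \<Rightarrow> 'a) \<Rightarrow> bool"
  where "L1_rel f g \<longleftrightarrow> bochner_integrable f \<and> bochner_integrable g \<and> (AE z in circle. f z = g z)"

lemma L1_relI:
  "bochner_integrable f \<Longrightarrow> bochner_integrable g \<Longrightarrow> AE z in circle. f z = g z \<Longrightarrow> L1_rel f g"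
  by (simp add: L1_rel_def)

quotient_type (overloaded) 'a L1 = "complex \<Rightarrow> 'a::complex_normed_vector" / partial: L1_rel
proof (rule part_equivpI)
  show "\<exists>f::complex \<Rightarrow> 'a. L1_rel f f"
    by (rule exI[of _ "\<lambda>z. 0"]) (simp add: L1_rel_def bochner_integrable_zero)
  show "symp (L1_rel :: (complex \<Rightarrow> 'a) \<Rightarrow> _)"
    by (auto simp: symp_def L1_rel_def elim: eventually_mono)
  show "transp (L1_rel :: (complex \<Rightarrow> 'a) \<Rightarrow> _)"
    unfolding transp_def L1_rel_def by (auto elim: eventually_elim2)
qed

instantiation L1 :: (complex_normed_vector) complex_normed_vector
begin

lift_definition norm_L1 :: "'a L1 \<Rightarrow> real" is "\<lambda>f. LINT z|circle. norm (f z)"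
  by (rule Bochner_Integration.integral_cong_AE)
    (auto simp: L1_rel_def bochner_integrable_def intro: strongly_measurable_norm elim: eventually_mono)

lift_definition zero_L1 :: "'a L1" is "\<lambda>z. 0"
  by (simp add: L1_rel_def bochner_integrable_zero)

lift_definition plus_L1 :: "'a L1 \<Rightarrow> 'a L1 \<Rightarrow> 'a L1" is "\<lambda>f g z. f z + g z"
  unfolding L1_rel_def by (auto intro: bochner_integrable_add elim: eventually_elim2)

lift_definition minus_L1 :: "'a L1 \<Rightarrow> 'a L1 \<Rightarrow> 'a L1" is "\<lambda>f g z. f z - g z"
  unfolding L1_rel_def by (auto intro: bochner_integrable_diff elim: eventually_elim2)

lift_definition uminus_L1 :: "'a L1 \<Rightarrow> 'a L1" is "\<lambda>f z. - f z"
  unfolding L1_rel_def by (auto intro: bochner_integrable_uminus elim: eventually_mono)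

lift_definition scaleR_L1 :: "real \<Rightarrow> 'a L1 \<Rightarrow> 'a L1" is "\<lambda>r f z. r *\<^sub>R f z"
  unfolding L1_rel_def by (auto intro: bochner_integrable_scaleR elim: eventually_mono)

lift_definition scaleC_L1 :: "complex \<Rightarrow> 'a L1 \<Rightarrow> 'a L1" is "\<lambda>c f z. c *\<^sub>C f z"
  unfolding L1_rel_def by (auto intro: bochner_integrable_scaleC elim: eventually_mono)

definition dist_L1 :: "'a L1 \<Rightarrow> 'a L1 \<Rightarrow> real"
  where "dist_L1 f g = norm (f - g)"

definition sgn_L1 :: "'a L1 \<Rightarrow> 'a L1"
  where "sgn_L1 f = inverse (norm f) *\<^sub>R f"

definition uniformity_L1 :: "('a L1 \<times> 'a L1) filter"
  where "uniformity_L1 = (INF e\<in>{0 <..}. principal {(x, y). dist x y < e})"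

definition open_L1 :: "'a L1 set \<Rightarrow> bool"
  where "open_L1 S = (\<forall>x\<in>S. \<forall>\<^sub>F (x', y) in uniformity. x' = x \<longrightarrow> y \<in> S)"

instance
proof
  note rel = L1_relI bochner_integrable_add bochner_integrable_zero bochner_integrable_scaleR
    bochner_integrable_scaleC bochner_integrable_diff bochner_integrable_uminus AE_I2
  have I: "bochner_integrable f" if "L1_rel f f" for f :: "complex \<Rightarrow> 'a"
    using that by (simp add: L1_rel_def)
  fix f g h :: "'a L1" and r s :: real and c d :: complex
  show "f + g + h = f + (g + h)" by transfer (auto intro!: rel dest!: I simp: add.assoc)
  show "f + g = g + f" by transfer (auto intro!: rel dest!: I simp: add.commute)
  show "0 + f = f" by transfer (auto intro!: rel dest!: I)
  show "- f + f = 0" by transfer (auto intro!: rel dest!: I)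
  show "f - g = f + - g" by transfer (auto intro!: rel dest!: I)
  show "r *\<^sub>R (f + g) = r *\<^sub>R f + r *\<^sub>R g"
    by transfer (auto intro!: rel dest!: I simp: scaleR_add_right)
  show "(r + s) *\<^sub>R f = r *\<^sub>R f + s *\<^sub>R f"
    by transfer (auto intro!: rel dest!: I simp: scaleR_add_left)
  show "r *\<^sub>R s *\<^sub>R f = (r * s) *\<^sub>R f" by transfer (auto intro!: rel dest!: I)
  show "1 *\<^sub>R f = f" by transfer (auto intro!: rel dest!: I)
  show "dist f g = norm (f - g)" by (rule dist_L1_def)
  show "sgn f = inverse (norm f) *\<^sub>R f" by (rule sgn_L1_def)
  show "uniformity = (INF e\<in>{0 <..}. principal {(x, y::'a L1). dist x y < e})"
    by (rule uniformity_L1_def)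
  show "open S = (\<forall>x\<in>S. \<forall>\<^sub>F (x', y) in uniformity. x' = x \<longrightarrow> y \<in> S)" for S :: "'a L1 set"
    by (rule open_L1_def)
  show "norm f = 0 \<longleftrightarrow> f = 0"
  proof transfer
    fix f :: "complex \<Rightarrow> 'a" assume "L1_rel f f"
    then have f: "bochner_integrable f" by (rule I)
    then have "(LINT z|circle. norm (f z)) = 0 \<longleftrightarrow> (AE z in circle. norm (f z) = 0)"
      by (intro integral_nonneg_eq_0_iff_AE) (auto simp: bochner_integrable_def)
    then show "(LINT z|circle. norm (f z)) = 0 \<longleftrightarrow> L1_rel f (\<lambda>z. 0)"
      using f by (simp add: L1_rel_def bochner_integrable_zero)
  qed
  show "norm (f + g) \<le> norm f + norm g"
  proof transfer
    fix f g :: "complex \<Rightarrow> 'a" assume "L1_rel f f" "L1_rel g g"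
    then have fg: "bochner_integrable f" "bochner_integrable g" by (auto dest: I)
    have "(LINT z|circle. norm (f z + g z)) \<le> (LINT z|circle. norm (f z) + norm (g z))"
      using fg bochner_integrable_add[OF fg]
      by (intro integral_mono) (auto simp: bochner_integrable_def norm_triangle_ineq)
    then show "(LINT z|circle. norm (f z + g z))
        \<le> (LINT z|circle. norm (f z)) + (LINT z|circle. norm (g z))"
      using fg by (simp add: bochner_integrable_def)
  qed
  show "norm (r *\<^sub>R f) = \<bar>r\<bar> * norm f" by transfer simp
  show "c *\<^sub>C (f + g) = c *\<^sub>C f + c *\<^sub>C g"
    by transfer (auto intro!: rel dest!: I simp: scaleC_add_right)
  show "(c + d) *\<^sub>C f = c *\<^sub>C f + d *\<^sub>C f"
    by transfer (auto intro!: rel dest!: I simp: scaleC_add_left)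
  show "c *\<^sub>C d *\<^sub>C f = (c * d) *\<^sub>C f"
    by transfer (auto intro!: rel dest!: I simp: scaleC_scaleC)
  show "complex_of_real r *\<^sub>C f = r *\<^sub>R f"
    by transfer (auto intro!: rel dest!: I simp: scaleC_of_real)
  show "norm (c *\<^sub>C f) = cmod c * norm f"
    by transfer (simp add: norm_scaleC)
qed

end

lift_definition L1_exp :: "int \<Rightarrow> complex L1" is "\<lambda>n z. z powi n"
  by (simp add: L1_rel_def bochner_integrable_power)

lift_definition L1_times :: "complex L1 \<Rightarrow> 'a \<Rightarrow> 'a::complex_normed_vector L1"
  is "\<lambda>h x z. h z *\<^sub>C x"
  unfolding L1_rel_def by (auto intro: bochner_integrable_scaleC_const elim: eventually_mono)

lemma norm_L1_times: "norm (L1_times h x) = norm h * norm x"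
  by transfer (simp add: norm_scaleC)


section \<open>Hardy spaces\<close>

lift_definition analytic_poly :: "nat \<Rightarrow> (nat \<Rightarrow> 'a) \<Rightarrow> 'a::complex_normed_vector L1"
  is "\<lambda>n x z. \<Sum>k\<le>n. z ^ k *\<^sub>C x k"
proof -
  fix n and x :: "nat \<Rightarrow> 'a"
  have "bochner_integrable (\<lambda>z. \<Sum>k\<le>n. z powi int k *\<^sub>C x k)"
    by (intro bochner_integrable_sum bochner_integrable_scaleC_const bochner_integrable_power)
  then show "L1_rel (\<lambda>z. \<Sum>k\<le>n. z ^ k *\<^sub>C x k) (\<lambda>z. \<Sum>k\<le>n. z ^ k *\<^sub>C x k)"
    by (simp add: L1_rel_def)
qed

definition Htilde1 :: "'a::complex_normed_vector L1 set"
  where "Htilde1 = closure {analytic_poly n x |n x. True}"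

lemma analytic_poly_extend:
  assumes "n \<le> m"
  shows "analytic_poly n x = analytic_poly m (\<lambda>k. if k \<le> n then x k else 0)"
  using assms
proof transfer
  fix n m :: nat and x :: "nat \<Rightarrow> 'a" assume "n \<le> m"
  then have eq: "(\<Sum>k\<le>m. z ^ k *\<^sub>C (if k \<le> n then x k else 0)) = (\<Sum>k\<le>n. z ^ k *\<^sub>C x k)"
    for z :: complex
    by (intro sum.mono_neutral_cong_right) auto
  have "bochner_integrable (\<lambda>z. \<Sum>k\<le>n. z powi int k *\<^sub>C x k)"
    by (intro bochner_integrable_sum bochner_integrable_scaleC_const bochner_integrable_power)
  then show "L1_rel (\<lambda>z. \<Sum>k\<le>n. z ^ k *\<^sub>C x k)
      (\<lambda>z. \<Sum>k\<le>m. z ^ k *\<^sub>C (if k \<le> n then x k else 0))"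
    by (simp add: L1_rel_def eq)
qed

lemma analytic_poly_add_same:
  "analytic_poly n x + analytic_poly n y = analytic_poly n (\<lambda>k. x k + y k)"
proof transfer
  fix n and x y :: "nat \<Rightarrow> 'a"
  have "bochner_integrable (\<lambda>z. \<Sum>k\<le>n. z powi int k *\<^sub>C (x k + y k))"
    by (intro bochner_integrable_sum bochner_integrable_scaleC_const bochner_integrable_power)
  then show "L1_rel (\<lambda>z. (\<Sum>k\<le>n. z ^ k *\<^sub>C x k) + (\<Sum>k\<le>n. z ^ k *\<^sub>C y k))
      (\<lambda>z. \<Sum>k\<le>n. z ^ k *\<^sub>C (x k + y k))"
    by (simp add: L1_rel_def scaleC_add_right sum.distrib)
qed

lemma analytic_poly_add:
  "\<exists>m w. analytic_poly n x + analytic_poly k y = analytic_poly m w"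
  using analytic_poly_extend[of n "max n k" x] analytic_poly_extend[of k "max n k" y]
  by (metis analytic_poly_add_same max.cobounded1 max.cobounded2)

lemma analytic_poly_scaleC: "c *\<^sub>C analytic_poly n x = analytic_poly n (\<lambda>k. c *\<^sub>C x k)"
proof transfer
  fix c n and x :: "nat \<Rightarrow> 'a"
  have eq: "c *\<^sub>C (\<Sum>k\<le>n. z ^ k *\<^sub>C x k) = (\<Sum>k\<le>n. z ^ k *\<^sub>C c *\<^sub>C x k)" for z :: complex
    by (induction n) (simp_all add: scaleC_add_right scaleC_scaleC mult.commute)
  have "bochner_integrable (\<lambda>z. \<Sum>k\<le>n. z powi int k *\<^sub>C c *\<^sub>C x k)"
    by (intro bochner_integrable_sum bochner_integrable_scaleC_const bochner_integrable_power)
  then show "L1_rel (\<lambda>z. c *\<^sub>C (\<Sum>k\<le>n. z ^ k *\<^sub>C x k)) (\<lambda>z. \<Sum>k\<le>n. z ^ k *\<^sub>C c *\<^sub>C x k)"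
    by (simp add: L1_rel_def eq)
qed

lemma analytic_poly_in_Htilde1: "analytic_poly n x \<in> Htilde1"
  unfolding Htilde1_def by (rule subsetD[OF closure_subset]) auto

lemma Htilde1_zero: "0 \<in> Htilde1"
proof -
  have "analytic_poly 0 (\<lambda>k. 0::'a) = 0" by transfer (simp add: L1_rel_def bochner_integrable_zero)
  then show ?thesis by (metis analytic_poly_in_Htilde1)
qed

lemma Htilde1_add:
  assumes "f \<in> Htilde1" "g \<in> Htilde1"
  shows "f + g \<in> Htilde1"
proof -
  obtain u v where u: "\<And>n. u n \<in> {analytic_poly n x |n x. True}" "u \<longlonglongrightarrow> f"
    and v: "\<And>n. v n \<in> {analytic_poly n x |n x. True}" "v \<longlonglongrightarrow> g"
    using assms unfolding Htilde1_def closure_sequential by blast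
  have "u n + v n \<in> {analytic_poly n x |n x. True}" for n
    using u(1)[of n] v(1)[of n] analytic_poly_add by force
  then show ?thesis
    unfolding Htilde1_def closure_sequential
    using tendsto_add[OF u(2) v(2)] by (intro exI[of _ "\<lambda>n. u n + v n"]) blast
qed

lemma Htilde1_scaleC:
  assumes "f \<in> Htilde1"
  shows "c *\<^sub>C f \<in> Htilde1"
proof -
  obtain u where u: "\<And>n. u n \<in> {analytic_poly n x |n x. True}" "u \<longlonglongrightarrow> f"
    using assms unfolding Htilde1_def closure_sequential by blast
  have "c *\<^sub>C u n \<in> {analytic_poly n x |n x. True}" for n
    using u(1)[of n] analytic_poly_scaleC by force
  then show ?thesis
    unfolding Htilde1_def closure_sequential
    using tendsto_scaleC[OF tendsto_const u(2)] by (intro exI[of _ "\<lambda>n. c *\<^sub>C u n"]) blast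
qed

typedef H1 = "Htilde1 :: complex L1 set"
  morphisms L1_of_H1 H1_of_L1
  by (rule exI[of _ 0]) (rule Htilde1_zero)

setup_lifting type_definition_H1

instantiation H1 :: complex_normed_vector
begin

lift_definition norm_H1 :: "H1 \<Rightarrow> real" is norm .

lift_definition zero_H1 :: H1 is 0 by (rule Htilde1_zero)

lift_definition plus_H1 :: "H1 \<Rightarrow> H1 \<Rightarrow> H1" is plus by (rule Htilde1_add)

lift_definition uminus_H1 :: "H1 \<Rightarrow> H1" is uminus
  by (metis Htilde1_scaleC scaleC_minus_one)

lift_definition minus_H1 :: "H1 \<Rightarrow> H1 \<Rightarrow> H1" is minus
  by (metis Htilde1_add Htilde1_scaleC scaleC_minus_one diff_conv_add_uminus)

lift_definition scaleR_H1 :: "real \<Rightarrow> H1 \<Rightarrow> H1" is scaleR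
  by (metis Htilde1_scaleC scaleC_of_real)

lift_definition scaleC_H1 :: "complex \<Rightarrow> H1 \<Rightarrow> H1" is scaleC by (rule Htilde1_scaleC)

definition dist_H1 :: "H1 \<Rightarrow> H1 \<Rightarrow> real"
  where "dist_H1 f g = norm (f - g)"

definition sgn_H1 :: "H1 \<Rightarrow> H1"
  where "sgn_H1 f = inverse (norm f) *\<^sub>R f"

definition uniformity_H1 :: "(H1 \<times> H1) filter"
  where "uniformity_H1 = (INF e\<in>{0 <..}. principal {(x, y). dist x y < e})"

definition open_H1 :: "H1 set \<Rightarrow> bool"
  where "open_H1 S = (\<forall>x\<in>S. \<forall>\<^sub>F (x', y) in uniformity. x' = x \<longrightarrow> y \<in> S)"

instance
proof
  fix f g h :: H1 and r s :: real and c d :: complex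
  show "f + g + h = f + (g + h)" by transfer (simp add: add.assoc)
  show "f + g = g + f" by transfer (simp add: add.commute)
  show "0 + f = f" by transfer simp
  show "- f + f = 0" by transfer simp
  show "f - g = f + - g" by transfer simp
  show "r *\<^sub>R (f + g) = r *\<^sub>R f + r *\<^sub>R g" by transfer (simp add: scaleR_add_right)
  show "(r + s) *\<^sub>R f = r *\<^sub>R f + s *\<^sub>R f" by transfer (simp add: scaleR_add_left)
  show "r *\<^sub>R s *\<^sub>R f = (r * s) *\<^sub>R f" by transfer simp
  show "1 *\<^sub>R f = f" by transfer simp
  show "dist f g = norm (f - g)" by (rule dist_H1_def)
  show "sgn f = inverse (norm f) *\<^sub>R f" by (rule sgn_H1_def)
  show "uniformity = (INF e\<in>{0 <..}. principal {(x, y::H1). dist x y < e})"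
    by (rule uniformity_H1_def)
  show "open S = (\<forall>x\<in>S. \<forall>\<^sub>F (x', y) in uniformity. x' = x \<longrightarrow> y \<in> S)" for S :: "H1 set"
    by (rule open_H1_def)
  show "norm f = 0 \<longleftrightarrow> f = 0" by transfer simp
  show "norm (f + g) \<le> norm f + norm g" by transfer (rule norm_triangle_ineq)
  show "norm (r *\<^sub>R f) = \<bar>r\<bar> * norm f" by transfer simp
  show "c *\<^sub>C (f + g) = c *\<^sub>C f + c *\<^sub>C g" by transfer (rule scaleC_add_right)
  show "(c + d) *\<^sub>C f = c *\<^sub>C f + d *\<^sub>C f" by transfer (rule scaleC_add_left)
  show "c *\<^sub>C d *\<^sub>C f = (c * d) *\<^sub>C f" by transfer (rule scaleC_scaleC)
  show "complex_of_real r *\<^sub>C f = r *\<^sub>R f" by transfer (rule scaleC_of_real)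
  show "norm (c *\<^sub>C f) = cmod c * norm f" by transfer (rule norm_scaleC)
qed

end

lift_definition H1_exp :: "nat \<Rightarrow> H1" is "\<lambda>n. L1_exp (int n)"
proof -
  fix n
  have "L1_exp (int n) = analytic_poly n (\<lambda>k. if k = n then 1 else 0)"
  proof transfer
    fix n
    have eq: "(\<Sum>k\<le>n. z ^ k *\<^sub>C (if k = n then 1 else 0)) = z powi int n" for z :: complex
      by (simp add: scaleC_complex_def if_distrib[of "\<lambda>y. _ * y"] cong: if_cong)
    show "L1_rel (\<lambda>z. z powi int n) (\<lambda>z::complex. \<Sum>k\<le>n. z ^ k *\<^sub>C (if k = n then 1 else 0))"
      unfolding eq by (simp add: L1_rel_def bochner_integrable_power del: power_int_of_nat)
  qed
  then show "L1_exp (int n) \<in> Htilde1" by (metis analytic_poly_in_Htilde1)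
qed


section \<open>The projective tensor product\<close>

definition cbilinear ::
    "('a::complex_normed_vector \<Rightarrow> 'b::complex_normed_vector \<Rightarrow> 'c::complex_normed_vector) \<Rightarrow> bool"
  where "cbilinear B \<longleftrightarrow>
    (\<forall>x x' y. B (x + x') y = B x y + B x' y) \<and> (\<forall>c x y. B (c *\<^sub>C x) y = c *\<^sub>C B x y) \<and>
    (\<forall>x y y'. B x (y + y') = B x y + B x y') \<and> (\<forall>c x y. B x (c *\<^sub>C y) = c *\<^sub>C B x y)"

text \<open>As in Ryan's book, the algebraic tensor product is the span of the functionals
  \<open>x \<otimes> y : B \<mapsto> B x y\<close> on the space of bilinear forms.  A list \<open>[(x\<^sub>1, y\<^sub>1), \<dots>, (x\<^sub>n, y\<^sub>n)]\<close>
  denotes \<open>\<Sum>\<^sub>i x\<^sub>i \<otimes> y\<^sub>i\<close>.\<close>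

definition tensor_functional ::
    "('a::complex_normed_vector \<times> 'b::complex_normed_vector) list \<Rightarrow> ('a \<Rightarrow> 'b \<Rightarrow> complex) \<Rightarrow> complex"
  where "tensor_functional l = (\<lambda>B. if cbilinear B then \<Sum>(x, y)\<leftarrow>l. B x y else 0)"

typedef (overloaded) ('a::complex_normed_vector, 'b::complex_normed_vector) tensor =
  "range (tensor_functional :: ('a \<times> 'b) list \<Rightarrow> _)"
  by blast

setup_lifting type_definition_tensor

lift_definition tensor_sum ::
    "('a::complex_normed_vector \<times> 'b::complex_normed_vector) list \<Rightarrow> ('a, 'b) tensor"
  is tensor_functional by blast

lemma tensor_functional_append:
  "tensor_functional (l @ l') B = tensor_functional l B + tensor_functional l' B"
  by (simp add: tensor_functional_def)

lemma cbilinear_minus: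
  assumes "cbilinear B" shows "B (- x) y = - B x y"
  using assms unfolding cbilinear_def by (metis scaleC_minus_one)

lemma tensor_functional_minus:
  "tensor_functional (map (\<lambda>(x, y). (- x, y)) l) B = - tensor_functional l B"
  by (induction l) (auto simp: tensor_functional_def cbilinear_minus)

instantiation tensor :: (complex_normed_vector, complex_normed_vector) ab_group_add
begin

lift_definition zero_tensor :: "('a, 'b) tensor" is "\<lambda>B. 0"
  by (rule range_eqI[of _ _ "[]"]) (auto simp: tensor_functional_def)

lift_definition plus_tensor :: "('a, 'b) tensor \<Rightarrow> ('a, 'b) tensor \<Rightarrow> ('a, 'b) tensor"
  is "\<lambda>s t B. s B + t B"
  by (auto simp flip: tensor_functional_append)

lift_definition uminus_tensor :: "('a, 'b) tensor \<Rightarrow> ('a, 'b) tensor"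
  is "\<lambda>t B. - t B"
  by (auto simp flip: tensor_functional_minus)

definition minus_tensor :: "('a, 'b) tensor \<Rightarrow> ('a, 'b) tensor \<Rightarrow> ('a, 'b) tensor"
  where "minus_tensor s t = s + - t"

instance
proof
  fix s t u :: "('a, 'b) tensor"
  show "s + t + u = s + (t + u)" by transfer (simp add: add.assoc)
  show "s + t = t + s" by transfer (simp add: add.commute)
  show "0 + t = t" by transfer simp
  show "- t + t = 0" by transfer simp
  show "s - t = s + - t" by (rule minus_tensor_def)
qed

end

lemma tensor_sum_append: "tensor_sum (l @ l') = tensor_sum l + tensor_sum l'"
  by transfer (simp add: tensor_functional_append fun_eq_iff)

lemma tensor_sum_minus: "tensor_sum (map (\<lambda>(x, y). (- x, y)) l) = - tensor_sum l"
  by transfer (simp add: tensor_functional_minus fun_eq_iff)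

lemma tensor_sum_cases: obtains l where "t = tensor_sum l"
  by transfer auto

definition proj_norm :: "('a::complex_normed_vector, 'b::complex_normed_vector) tensor \<Rightarrow> real"
  where "proj_norm t = Inf {\<Sum>(x, y)\<leftarrow>l. norm x * norm y |l. t = tensor_sum l}"

lemma proj_norm_bdd_below: "bdd_below {\<Sum>(x, y)\<leftarrow>l. norm x * norm y |l. t = tensor_sum l}"
  by (rule bdd_belowI[of _ 0]) (auto intro!: sum_list_nonneg)

lemma proj_norm_le: "proj_norm (tensor_sum l) \<le> (\<Sum>(x, y)\<leftarrow>l. norm x * norm y)"
  unfolding proj_norm_def by (rule cInf_lower[OF _ proj_norm_bdd_below]) auto

lemma proj_norm_approx:
  assumes "0 < e"
  obtains l where "t = tensor_sum l" "(\<Sum>(x, y)\<leftarrow>l. norm x * norm y) < proj_norm t + e"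
proof -
  have "{\<Sum>(x, y)\<leftarrow>l. norm x * norm y |l. t = tensor_sum l} \<noteq> {}"
    using tensor_sum_cases[of t] by auto
  from cInf_lessD[OF this, of "proj_norm t + e"] show thesis
    using assms that unfolding proj_norm_def by auto
qed

lemma proj_norm_nonneg: "0 \<le> proj_norm t"
  unfolding proj_norm_def
proof (rule cInf_greatest)
  obtain l where "t = tensor_sum l" by (rule tensor_sum_cases)
  then show "{\<Sum>(x, y)\<leftarrow>l. norm x * norm y |l. t = tensor_sum l} \<noteq> {}" by blast
next
  fix r assume "r \<in> {\<Sum>(x, y)\<leftarrow>l. norm x * norm y |l. t = tensor_sum l}"
  then show "0 \<le> r" by (auto intro!: sum_list_nonneg)
qed

lemma proj_norm_zero [simp]: "proj_norm 0 = 0"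
proof -
  have "tensor_sum [] = (0 :: ('a::complex_normed_vector, 'b::complex_normed_vector) tensor)"
    by transfer (auto simp: tensor_functional_def)
  then show ?thesis
    using proj_norm_le[of "[] :: ('a \<times> 'b) list"] proj_norm_nonneg[of "0 :: ('a, 'b) tensor"] by simp
qed

lemma proj_norm_triangle: "proj_norm (s + t) \<le> proj_norm s + proj_norm t"
proof (rule field_le_epsilon)
  fix e :: real assume e: "0 < e"
  then have e2: "0 < e / 2" by simp
  obtain l where l: "s = tensor_sum l" "(\<Sum>(x, y)\<leftarrow>l. norm x * norm y) < proj_norm s + e / 2"
    by (rule proj_norm_approx[OF e2, of s])
  obtain l' where l': "t = tensor_sum l'" "(\<Sum>(x, y)\<leftarrow>l'. norm x * norm y) < proj_norm t + e / 2"
    by (rule proj_norm_approx[OF e2, of t])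
  have "proj_norm (s + t) \<le> (\<Sum>(x, y)\<leftarrow>l @ l'. norm x * norm y)"
    unfolding l(1) l'(1) tensor_sum_append[symmetric] by (rule proj_norm_le)
  with l(2) l'(2) show "proj_norm (s + t) \<le> proj_norm s + proj_norm t + e" by simp
qed

lemma proj_norm_minus: "proj_norm (- t) = proj_norm t"
proof -
  have le: "proj_norm (- t) \<le> proj_norm t" for t :: "('a, 'b) tensor"
  proof (rule field_le_epsilon)
    fix e :: real assume "0 < e"
    then obtain l where l: "t = tensor_sum l"
        "(\<Sum>(x, y)\<leftarrow>l. norm x * norm y) < proj_norm t + e"
      by (rule proj_norm_approx[of e t])
    have "proj_norm (- t) \<le> (\<Sum>(x, y)\<leftarrow>map (\<lambda>(x, y). (- x, y)) l. norm x * norm y)"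
      unfolding l(1) tensor_sum_minus[symmetric] by (rule proj_norm_le)
    also have "\<dots> = (\<Sum>(x, y)\<leftarrow>l. norm x * norm y)"
      by (simp add: o_def split_def)
    finally show "proj_norm (- t) \<le> proj_norm t + e" using l(2) by simp
  qed
  from le[of t] le[of "- t"] show ?thesis by simp
qed

lemma proj_norm_diff_commute: "proj_norm (s - t) = proj_norm (t - s)"
  using proj_norm_minus[of "s - t"] by simp

lemma proj_norm_diff_triangle: "proj_norm (s - u) \<le> proj_norm (s - t) + proj_norm (t - u)"
  using proj_norm_triangle[of "s - t" "t - u"] by simp

lemma proj_norm_diff_abs: "\<bar>proj_norm s - proj_norm t\<bar> \<le> proj_norm (s - t)"
  using proj_norm_triangle[of "s - t" t] proj_norm_triangle[of "t - s" s]
  by (simp add: proj_norm_diff_commute[of t s])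

text \<open>The completed projective tensor product, by the Cauchy sequence construction.\<close>

definition proj_Cauchy :: "(nat \<Rightarrow> ('a::complex_normed_vector, 'b::complex_normed_vector) tensor) \<Rightarrow> bool"
  where "proj_Cauchy u \<longleftrightarrow> (\<forall>e>0. \<exists>N. \<forall>m\<ge>N. \<forall>n\<ge>N. proj_norm (u m - u n) < e)"

definition ptensor_rel ::
    "(nat \<Rightarrow> ('a::complex_normed_vector, 'b::complex_normed_vector) tensor) \<Rightarrow>
     (nat \<Rightarrow> ('a, 'b) tensor) \<Rightarrow> bool"
  where "ptensor_rel u v \<longleftrightarrow>
    proj_Cauchy u \<and> proj_Cauchy v \<and> (\<lambda>n. proj_norm (u n - v n)) \<longlonglongrightarrow> 0"

quotient_type (overloaded) ('a, 'b) ptensor =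
  "nat \<Rightarrow> ('a::complex_normed_vector, 'b::complex_normed_vector) tensor" / partial: ptensor_rel
proof (rule part_equivpI)
  show "\<exists>u :: nat \<Rightarrow> ('a, 'b) tensor. ptensor_rel u u"
    by (rule exI[of _ "\<lambda>n. 0"]) (simp add: ptensor_rel_def proj_Cauchy_def)
  show "symp (ptensor_rel :: (nat \<Rightarrow> ('a, 'b) tensor) \<Rightarrow> _)"
    by (auto simp: symp_def ptensor_rel_def proj_norm_diff_commute)
  show "transp (ptensor_rel :: (nat \<Rightarrow> ('a, 'b) tensor) \<Rightarrow> _)"
  proof (rule transpI)
    fix u v w :: "nat \<Rightarrow> ('a, 'b) tensor"
    assume uv: "ptensor_rel u v" and vw: "ptensor_rel v w"
    then have "(\<lambda>n. proj_norm (u n - v n) + proj_norm (v n - w n)) \<longlonglongrightarrow> 0 + 0"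
      by (intro tendsto_add) (auto simp: ptensor_rel_def)
    then have "(\<lambda>n. proj_norm (u n - w n)) \<longlonglongrightarrow> 0"
      by (intro tendsto_sandwich[where f = "\<lambda>_. 0" and g = "\<lambda>n. proj_norm (u n - w n)"
            and h = "\<lambda>n. proj_norm (u n - v n) + proj_norm (v n - w n)"])
        (auto simp: proj_norm_nonneg proj_norm_diff_triangle)
    with uv vw show "ptensor_rel u w" by (simp add: ptensor_rel_def)
  qed
qed

lemma lim_cong_dist:
  fixes a b :: "nat \<Rightarrow> 'c::metric_space"
  assumes "(\<lambda>n. dist (a n) (b n)) \<longlonglongrightarrow> 0"
  shows "lim a = lim b"
proof -
  have *: "d \<longlonglongrightarrow> L" if "c \<longlonglongrightarrow> L" "(\<lambda>n. dist (c n) (d n)) \<longlonglongrightarrow> 0"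
    for c d :: "nat \<Rightarrow> 'c" and L
  proof -
    have "(\<lambda>n. dist (c n) (d n) + dist (c n) L) \<longlonglongrightarrow> 0"
      using tendsto_add[OF that(2) iffD1[OF tendsto_dist_iff that(1)]] by simp
    then have "(\<lambda>n. dist (d n) L) \<longlonglongrightarrow> 0"
      by (intro tendsto_sandwich[where f = "\<lambda>_. 0" and g = "\<lambda>n. dist (d n) L"
            and h = "\<lambda>n. dist (c n) (d n) + dist (c n) L"])
        (auto simp: dist_triangle3)
    then show ?thesis by (rule iffD2[OF tendsto_dist_iff])
  qed
  have "a \<longlonglongrightarrow> L \<longleftrightarrow> b \<longlonglongrightarrow> L" for L
    using *[of a L b] *[of b L a] assms by (auto simp: dist_commute[of "b _"])
  then show ?thesis by (simp add: lim_def)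
qed

lift_definition ptensor_norm ::
    "('a::complex_normed_vector, 'b::complex_normed_vector) ptensor \<Rightarrow> real"
  is "\<lambda>u. lim (\<lambda>n. proj_norm (u n))"
proof (rule lim_cong_dist)
  fix u v :: "nat \<Rightarrow> ('a, 'b) tensor" assume "ptensor_rel u v"
  then have "(\<lambda>n. proj_norm (u n - v n)) \<longlonglongrightarrow> 0" by (simp add: ptensor_rel_def)
  then show "(\<lambda>n. dist (proj_norm (u n)) (proj_norm (v n))) \<longlonglongrightarrow> 0"
    by (intro tendsto_sandwich[where f = "\<lambda>_. 0" and h = "\<lambda>n. proj_norm (u n - v n)"
          and g = "\<lambda>n. dist (proj_norm (u n)) (proj_norm (v n))"])
      (auto simp: dist_real_def proj_norm_diff_abs)
qed

text \<open>The linear extension of a bilinear map to the algebraic tensor product; independence of the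
  representation is lemma \<open>tensor_sum_eq_imp\<close> below.\<close>

definition tensor_lift ::
    "('a::complex_normed_vector \<Rightarrow> 'b::complex_normed_vector \<Rightarrow> 'c::complex_normed_vector) \<Rightarrow>
     ('a, 'b) tensor \<Rightarrow> 'c"
  where "tensor_lift B t = (THE w. \<forall>l. t = tensor_sum l \<longrightarrow> w = (\<Sum>(x, y)\<leftarrow>l. B x y))"

lemma separating_functional:
  fixes w :: "'c::complex_normed_vector"
  assumes "w \<noteq> 0"
  obtains \<phi> :: "'c \<Rightarrow> complex"
  where "\<And>x y. \<phi> (x + y) = \<phi> x + \<phi> y" "\<And>c x. \<phi> (c *\<^sub>C x) = c * \<phi> x" "\<phi> w = 1"
proof -
  interpret vs: vector_space_pair "scaleC :: complex \<Rightarrow> 'c \<Rightarrow> 'c" "scaleC :: complex \<Rightarrow> complex \<Rightarrow> complex"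
    by (intro vector_space_pair.intro vector_space_scaleC)
  have "vs.vs1.independent {w}" using assms by simp
  from vs.linear_independent_extend[OF this, of "\<lambda>_. 1"]
  obtain \<phi> :: "'c \<Rightarrow> complex"
    where \<phi>: "Vector_Spaces.linear scaleC scaleC \<phi>" "\<phi> w = 1" by auto
  show thesis
    by (rule that[of \<phi>])
      (use \<phi> in \<open>auto simp: linear_iff_module_hom module_hom_iff scaleC_complex_def\<close>)
qed

lemma tensor_sum_eq_imp:
  assumes eq: "tensor_sum l = tensor_sum l'" and B: "cbilinear B"
  shows "(\<Sum>(x, y)\<leftarrow>l. B x y) = (\<Sum>(x, y)\<leftarrow>l'. B x y)"
proof (rule ccontr)
  assume "\<not> ?thesis"
  then have "(\<Sum>(x, y)\<leftarrow>l. B x y) - (\<Sum>(x, y)\<leftarrow>l'. B x y) \<noteq> 0" by simp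
  then obtain \<phi> where add: "\<And>x y. \<phi> (x + y) = \<phi> x + \<phi> y"
    and sc: "\<And>c x. \<phi> (c *\<^sub>C x) = c * \<phi> x"
    and one: "\<phi> ((\<Sum>(x, y)\<leftarrow>l. B x y) - (\<Sum>(x, y)\<leftarrow>l'. B x y)) = (1::complex)"
    by (rule separating_functional) blast
  have bil: "cbilinear (\<lambda>x y. \<phi> (B x y))"
    using B by (simp add: cbilinear_def add sc scaleC_complex_def)
  have zero: "\<phi> 0 = 0" using add[of 0 0] by simp
  have sum: "(\<Sum>(x, y)\<leftarrow>k. \<phi> (B x y)) = \<phi> (\<Sum>(x, y)\<leftarrow>k. B x y)" for k
    by (induction k) (auto simp: zero add)
  have "tensor_functional l = tensor_functional l'" using eq by transfer
  then have "\<phi> (\<Sum>(x, y)\<leftarrow>l. B x y) = \<phi> (\<Sum>(x, y)\<leftarrow>l'. B x y)"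
    by (metis (no_types, lifting) tensor_functional_def bil sum)
  with one add show False by (metis (no_types, lifting) diff_add_cancel add_cancel_right_left zero_neq_one)
qed

lemma tensor_lift_sum:
  assumes "cbilinear B"
  shows "tensor_lift B (tensor_sum l) = (\<Sum>(x, y)\<leftarrow>l. B x y)"
  unfolding tensor_lift_def
  by (rule the_equality) (auto dest: tensor_sum_eq_imp[OF _ assms])

lemma tensor_lift_diff:
  assumes "cbilinear B"
  shows "tensor_lift B (s - t) = tensor_lift B s - tensor_lift B t"
proof -
  obtain l l' where l: "s = tensor_sum l" "t = tensor_sum l'" by (metis tensor_sum_cases)
  have "s - t = tensor_sum (l @ map (\<lambda>(x, y). (- x, y)) l')"
    by (simp add: l tensor_sum_append tensor_sum_minus)
  moreover have "(\<Sum>(x, y)\<leftarrow>map (\<lambda>(x, y). (- x, y)) l'. B x y) = - (\<Sum>(x, y)\<leftarrow>l'. B x y)"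
    by (induction l') (auto simp: cbilinear_minus[OF assms])
  ultimately show ?thesis by (simp add: l tensor_lift_sum[OF assms])
qed

lemma norm_tensor_lift_le:
  assumes "cbilinear B" and bound: "\<And>x y. norm (B x y) \<le> norm x * norm y"
  shows "norm (tensor_lift B t) \<le> proj_norm t"
proof (rule field_le_epsilon)
  fix e :: real assume "0 < e"
  then obtain l where l: "t = tensor_sum l" "(\<Sum>(x, y)\<leftarrow>l. norm x * norm y) < proj_norm t + e"
    by (rule proj_norm_approx[of e t])
  have "norm (\<Sum>(x, y)\<leftarrow>l. B x y) \<le> (\<Sum>(x, y)\<leftarrow>l. norm x * norm y)"
  proof (induction l)
    case (Cons p l)
    obtain x y where p: "p = (x, y)" by (cases p)
    show ?case
      using norm_triangle_mono[OF bound[of x y] Cons.IH] by (simp add: p)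
  qed simp
  with l(2) show "norm (tensor_lift B t) \<le> proj_norm t + e"
    unfolding l(1) tensor_lift_sum[OF assms(1)] by linarith
qed


section \<open>Projectivity with respect to the Hardy space\<close>

definition H1_times :: "H1 \<Rightarrow> 'a \<Rightarrow> 'a::complex_normed_vector L1"
  where "H1_times h x = L1_times (L1_of_H1 h) x"

lemma cbilinear_H1_times: "cbilinear (H1_times :: H1 \<Rightarrow> 'a \<Rightarrow> 'a::complex_normed_vector L1)"
proof -
  have I: "bochner_integrable f" if "L1_rel f f" for f :: "complex \<Rightarrow> complex"
    using that by (simp add: L1_rel_def)
  have "L1_times (h + h') x = L1_times h x + L1_times h' x" for h h' and x :: 'a
    by transfer (auto simp: L1_rel_def scaleC_add_left
        intro!: bochner_integrable_add bochner_integrable_scaleC_const)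
  moreover have "L1_times (c *\<^sub>C h) x = c *\<^sub>C L1_times h x" for c h and x :: 'a
  proof transfer
    fix c and h :: "complex \<Rightarrow> complex" and x :: 'a assume "L1_rel h h"
    from bochner_integrable_scaleC[OF bochner_integrable_scaleC_const[OF I[OF this]], of c x]
    show "L1_rel (\<lambda>z. (c *\<^sub>C h z) *\<^sub>C x) (\<lambda>z. c *\<^sub>C h z *\<^sub>C x)"
      by (simp add: L1_rel_def scaleC_scaleC scaleC_complex_def)
  qed
  moreover have "L1_times h (x + x') = L1_times h x + L1_times h x'" for h and x x' :: 'a
    by transfer (auto simp: L1_rel_def scaleC_add_right
        intro!: bochner_integrable_add bochner_integrable_scaleC_const)
  moreover have "L1_times h (c *\<^sub>C x) = c *\<^sub>C L1_times h x" for c h and x :: 'a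
  proof transfer
    fix c and h :: "complex \<Rightarrow> complex" and x :: 'a assume "L1_rel h h"
    from bochner_integrable_scaleC[OF bochner_integrable_scaleC_const[OF I[OF this]], of c x]
    show "L1_rel (\<lambda>z. h z *\<^sub>C c *\<^sub>C x) (\<lambda>z. c *\<^sub>C h z *\<^sub>C x)"
      by (simp add: L1_rel_def scaleC_scaleC mult.commute)
  qed
  ultimately show ?thesis
    by (simp add: cbilinear_def H1_times_def plus_H1.rep_eq scaleC_H1.rep_eq)
qed

lemma norm_H1_times: "norm (H1_times h x) = norm h * norm x"
  by (simp add: H1_times_def norm_L1_times norm_H1.rep_eq)

text \<open>The canonical map \<open>H\<^sup>1 \<otimes>\<^sub>\<pi> X \<rightarrow> L\<^sup>1(X)\<close>, \<open>h \<otimes> x \<mapsto> h(\<cdot>) x\<close>, extended by continuity to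
  the completion; the limit exists because \<open>L\<^sup>1(X)\<close> is complete when \<open>X\<close> is.\<close>

lift_definition canonical_map :: "(H1, 'a) ptensor \<Rightarrow> 'a::complex_banach L1"
  is "\<lambda>u. lim (\<lambda>n. tensor_lift H1_times (u n))"
proof (rule lim_cong_dist)
  fix u v :: "nat \<Rightarrow> (H1, 'a) tensor" assume "ptensor_rel u v"
  then have "(\<lambda>n. proj_norm (u n - v n)) \<longlonglongrightarrow> 0" by (simp add: ptensor_rel_def)
  moreover have "dist (tensor_lift H1_times (u n)) (tensor_lift H1_times (v n))
      \<le> proj_norm (u n - v n)" for n
    using norm_tensor_lift_le[OF cbilinear_H1_times, of "u n - v n"]
    by (simp add: dist_norm norm_H1_times tensor_lift_diff[OF cbilinear_H1_times])
  ultimately show "(\<lambda>n. dist (tensor_lift H1_times (u n)) (tensor_lift H1_times (v n))) \<longlonglongrightarrow> 0"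
    by (intro tendsto_sandwich[where f = "\<lambda>_. 0" and h = "\<lambda>n. proj_norm (u n - v n)"
          and g = "\<lambda>n. dist (tensor_lift H1_times (u n)) (tensor_lift H1_times (v n))"]) auto
qed

definition H1_projective :: "'a::complex_banach itself \<Rightarrow> bool"
  where "H1_projective _ \<longleftrightarrow> range (canonical_map :: (H1, 'a) ptensor \<Rightarrow> 'a L1) = Htilde1"

text \<open>The infimum is attained as soon as some \<open>c\<close> qualifies; \<open>0 \<le> c\<close> only matters for
  \<open>X = 0\<close>, where it gives \<open>\<eta> = 0\<close>.\<close>

definition \<eta> :: "'a::complex_banach itself \<Rightarrow> real"
  where "\<eta> _ = Inf {c. 0 \<le> c \<and> (\<forall>F :: (H1, 'a) ptensor. ptensor_norm F \<le> c * norm (canonical_map F))}"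


section \<open>Extension of operators\<close>

definition L1_ops_fin :: "(complex L1 \<Rightarrow>\<^sub>L 'z::complex_normed_vector) set"
  where "L1_ops_fin = {u \<in> bounded_ops.
    \<exists>k::nat. 0 < k \<and> (\<forall>n::int. n \<notin> {- int k..int k} \<longrightarrow> blinfun_apply u (L1_exp n) = 0)}"

definition H1_ops_fin :: "(H1 \<Rightarrow>\<^sub>L 'z::complex_normed_vector) set"
  where "H1_ops_fin = {u \<in> bounded_ops.
    \<exists>k::nat. 0 < k \<and> (\<forall>n>k. blinfun_apply u (H1_exp n) = 0)}"

definition extends :: "(complex L1 \<Rightarrow>\<^sub>L 'z::complex_normed_vector) \<Rightarrow> (H1 \<Rightarrow>\<^sub>L 'z) \<Rightarrow> bool"
  where "extends w v \<longleftrightarrow> (\<forall>h. blinfun_apply w (L1_of_H1 h) = blinfun_apply v h)"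

definition extension_const :: "'a::complex_banach itself \<Rightarrow> real \<Rightarrow> bool"
  where "extension_const _ l \<longleftrightarrow>
    (\<forall>v \<in> (bounded_ops :: (H1 \<Rightarrow>\<^sub>L 'a dual) set).
      \<exists>w \<in> bounded_ops. extends w v \<and> norm w \<le> l * norm v)"

text \<open>Unlike for \<open>extension_const\<close>, the infimum of the admissible \<open>l\<close> need not be attained here:
  already for \<open>X = \<complex>\<close> the minimal extension of a Caratheodory-Fejer problem is in general a
  multiple of a Blaschke product and not a trigonometric polynomial.\<close>

definition extension_const_fin :: "'a::complex_banach itself \<Rightarrow> real \<Rightarrow> bool"
  where "extension_const_fin _ l \<longleftrightarrow>
    (\<forall>v \<in> (H1_ops_fin :: (H1 \<Rightarrow>\<^sub>L 'a dual) set).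
      \<exists>w \<in> L1_ops_fin. extends w v \<and> norm w \<le> l * norm v)"

end

theory Submission
  imports Defs
begin

text \<open>
  Write \<open>T\<close> for the canonical map on the algebraic tensor product \<open>H\<^sup>1 \<otimes> X\<close>.  All three assertions
  are compared with the inequality \<open>\<parallel>t\<parallel>\<^sub>\<pi> \<le> c \<parallel>T t\<parallel>\<close> for \<open>t \<in> H\<^sup>1 \<otimes> X\<close>, called
  \<open>proj_bound\<close> below.  It passes to the completion by continuity, so \<open>\<eta>(X)\<close> is its best constant
  (\<open>proj_bound_iff\<close>).

  Two facts carry the duality.  Operators \<open>v : H\<^sup>1 \<rightarrow> X\<^sup>*\<close> are the bounded bilinear forms on
  \<open>H\<^sup>1 \<times> X\<close>, and by the Hahn-Banach theorem each tensor is normed by such a \<open>v\<close> of norm at most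
  one (\<open>proj_norm_attained\<close>).  On the other hand a bilinear form on \<open>L\<^sup>1 \<times> X\<close> of norm \<open>K\<close>
  satisfies \<open>|\<Sum> B(f\<^sub>i, x\<^sub>i)| \<le> K \<parallel>\<Sum> f\<^sub>i(\<cdot>) x\<^sub>i\<parallel>\<close> in \<open>L\<^sup>1(X)\<close>, because simple functions are dense and
  can be split over disjoint sets (\<open>L1_tensor_bound\<close>); this is the part of
  \<open>L\<^sup>1 \<otimes>\<^sub>\<pi> X = L\<^sup>1(X)\<close> that is needed.

  If the inequality holds with \<open>c\<close>, then \<open>T t \<mapsto> \<langle>v, t\<rangle>\<close> is a well defined functional on the range of
  \<open>T\<close>, of norm at most \<open>c \<parallel>v\<parallel>\<close>; a Hahn-Banach extension of it to \<open>L\<^sup>1(X)\<close> is an operator from \<open>L\<^sup>1\<close>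
  to \<open>X\<^sup>*\<close> extending \<open>v\<close>.  Conversely, if every \<open>v\<close> extends with constant \<open>\<lambda>\<close>, then
  \<open>L1_tensor_bound\<close>, applied to the extension of an operator that norms \<open>t\<close>, gives the inequality
  with \<open>c = \<lambda>\<close>.

  Finite spectrum is handled by operators of de la Vallee-Poussin type: finite rank multipliers
  \<open>V\<close> on \<open>L\<^sup>1\<close> of norm at most \<open>1 + \<epsilon>\<close> that fix \<open>1, z, \<dots>, z\<^sup>k\<close>.  Composing an extension with \<open>V\<close>
  gives it a finite spectrum at the cost of a factor \<open>1 + \<epsilon>\<close>, and composing a norming \<open>v\<close> with such
  operators reduces the converse to operators with finite spectrum.

  If \<open>T\<close>, extended to the completion, maps onto \<open>Htilde1\<close>, the inequality follows from the uniform boundedness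
  principle.  The functionals \<open>t \<mapsto> \<langle>v V, t\<rangle>\<close>, for \<open>\<parallel>v\<parallel> \<le> 1\<close> and \<open>V\<close> in a sequence of such multipliers
  converging strongly to the identity on \<open>H\<^sup>1\<close>, are continuous for \<open>\<parallel>T t\<parallel>\<close> because \<open>V\<close> has finite
  rank, and surjectivity bounds them pointwise on \<open>Htilde1\<close>.  This avoids proving separately that
  \<open>T\<close> is injective.  Conversely, the inequality makes the range of \<open>T\<close> closed, and it contains the
  analytic polynomials.
\<close>

section \<open>The Hahn-Banach theorem\<close>

text \<open>Sublinear functionals on a real vector space; homogeneity includes \<open>r = 0\<close>, so \<open>p 0 = 0\<close>.\<close>

definition sublinear :: "('a::real_vector \<Rightarrow> real) \<Rightarrow> bool"
  where "sublinear p \<longleftrightarrow>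
    (\<forall>x y. p (x + y) \<le> p x + p y) \<and> (\<forall>r x. 0 \<le> r \<longrightarrow> p (r *\<^sub>R x) = r * p x)"

lemma sublinearI:
  assumes "\<And>x y. p (x + y) \<le> p x + p y" "\<And>r x. 0 < r \<Longrightarrow> p (r *\<^sub>R x) \<le> r * p x" "p 0 = 0"
  shows "sublinear p"
proof -
  have "p (r *\<^sub>R x) = r * p x" if "0 \<le> r" for r x
  proof (cases "r = 0")
    case False
    with that have r: "0 < r" by simp
    have "p x \<le> inverse r * p (r *\<^sub>R x)"
      using assms(2)[of "inverse r" "r *\<^sub>R x"] r by simp
    then have "r * p x \<le> p (r *\<^sub>R x)" using r by (simp add: field_simps)
    with assms(2)[OF r, of x] show ?thesis by simp
  qed (simp add: assms(3))
  with assms(1) show ?thesis by (simp add: sublinear_def)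
qed

lemma sublinear_add: "sublinear p \<Longrightarrow> p (x + y) \<le> p x + p y"
  and sublinear_scaleR: "sublinear p \<Longrightarrow> 0 \<le> r \<Longrightarrow> p (r *\<^sub>R x) = r * p x"
  by (auto simp: sublinear_def)

lemma sublinear_zero: "sublinear p \<Longrightarrow> p 0 = 0"
  using sublinear_scaleR[of p 0 0] by simp

lemma sublinear_lower: "sublinear p \<Longrightarrow> - p (- x) \<le> p x"
  using sublinear_add[of p x "- x"] sublinear_zero[of p] by simp

text \<open>Zorn's lemma is applied to sublinear functionals ordered downwards, rather than to functionals
  on subspaces: the infimum of a chain is again sublinear.\<close>

lemma minimal_sublinear_exists:
  assumes p: "sublinear p"
  obtains q where "sublinear q" "\<And>x. q x \<le> p x"
    "\<And>q' x. sublinear q' \<Longrightarrow> (\<And>x. q' x \<le> q x) \<Longrightarrow> q' x = q x"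
proof -
  define S where "S = {q. sublinear q \<and> q \<le> p}"
  define R :: "('a \<Rightarrow> real) \<Rightarrow> ('a \<Rightarrow> real) \<Rightarrow> bool" where "R = (\<lambda>q q'. q' \<le> q)"
  have "\<exists>m\<in>S. \<forall>a\<in>S. R m a \<longrightarrow> a = m"
  proof (rule predicate_Zorn)
    show "partial_order_on S (relation_of R S)"
      by (rule partial_order_on_relation_ofI) (auto simp: R_def)
  next
    fix C assume C: "C \<in> Chains (relation_of R S)"
    then have CS: "C \<subseteq> S" by (auto simp: Chains_def relation_of_def)
    have tot: "q \<le> q' \<or> q' \<le> q" if "q \<in> C" "q' \<in> C" for q q'
      using C that by (auto simp: Chains_def relation_of_def R_def)
    show "\<exists>u\<in>S. \<forall>a\<in>C. R a u"
    proof (cases "C = {}")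
      case True
      then show ?thesis using p by (auto simp: S_def)
    next
      case False
      define u where "u x = (INF q\<in>C. q x)" for x
      have bdd: "bdd_below ((\<lambda>q. q x) ` C)" for x
      proof (rule bdd_belowI2)
        fix q assume "q \<in> C"
        then have "sublinear q" "q (- x) \<le> p (- x)" using CS by (auto simp: S_def le_fun_def)
        then show "- p (- x) \<le> q x" using sublinear_lower[of q x] by simp
      qed
      have ule: "u x \<le> q x" if "q \<in> C" for q x
        unfolding u_def by (rule cINF_lower[OF bdd that])
      have ug: "a \<le> u x" if "\<And>q. q \<in> C \<Longrightarrow> a \<le> q x" for a x
        unfolding u_def by (rule cINF_greatest[OF False that])
      have sub: "sublinear q" if "q \<in> C" for q using that CS by (auto simp: S_def)
      have "sublinear u"
      proof (rule sublinearI)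
        fix x y
        have "u (x + y) \<le> q x + q' y" if q: "q \<in> C" "q' \<in> C" for q q'
        proof -
          obtain q'' where "q'' \<in> C" "q'' \<le> q" "q'' \<le> q'" using tot[OF q] q by blast
          then show ?thesis
            using ule[of q'' "x + y"] sublinear_add[OF sub, of q'' x y]
            by (fastforce simp: le_fun_def intro: order_trans add_mono)
        qed
        then have "u (x + y) - q' y \<le> u x" if "q' \<in> C" for q'
          using that by (intro ug) (simp add: diff_le_eq)
        then have "u (x + y) - u x \<le> u y" by (intro ug) (simp add: algebra_simps)
        then show "u (x + y) \<le> u x + u y" by simp
      next
        fix r :: real and x assume r: "0 < r"
        have "u (r *\<^sub>R x) / r \<le> u x"
        proof (rule ug)
          fix q assume "q \<in> C"
          then show "u (r *\<^sub>R x) / r \<le> q x"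
            using ule[of q "r *\<^sub>R x"] sublinear_scaleR[OF sub, of q r x] r by (simp add: field_simps)
        qed
        then show "u (r *\<^sub>R x) \<le> r * u x" using r by (simp add: field_simps)
      next
        obtain q where "q \<in> C" using False by blast
        then show "u 0 = 0"
          using ule[of q 0] by (intro antisym ug) (auto simp: sublinear_zero[OF sub])
      qed
      moreover obtain q where "q \<in> C" using False by blast
      then have "u \<le> p"
        using ule[of q] CS by (auto simp: S_def le_fun_def intro: order_trans)
      ultimately show ?thesis using ule by (auto simp: S_def R_def le_fun_def)
    qed
  qed
  then obtain q where q: "q \<in> S" "\<And>q'. q' \<in> S \<Longrightarrow> q' \<le> q \<Longrightarrow> q' = q" by (auto simp: R_def)
  show thesis
  proof (rule that)
    show "sublinear q" "\<And>x. q x \<le> p x" using q(1) by (auto simp: S_def le_fun_def)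
    fix q' x assume "sublinear q'" "\<And>x. q' x \<le> q x"
    moreover from this have "q' \<in> S" using q(1) by (auto simp: S_def le_fun_def intro: order_trans)
    ultimately show "q' x = q x" using q(2)[of q'] by (auto simp: le_fun_def)
  qed
qed

text \<open>The infimal convolution \<open>q x = inf {p (x + T t) - \<phi> t | t \<in> D}\<close> over a convex cone \<open>D\<close> is
  sublinear.  With \<open>D\<close> a half line it shows that minimal sublinear functionals are linear; with \<open>D\<close>
  the whole space, a linear functional below \<open>q\<close> extends \<open>\<phi>\<close>.\<close>

lemma sublinear_infimal:
  fixes p :: "'a::real_vector \<Rightarrow> real" and T :: "'e::real_vector \<Rightarrow> 'a"
  assumes p: "sublinear p" 
    and D0: "0 \<in> D" and Dadd: "\<And>s t. s \<in> D \<Longrightarrow> t \<in> D \<Longrightarrow> s + t \<in> D" 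
    and Dsc: "\<And>r t. 0 < r \<Longrightarrow> t \<in> D \<Longrightarrow> r *\<^sub>R t \<in> D"
    and T: "linear T" and \<phi>: "linear \<phi>" and le: "\<And>t. t \<in> D \<Longrightarrow> \<phi> t \<le> p (T t)"
  obtains q where "sublinear q" "\<And>x t. t \<in> D \<Longrightarrow> q x \<le> p (x + T t) - \<phi> t"
proof -
  interpret T: linear T by fact
  interpret \<phi>: linear \<phi> by fact
  define q where "q x = (INF t\<in>D. p (x + T t) - \<phi> t)" for x
  have bdd: "bdd_below ((\<lambda>t. p (x + T t) - \<phi> t) ` D)" for x
  proof (rule bdd_belowI2)
    fix t assume "t \<in> D"
    have "p (T t) \<le> p (x + T t) + p (- x)" using sublinear_add[OF p, of "x + T t" "- x"] by simp
    with le[OF \<open>t \<in> D\<close>] show "- p (- x) \<le> p (x + T t) - \<phi> t" by simp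
  qed
  have qle: "q x \<le> p (x + T t) - \<phi> t" if "t \<in> D" for x t
    unfolding q_def by (rule cINF_lower[OF bdd that])
  have qg: "a \<le> q x" if "\<And>t. t \<in> D \<Longrightarrow> a \<le> p (x + T t) - \<phi> t" for a x
    unfolding q_def by (rule cINF_greatest[OF _ that]) (use D0 in auto)
  have "sublinear q"
  proof (rule sublinearI)
    fix x y
    have "q (x + y) \<le> (p (x + T s) - \<phi> s) + (p (y + T t) - \<phi> t)" if "s \<in> D" "t \<in> D" for s t
      using qle[OF Dadd[OF that], of "x + y"] sublinear_add[OF p, of "x + T s" "y + T t"]
      by (simp add: T.add \<phi>.add algebra_simps)
    then have "q (x + y) - (p (y + T t) - \<phi> t) \<le> q x" if "t \<in> D" for t
      using that by (intro qg) (simp add: diff_le_eq)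
    then have "q (x + y) - q x \<le> q y" by (intro qg) (simp add: algebra_simps)
    then show "q (x + y) \<le> q x + q y" by simp
  next
    fix r :: real and x assume r: "0 < r"
    have "q (r *\<^sub>R x) / r \<le> q x"
    proof (rule qg)
      fix t assume "t \<in> D"
      then have "q (r *\<^sub>R x) \<le> p (r *\<^sub>R (x + T t)) - r * \<phi> t"
        using qle[OF Dsc[OF r], of t "r *\<^sub>R x"] by (simp add: T.scaleR \<phi>.scaleR scaleR_add_right)
      then show "q (r *\<^sub>R x) / r \<le> p (x + T t) - \<phi> t"
        using r by (simp only: sublinear_scaleR[OF p, of r] less_imp_le) (simp add: field_simps)
    qed
    then show "q (r *\<^sub>R x) \<le> r * q x" using r by (simp add: field_simps)
  next
    show "q 0 = 0"
      using qle[OF D0, of 0] sublinear_zero[OF p] by (intro antisym qg) (auto simp: T.zero \<phi>.zero le)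
  qed
  then show thesis using qle by (rule that)
qed

theorem hahn_banach_sublinear:
  fixes p :: "'a::real_vector \<Rightarrow> real"
  assumes p: "sublinear p"
  obtains f where "linear f" "\<And>x. f x \<le> p x"
proof -
  obtain q where q: "sublinear q" "\<And>x. q x \<le> p x"
    and min: "\<And>q' x. sublinear q' \<Longrightarrow> (\<And>x. q' x \<le> q x) \<Longrightarrow> q' x = q x"
    using minimal_sublinear_exists[OF p] by blast
  have ge: "q x + q y \<le> q (x + y)" for x y
  proof -
    have "linear (\<lambda>r. r *\<^sub>R y)" by (simp add: linear_iff scaleR_add_left)
    moreover have "linear (\<lambda>r. r * q y)" by (simp add: linear_iff algebra_simps)
    ultimately obtain q' where q': "sublinear q'"
      "\<And>x t. 0 \<le> t \<Longrightarrow> q' x \<le> q (x + t *\<^sub>R y) - t * q y"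
      using sublinear_infimal[OF q(1), of "{0..}" "\<lambda>r. r *\<^sub>R y" "\<lambda>r. r * q y"]
      by (auto simp: sublinear_scaleR[OF q(1)])
    have "q' x = q x"
      by (rule min[OF q'(1)]) (use q'(2)[of 0] in simp)
    with q'(2)[of 1 x] show ?thesis by simp
  qed
  have add: "q (x + y) = q x + q y" for x y
    using ge[of x y] sublinear_add[OF q(1), of x y] by simp
  have neg: "q (- x) = - q x" for x using add[of x "- x"] sublinear_zero[OF q(1)] by simp
  have "q (r *\<^sub>R x) = r * q x" for r x
  proof (cases "0 \<le> r")
    case False
    then have "q ((- r) *\<^sub>R x) = (- r) * q x" by (intro sublinear_scaleR[OF q(1)]) simp
    then show ?thesis by (simp add: neg)
  qed (simp add: sublinear_scaleR[OF q(1)])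
  then have "linear q" by (simp add: linear_iff add)
  then show thesis using q(2) by (rule that)
qed

text \<open>The functional to be extended is given along a linear map \<open>T\<close>, which need not be
  injective, so that no subspace and no functional on it has to be constructed.\<close>

theorem hahn_banach_dominated_extension:
  fixes p :: "'a::real_vector \<Rightarrow> real" and T :: "'e::real_vector \<Rightarrow> 'a"
  assumes p: "sublinear p" and T: "linear T" and \<phi>: "linear \<phi>"
    and le: "\<And>t. \<phi> t \<le> p (T t)"
  obtains f where "linear f" "\<And>x. f x \<le> p x" "\<And>t. f (T t) = \<phi> t"
proof -
  interpret T: linear T by fact
  interpret \<phi>: linear \<phi> by fact
  obtain q where q: "sublinear q" "\<And>x t. q x \<le> p (x + T t) - \<phi> t"
  proof (rule sublinear_infimal[OF p _ _ _ T \<phi>, of UNIV])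
    show "\<phi> t \<le> p (T t)" for t by (rule le)
  qed auto
  obtain f where f: "linear f" "\<And>x. f x \<le> q x" using hahn_banach_sublinear[OF q(1)] by blast
  interpret f: linear f by fact
  \<comment> \<open>The inequality at \<open>t\<close> and at \<open>- t\<close> gives equality.\<close>
  have "f (T t) \<le> \<phi> t" for t
    using f(2)[of "T t"] q(2)[of "T t" "- t"] by (simp add: T.neg \<phi>.neg sublinear_zero[OF p])
  from this this[of "- t" for t] have "f (T t) = \<phi> t" for t
    by (simp add: T.neg \<phi>.neg f.neg antisym)
  moreover have "f x \<le> p x" for x
    using f(2)[of x] q(2)[of x 0] by (simp add: T.zero \<phi>.zero)
  ultimately show thesis using that f(1) by blast
qed

section \<open>Integrals of characters\<close>

lemma cis_measurable_circle:
  "cis \<in> uniform_measure lborel {0..<2*pi} \<rightarrow>\<^sub>M restrict_space borel (sphere 0 1)"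
proof (rule measurable_restrict_space2)
  have "cis \<in> borel_measurable borel"
    by (intro borel_measurable_continuous_onI continuous_intros)
  then show "cis \<in> borel_measurable (uniform_measure lborel {0..<2*pi})"
    by (simp cong: measurable_cong_sets)
qed simp

lemma integral_circle_powi: "(LINT z|circle. z powi n) = (if n = 0 then 1 else 0)"
proof (cases "n = 0")
  case True
  have "measure circle (space circle) = 1"
    by (simp only: measure_def emeasure_circle_space enn2real_1)
  then show ?thesis using True by simp
next
  case False
  have m: "(\<lambda>z::complex. z powi n) \<in> borel_measurable (restrict_space borel (sphere 0 1))"
    by (intro borel_measurable_continuous_on_restrict continuous_intros) auto
  have "(LINT z|circle. z powi n) = (LINT t|uniform_measure lborel {0..<2*pi}. cis (of_int n * t))"
    unfolding circle_def by (subst integral_distr[OF cis_measurable_circle m]) (simp add: cis_power_int)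
  also have "uniform_measure lborel {0..<2*pi}
      = density lborel (\<lambda>t. ennreal (indicator {0..<2*pi} t / (2*pi)))"
    unfolding uniform_measure_def
    by (intro density_cong) (auto simp: indicator_def divide_ennreal[of 1 "2*pi", simplified])
  also have "(LINT t|\<dots>. cis (of_int n * t))
      = (LINT t|lborel. (indicator {0..<2*pi} t / (2*pi)) *\<^sub>R cis (of_int n * t))"
    by (intro integral_density) (auto intro!: borel_measurable_continuous_onI continuous_intros)
  also have "\<dots> = (LINT t|lborel. inverse (2*pi) *\<^sub>R (indicator {0..2*pi} t *\<^sub>R cis (of_int n * t)))"
  proof (rule integral_cong_AE)
    have *: "(\<lambda>t. cis (real_of_int n * t)) \<in> borel_measurable borel"
      by (intro borel_measurable_continuous_onI continuous_intros)
    show "(\<lambda>t. (indicator {0..<2*pi} t / (2*pi)) *\<^sub>R cis (of_int n * t)) \<in> borel_measurable lborel"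
      "(\<lambda>t. inverse (2*pi) *\<^sub>R (indicator {0..2*pi} t *\<^sub>R cis (of_int n * t))) \<in> borel_measurable lborel"
      using * by measurable
    show "AE t in lborel. (indicator {0..<2*pi} t / (2*pi)) *\<^sub>R cis (of_int n * t)
        = inverse (2*pi) *\<^sub>R (indicator {0..2*pi} t *\<^sub>R cis (of_int n * t))"
      using AE_lborel_singleton[of "2*pi"] by eventually_elim (auto simp: indicator_def field_simps)
  qed
  also have "\<dots> = inverse (2*pi) *\<^sub>R (LINT t|lborel. indicator {0..2*pi} t *\<^sub>R cis (of_int n * t))"
    by (rule integral_scaleR_right)
  also have "(LINT t|lborel. indicator {0..2*pi} t *\<^sub>R cis (of_int n * t))
      = cis (of_int n * (2*pi)) / (\<i> * of_int n) - cis (of_int n * 0) / (\<i> * of_int n)"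
  proof (rule integral_FTC_atLeastAtMost)
    fix x :: real
    have "((\<lambda>w. exp (\<i> * of_int n * w) / (\<i> * of_int n)) has_field_derivative
        exp (\<i> * of_int n * of_real x)) (at (of_real x))"
      using False by (auto intro!: derivative_eq_intros)
    from has_vector_derivative_real_field[OF this, of "{0..2*pi}"]
    show "((\<lambda>t. cis (of_int n * t) / (\<i> * of_int n)) has_vector_derivative cis (of_int n * x))
        (at x within {0..2*pi})"
      by (simp add: cis_conv_exp mult.assoc)
  qed (auto intro!: continuous_intros)
  also have "cis (of_int n * (2*pi)) = 1"
    using cis_power_int[of "2*pi" n] unfolding cis_2pi by simp
  finally show ?thesis using False by simp
qed

section \<open>Simple functions and completeness of the Bochner space\<close>

lemma L1_rel_refl [simp]: "L1_rel f f \<longleftrightarrow> bochner_integrable f"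
  by (simp add: L1_rel_def)

lemma abs_L1_eqI: "L1_rel f g \<Longrightarrow> abs_L1 f = abs_L1 g"
  by (rule Quotient_rel_abs[OF Quotient_L1])

lemma L1_cases:
  obtains f where "bochner_integrable f" "F = abs_L1 f"
  by (induction F rule: L1.abs_induct) simp

lemma norm_abs_L1_diff:
  assumes "bochner_integrable f" "bochner_integrable g"
  shows "norm (abs_L1 f - abs_L1 g) = (LINT z|circle. norm (f z - g z))"
  using assms by (simp add: minus_L1.abs_eq norm_L1.abs_eq bochner_integrable_diff)

lemma bochner_integrable_simple:
  assumes "simple_function circle s"
  shows "bochner_integrable s"
proof (rule bochner_integrable_bounded)
  show "strongly_measurable s"
    unfolding strongly_measurable_def using assms by (intro exI[of _ "\<lambda>n. s"]) auto
  have "finite ((\<lambda>z. norm (s z)) ` sphere 0 1)"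
    using simple_functionD(1)[OF assms] by (simp add: image_image[symmetric, of norm s])
  then show "norm (s z) \<le> Max ((\<lambda>z. norm (s z)) ` sphere 0 1)" if "z \<in> sphere 0 1" for z
    using that by (intro Max_ge) auto
qed

lemma integrable_norm_bochner: "bochner_integrable f \<Longrightarrow> integrable circle (\<lambda>z. norm (f z))"
  by (simp add: bochner_integrable_def)

lemma simple_functions_dense_L1:
  fixes F :: "'a::complex_normed_vector L1"
  obtains s where "\<And>n. simple_function circle (s n)" "(\<lambda>n. abs_L1 (s n)) \<longlonglongrightarrow> F"
proof -
  obtain f where f: "bochner_integrable f" and F: "F = abs_L1 f" by (rule L1_cases)
  obtain s where s: "\<And>n. simple_function circle (s n)"
    and lim: "\<And>z. z \<in> space circle \<Longrightarrow> (\<lambda>n. s n z) \<longlonglongrightarrow> f z"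
    using f unfolding bochner_integrable_def strongly_measurable_def by blast
  \<comment> \<open>Truncation makes \<open>3 |f|\<close> an integrable bound and keeps pointwise convergence, also where \<open>f\<close>
    vanishes.\<close>
  define t where "t n z = (if norm (s n z) \<le> 2 * norm (f z) then s n z else 0)" for n z
  have nf: "(\<lambda>z. norm (f z)) \<in> borel_measurable circle"
    using f by (auto simp: bochner_integrable_def intro: strongly_measurable_norm)
  have t: "simple_function circle (t n)" for n
  proof -
    have "(\<lambda>z. norm (s n z)) \<in> borel_measurable circle"
      by (rule borel_measurable_simple_function[OF simple_function_compose1[OF s]])
    with nf have "{z \<in> space circle. norm (s n z) \<le> 2 * norm (f z)} \<in> sets circle"
      by measurable
    then show ?thesis unfolding t_def by (intro simple_function_If s simple_function_const)
  qed
  have tlim: "(\<lambda>n. t n z) \<longlonglongrightarrow> f z" if z: "z \<in> space circle" for z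
  proof (cases "f z = 0")
    case True
    then have "t n z = 0" for n by (simp add: t_def)
    with True show ?thesis by simp
  next
    case False
    have "(\<lambda>n. norm (s n z)) \<longlonglongrightarrow> norm (f z)" by (rule tendsto_norm[OF lim[OF z]])
    moreover have "norm (f z) < 2 * norm (f z)" using False by simp
    ultimately have "\<forall>\<^sub>F n in sequentially. norm (s n z) < 2 * norm (f z)"
      by (rule order_tendstoD(2))
    then have "\<forall>\<^sub>F n in sequentially. s n z = t n z"
      by eventually_elim (simp add: t_def)
    with lim[OF z] show ?thesis by (rule Lim_transform_eventually)
  qed
  have bd: "bochner_integrable (\<lambda>z. t n z - f z)" for n
    by (rule bochner_integrable_diff[OF bochner_integrable_simple[OF t] f])
  have "(\<lambda>n. LINT z|circle. norm (t n z - f z)) \<longlonglongrightarrow> (LINT z|circle. (0::real))"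
  proof (rule integral_dominated_convergence)
    show "integrable circle (\<lambda>z. 3 * norm (f z))" using f by (simp add: bochner_integrable_def)
    show "(\<lambda>z. norm (t n z - f z)) \<in> borel_measurable circle" for n
      using integrable_norm_bochner[OF bd] by (rule borel_measurable_integrable)
    show "AE z in circle. (\<lambda>n. norm (t n z - f z)) \<longlonglongrightarrow> 0"
      using tendsto_norm_zero[OF LIM_zero[OF tlim]] by (intro AE_I2)
    have "norm (t n z - f z) \<le> 3 * norm (f z)" for n z
      using norm_triangle_ineq4[of "t n z" "f z"] norm_ge_zero[of "f z"]
      by (simp add: t_def split: if_splits)
    then show "AE z in circle. norm (norm (t n z - f z)) \<le> 3 * norm (f z)" for n by simp
  qed simp
  then have "(\<lambda>n. norm (abs_L1 (t n) - F)) \<longlonglongrightarrow> 0"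
    by (simp add: F norm_abs_L1_diff[OF bochner_integrable_simple[OF t] f])
  then have "(\<lambda>n. abs_L1 (t n)) \<longlonglongrightarrow> F" by (simp add: LIM_zero_iff tendsto_norm_zero_iff)
  with t show thesis by (rule that)
qed

text \<open>A sequence of simple functions with summable increments converges almost everywhere and
  in \<open>L\<^sup>1\<close>.  Resetting the functions to zero on the exceptional null set keeps them simple, so
  the limit is strongly measurable by definition.\<close>

lemma simple_functions_summable_increments:
  fixes t :: "nat \<Rightarrow> complex \<Rightarrow> 'a::complex_banach"
  assumes t: "\<And>n. simple_function circle (t n)"
    and sum: "summable (\<lambda>n. norm (abs_L1 (t (Suc n)) - abs_L1 (t n)))"
  shows "convergent (\<lambda>n. abs_L1 (t n))"
proof -
  define d where "d n z = norm (t (Suc n) z - t n z)" for n z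
  have bt: "bochner_integrable (t n)" for n by (rule bochner_integrable_simple[OF t])
  have int: "integrable circle (d n)" for n
    unfolding d_def by (intro integrable_norm_bochner bochner_integrable_diff bt)
  have [measurable]: "d n \<in> borel_measurable circle" for n
    by (rule borel_measurable_integrable[OF int])
  have nn: "norm (abs_L1 (t (Suc n)) - abs_L1 (t n)) = (LINT z|circle. d n z)" for n
    by (simp add: norm_abs_L1_diff[OF bt bt] d_def)
  \<comment> \<open>Monotone convergence: the sum of the increments has a finite integral.\<close>
  have AEs: "AE z in circle. summable (\<lambda>n. d n z)"
  proof -
    have "(\<integral>\<^sup>+z. (\<Sum>n. ennreal (d n z)) \<partial>circle) = (\<Sum>n. \<integral>\<^sup>+z. ennreal (d n z) \<partial>circle)"
      by (rule nn_integral_suminf) measurable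
    also have "\<dots> = (\<Sum>n. ennreal (LINT z|circle. d n z))"
      by (intro suminf_cong nn_integral_eq_integral[OF int]) (simp add: d_def)
    also have "\<dots> = ennreal (\<Sum>n. LINT z|circle. d n z)"
      using sum by (intro suminf_ennreal2) (auto simp: nn d_def)
    finally have "(\<integral>\<^sup>+z. (\<Sum>n. ennreal (d n z)) \<partial>circle) \<noteq> \<infinity>" by simp
    then have "AE z in circle. (\<Sum>n. ennreal (d n z)) \<noteq> \<infinity>"
      by (intro nn_integral_PInf_AE) measurable
    then show ?thesis
      by eventually_elim (auto intro!: summable_suminf_not_top simp: d_def)
  qed
  then obtain N where N: "N \<in> null_sets circle"
      "{z \<in> space circle. \<not> summable (\<lambda>n. d n z)} \<subseteq> N"
    by (auto elim!: AE_E simp: null_sets_def)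
  define t' where "t' n z = (if z \<in> N then 0 else t n z)" for n z
  have t': "simple_function circle (t' n)" for n
    unfolding t'_def
    by (rule simple_function_If_set[OF simple_function_const t sets.Int[OF null_setsD2[OF N(1)] sets.top]])
  have cau: "summable (\<lambda>n. norm (t' (Suc n) z - t' n z))" if "z \<in> space circle" for z
    
  proof (cases "z \<in> N")
    case False
    with N(2) that have "summable (\<lambda>n. d n z)" by blast
    with False show ?thesis by (simp add: t'_def d_def)
  qed (simp add: t'_def)
  define g where "g z = lim (\<lambda>n. t' n z)" for z
  have tel: "(\<lambda>k. t' (k + n) z) \<longlonglongrightarrow> t' n z + (\<Sum>k. t' (Suc (k + n)) z - t' (k + n) z)"
    if "z \<in> space circle" for n z
  proof -
    define h where "h k = t' (k + n) z" for k
    have "summable (\<lambda>k. norm (t' (Suc (k + n)) z - t' (k + n) z))"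
      using cau[OF that] by (rule summable_ignore_initial_segment)
    then have "summable (\<lambda>k. h (Suc k) - h k)"
      unfolding h_def add_Suc by (rule summable_norm_cancel)
    from tendsto_add[OF tendsto_const[of "h 0"] summable_LIMSEQ[OF this]]
    have "h \<longlonglongrightarrow> h 0 + (\<Sum>k. h (Suc k) - h k)"
      unfolding sum_lessThan_telescope by simp
    then show ?thesis by (simp add: h_def [abs_def])
  qed
  have glim: "(\<lambda>n. t' n z) \<longlonglongrightarrow> g z" if "z \<in> space circle" for z
  proof -
    have "convergent (\<lambda>n. t' n z)" using tel[OF that, of 0] by (auto simp: convergent_def)
    then show ?thesis unfolding g_def by (simp only: convergent_LIMSEQ_iff)
  qed
  have gle: "norm (t' n z - g z) \<le> (\<Sum>k. norm (t' (Suc k) z - t' k z))" if z: "z \<in> space circle" for n z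
  proof -
    have "g z = t' n z + (\<Sum>k. t' (Suc (k + n)) z - t' (k + n) z)"
      by (rule LIMSEQ_unique[OF LIMSEQ_ignore_initial_segment[OF glim[OF z]] tel[OF z]])
    then have "norm (t' n z - g z) = norm (\<Sum>k. t' (Suc (k + n)) z - t' (k + n) z)"
      by simp
    also have "\<dots> \<le> (\<Sum>k. norm (t' (Suc (k + n)) z - t' (k + n) z))"
      using cau[OF z] by (intro summable_norm summable_ignore_initial_segment[where k = n])
    also have "\<dots> \<le> (\<Sum>k. norm (t' (Suc k) z - t' k z))"
      using suminf_minus_initial_segment[OF cau[OF z], of n]
      by (simp add: sum_nonneg)
    finally show ?thesis .
  qed
  have sg: "strongly_measurable g"
    unfolding strongly_measurable_def using t' glim by blast
  have st: "strongly_measurable (t' n)" for n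
    using bochner_integrable_simple[OF t'] by (simp add: bochner_integrable_def)
  have AEN: "AE z in circle. z \<notin> N" using N(1) by (rule AE_not_in)
  define W where "W z = (\<Sum>n. d n z)" for z
  have intW: "integrable circle W"
    unfolding W_def
    by (rule integrable_suminf[OF int]) (use AEs sum in \<open>simp_all add: nn d_def\<close>)
  have bound: "AE z in circle. norm (t' n z - g z) \<le> W z" for n
    using AEN AE_space
  proof eventually_elim
    case (elim z)
    then show ?case using gle[of z n] by (simp add: t'_def d_def W_def)
  qed
  have sd: "strongly_measurable (\<lambda>z. t' n z - g z)" for n
    using strongly_measurable_add[OF st strongly_measurable_scaleC[OF strongly_measurable_const[of "-1"] sg], of n]
    by (simp add: scaleC_minus_one)
  have bd: "bochner_integrable (\<lambda>z. t' n z - g z)" for n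
    unfolding bochner_integrable_def
  proof
    have "AE z in circle. norm (norm (t' n z - g z)) \<le> norm (W z)"
      using bound[of n] by eventually_elim simp
    then show "integrable circle (\<lambda>z. norm (t' n z - g z))"
      by (rule Bochner_Integration.integrable_bound[OF intW strongly_measurable_norm[OF sd]])
  qed (rule sd)
  have bg: "bochner_integrable g"
    using bochner_integrable_diff[OF bochner_integrable_simple[OF t'] bd, of 0 0] by simp
  have "(\<lambda>n. LINT z|circle. norm (t' n z - g z)) \<longlonglongrightarrow> (LINT z|circle. (0::real))"
  proof (rule integral_dominated_convergence[OF _ _ intW])
    show "(\<lambda>z. norm (t' n z - g z)) \<in> borel_measurable circle" for n
      by (rule strongly_measurable_norm[OF sd])
    show "AE z in circle. (\<lambda>n. norm (t' n z - g z)) \<longlonglongrightarrow> 0"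
      using tendsto_norm_zero[OF LIM_zero[OF glim]] by (intro AE_I2)
    show "AE z in circle. norm (norm (t' n z - g z)) \<le> W z" for n using bound by simp
  qed simp
  then have "(\<lambda>n. norm (abs_L1 (t' n) - abs_L1 g)) \<longlonglongrightarrow> 0"
    by (simp add: norm_abs_L1_diff[OF bochner_integrable_simple[OF t'] bg])
  then have "(\<lambda>n. abs_L1 (t' n)) \<longlonglongrightarrow> abs_L1 g" by (simp add: LIM_zero_iff tendsto_norm_zero_iff)
  moreover have "abs_L1 (t' n) = abs_L1 (t n)" for n
  proof -
    have "AE z in circle. t' n z = t n z" using AEN by eventually_elim (simp add: t'_def)
    then have "L1_rel (t' n) (t n)"
      by (intro L1_relI bt bochner_integrable_simple[OF t'])
    then show ?thesis by (rule abs_L1_eqI)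
  qed
  ultimately show ?thesis by (auto simp: convergent_def)
qed

lemma Cauchy_L1_convergent:
  fixes X :: "nat \<Rightarrow> 'a::complex_banach L1"
  assumes "Cauchy X"
  shows "convergent X"
proof -
  \<comment> \<open>Replacing the terms by simple functions reduces the claim to simple functions.\<close>
  have "\<exists>s. simple_function circle s \<and> norm (X n - abs_L1 s) < (1/2) ^ n" for n
  proof -
    obtain s where s: "\<And>k. simple_function circle (s k)" "(\<lambda>k. abs_L1 (s k)) \<longlonglongrightarrow> X n"
      using simple_functions_dense_L1[of "X n"] by blast
    obtain m where "\<forall>k\<ge>m. norm (abs_L1 (s k) - X n) < (1/2) ^ n"
      using LIMSEQ_D[OF s(2), of "(1/2) ^ n"] by auto
    then have "norm (X n - abs_L1 (s m)) < (1/2) ^ n" by (simp add: norm_minus_commute)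
    with s(1) show ?thesis by blast
  qed
  then obtain s where s: "\<And>n. simple_function circle (s n)" "\<And>n. norm (X n - abs_L1 (s n)) < (1/2) ^ n"
    by metis
  obtain r where r: "strict_mono r" "\<And>n. \<forall>i\<ge>r n. \<forall>j\<ge>r n. norm (X i - X j) < (1/2) ^ n"
  proof -
    have "\<exists>N. \<forall>i\<ge>N. \<forall>j\<ge>N. norm (X i - X j) < (1/2) ^ n" for n
      using assms by (intro CauchyD) auto
    then obtain N where N: "\<And>n. \<forall>i\<ge>N n. \<forall>j\<ge>N n. norm (X i - X j) < (1/2) ^ n" by metis
    define r where "r n = (\<Sum>i\<le>n. N i) + n" for n
    have "strict_mono r" by (rule strict_mono_Suc_iff[THEN iffD2]) (simp add: r_def)
    moreover have "N n \<le> r n" for n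
      using member_le_sum[of n "{..n}" N] by (simp add: r_def trans_le_add1)
    then have "\<forall>i\<ge>r n. \<forall>j\<ge>r n. norm (X i - X j) < (1/2) ^ n" for n
      using N[of n] le_trans by blast
    ultimately show thesis by (rule that)
  qed
  have rn: "n \<le> r n" for n by (rule seq_suble[OF r(1)])
  have half: "(1/2) ^ r n \<le> ((1/2) ^ m :: real)" if "m \<le> n" for m n
    using rn[of n] that by (intro power_decreasing) auto
  have conv: "convergent (\<lambda>n. abs_L1 (s (r n)))"
  proof (rule simple_functions_summable_increments)
    have "norm (abs_L1 (s (r (Suc n))) - abs_L1 (s (r n))) \<le> 3 * (1/2) ^ n" for n
    proof -
      have "norm (X (r (Suc n)) - X (r n)) < (1/2) ^ n"
        using r(2)[of n] strict_monoD[OF r(1), of n "Suc n"] by simp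
      moreover have "norm (X (r (Suc n)) - abs_L1 (s (r (Suc n)))) < (1/2) ^ n"
        by (rule less_le_trans[OF s(2) half]) simp
      moreover have "norm (X (r n) - abs_L1 (s (r n))) < (1/2) ^ n"
        by (rule less_le_trans[OF s(2) half]) simp
      moreover have "abs_L1 (s (r (Suc n))) - abs_L1 (s (r n)) = (X (r (Suc n)) - X (r n))
          - (X (r (Suc n)) - abs_L1 (s (r (Suc n)))) + (X (r n) - abs_L1 (s (r n)))" by simp
      ultimately show ?thesis
        using norm_triangle_ineq[of "(X (r (Suc n)) - X (r n)) - (X (r (Suc n)) - abs_L1 (s (r (Suc n))))"
            "X (r n) - abs_L1 (s (r n))"]
          norm_triangle_ineq4[of "X (r (Suc n)) - X (r n)" "X (r (Suc n)) - abs_L1 (s (r (Suc n)))"]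
        by simp
    qed
    then have le: "norm (norm (abs_L1 (s (r (Suc n))) - abs_L1 (s (r n)))) \<le> 3 * (1/2) ^ n" for n
      by simp
    have "summable (\<lambda>n. 3 * (1/2) ^ n :: real)" by (intro summable_mult summable_geometric) simp
    then show "summable (\<lambda>n. norm (abs_L1 (s (r (Suc n))) - abs_L1 (s (r n))))"
      by (rule summable_comparison_test'[where N = 0]) (rule le)
  qed (rule s(1))
  then obtain G where G: "(\<lambda>n. abs_L1 (s (r n))) \<longlonglongrightarrow> G" by (auto simp: convergent_def)
  have "(\<lambda>n. X (r n) - abs_L1 (s (r n))) \<longlonglongrightarrow> 0"
  proof (rule Lim_null_comparison)
    show "\<forall>\<^sub>F n in sequentially. norm (X (r n) - abs_L1 (s (r n))) \<le> (1/2) ^ n"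
      by (rule always_eventually, rule allI, rule less_imp_le, rule less_le_trans[OF s(2) half]) simp
    show "(\<lambda>n. (1/2) ^ n :: real) \<longlonglongrightarrow> 0" by (rule LIMSEQ_power_zero) simp
  qed
  from tendsto_add[OF this G] have "(X \<circ> r) \<longlonglongrightarrow> G" by (simp add: o_def)
  from Cauchy_converges_subseq[OF assms r(1) this] show ?thesis by (auto simp: convergent_def)
qed

instance L1 :: (complex_banach) complex_banach
  by standard (rule Cauchy_L1_convergent)

section \<open>Bilinear forms on the Bochner space\<close>

lemma cbilinear_add_left: "cbilinear B \<Longrightarrow> B (x + x') y = B x y + B x' y"
  and cbilinear_add_right: "cbilinear B \<Longrightarrow> B x (y + y') = B x y + B x y'"
  and cbilinear_scaleC_left: "cbilinear B \<Longrightarrow> B (c *\<^sub>C x) y = c *\<^sub>C B x y"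
  and cbilinear_scaleC_right: "cbilinear B \<Longrightarrow> B x (c *\<^sub>C y) = c *\<^sub>C B x y"
  by (simp_all add: cbilinear_def)

lemma cbilinear_zero_left: "cbilinear B \<Longrightarrow> B 0 y = 0"
  using cbilinear_scaleC_left[of B 0 0 y] by simp

lemma cbilinear_zero_right: "cbilinear B \<Longrightarrow> B x 0 = 0"
  using cbilinear_scaleC_right[of B x 0 0] by simp

lemma cbilinear_diff_left: "cbilinear B \<Longrightarrow> B (x - x') y = B x y - B x' y"
  using cbilinear_add_left[of B "x - x'" x' y] by simp

lemma cbilinear_scaleR_left: "cbilinear B \<Longrightarrow> B (r *\<^sub>R x) y = r *\<^sub>R B x y"
  using cbilinear_scaleC_left[of B "complex_of_real r" x y] by (simp add: scaleC_of_real)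

lemma cbilinear_sum_left: "cbilinear B \<Longrightarrow> B (\<Sum>i\<in>I. f i) y = (\<Sum>i\<in>I. B (f i) y)"
  by (induction I rule: infinite_finite_induct) (simp_all add: cbilinear_zero_left cbilinear_add_left)

lemma cbilinear_tendsto_sum_list:
  assumes B: "cbilinear B" and bd: "\<And>x y. norm (B x y) \<le> K * (norm x * norm y)"
    and lim: "\<And>x. (\<lambda>n. a x n) \<longlonglongrightarrow> x"
  shows "(\<lambda>n. \<Sum>(x, y)\<leftarrow>l. B (a x n) y) \<longlonglongrightarrow> (\<Sum>(x, y)\<leftarrow>l. B x y)"
proof -
  have "(\<lambda>n. B (a x n) y) \<longlonglongrightarrow> B x y" for x y
  proof -
    have "(\<lambda>n. K * (norm (a x n - x) * norm y)) \<longlonglongrightarrow> K * (0 * norm y)"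
      by (intro tendsto_intros tendsto_norm_zero LIM_zero lim)
    then have "(\<lambda>n. B (a x n) y - B x y) \<longlonglongrightarrow> 0"
      by (intro Lim_null_comparison[OF always_eventually[OF allI, OF bd[of "a x n - x" y for n]],
            unfolded cbilinear_diff_left[OF B]]) simp
    then show ?thesis by (simp add: LIM_zero_iff)
  qed
  then show ?thesis by (induction l) (auto intro!: tendsto_add)
qed

lemma cbilinear_L1_times: "cbilinear (L1_times :: complex L1 \<Rightarrow> 'a \<Rightarrow> 'a::complex_normed_vector L1)"
proof -
  have I: "bochner_integrable f" if "L1_rel f f" for f :: "complex \<Rightarrow> complex"
    using that by simp
  have "L1_times (h + h') x = L1_times h x + L1_times h' x" for h h' and x :: 'a
    by transfer (auto simp: L1_rel_def scaleC_add_left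
        intro!: bochner_integrable_add bochner_integrable_scaleC_const)
  moreover have "L1_times (c *\<^sub>C h) x = c *\<^sub>C L1_times h x" for c h and x :: 'a
  proof transfer
    fix c and h :: "complex \<Rightarrow> complex" and x :: 'a assume "L1_rel h h"
    from bochner_integrable_scaleC[OF bochner_integrable_scaleC_const[OF I[OF this]], of c x]
    show "L1_rel (\<lambda>z. (c *\<^sub>C h z) *\<^sub>C x) (\<lambda>z. c *\<^sub>C h z *\<^sub>C x)"
      by (simp add: scaleC_scaleC scaleC_complex_def)
  qed
  moreover have "L1_times h (x + x') = L1_times h x + L1_times h x'" for h and x x' :: 'a
    by transfer (auto simp: L1_rel_def scaleC_add_right
        intro!: bochner_integrable_add bochner_integrable_scaleC_const)
  moreover have "L1_times h (c *\<^sub>C x) = c *\<^sub>C L1_times h x" for c h and x :: 'a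
  proof transfer
    fix c and h :: "complex \<Rightarrow> complex" and x :: 'a assume "L1_rel h h"
    from bochner_integrable_scaleC[OF bochner_integrable_scaleC_const[OF I[OF this]], of c x]
    show "L1_rel (\<lambda>z. h z *\<^sub>C c *\<^sub>C x) (\<lambda>z. c *\<^sub>C h z *\<^sub>C x)"
      by (simp add: scaleC_scaleC mult.commute)
  qed
  ultimately show ?thesis by (simp add: cbilinear_def)
qed

text \<open>Finitely many simple functions are functions of a single one, whose values are lists.\<close>

lemma simple_functions_common_refinement:
  fixes ls :: "((complex \<Rightarrow> complex) \<times> 'a) list"
  assumes "\<And>s x. (s, x) \<in> set ls \<Longrightarrow> simple_function circle s"
  obtains S :: "complex \<Rightarrow> complex list" and l
  where "simple_function circle S" "ls = map (\<lambda>(u, x). (u \<circ> S, x)) l"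
proof -
  have "\<forall>p\<in>set ls. simple_function circle (fst p)" using assms by auto
  then have "\<exists>(S :: complex \<Rightarrow> complex list) l. simple_function circle S \<and> ls = map (\<lambda>(u, x). (u \<circ> S, x)) l"
  proof (induction ls)
    case Nil
    show ?case by (intro exI[of _ "\<lambda>z. []"] exI[of _ "[]"]) simp
  next
    case (Cons p ls)
    obtain s x where p: "p = (s, x)" by (cases p)
    have s: "simple_function circle s" and ls: "\<forall>p\<in>set ls. simple_function circle (fst p)"
      using Cons.prems by (auto simp: p)
    from Cons.IH[OF ls] obtain S :: "complex \<Rightarrow> complex list" and l
      where S: "simple_function circle S" and l: "ls = map (\<lambda>(u, x). (u \<circ> S, x)) l"
      by (elim exE conjE) (rule that)
    show ?case
    proof (intro exI conjI)
      show "simple_function circle (\<lambda>z. s z # S z)"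
        by (rule simple_function_compose2[OF s S])
      show "p # ls = map (\<lambda>(u, x). (u \<circ> (\<lambda>z. s z # S z), x)) ((hd, x) # map (\<lambda>(u, x). (u \<circ> tl, x)) l)"
        by (auto simp: p l o_def)
    qed
  qed
  with that show thesis by blast
qed

text \<open>On the level sets \<open>A c\<close> of \<open>S\<close> all the functions \<open>u \<circ> S\<close> are constant.  There the form takes the
  value \<open>B (1\<^bsub>A c\<^esub>, y c)\<close>, and the norms \<open>m(A c) \<parallel>y c\<parallel>\<close> add up to the norm in \<open>L\<^sup>1(X)\<close>.\<close>

lemma L1_tensor_bound_simple:
  fixes B :: "complex L1 \<Rightarrow> 'a::complex_normed_vector \<Rightarrow> complex" and S :: "complex \<Rightarrow> 'c"
  assumes B: "cbilinear B" and bd: "\<And>f x. cmod (B f x) \<le> K * (norm f * norm x)"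
    and S: "simple_function circle S"
  shows "cmod (\<Sum>(u, x)\<leftarrow>l. B (abs_L1 (u \<circ> S)) x)
    \<le> K * norm (\<Sum>(u, x)\<leftarrow>l. L1_times (abs_L1 (u \<circ> S)) x)"
proof -
  define R where "R = S ` space circle"
  have R: "finite R" unfolding R_def by (rule simple_functionD(1)[OF S])
  define A where "A c = S -` {c} \<inter> space circle" for c
  have A: "A c \<in> sets circle" for c unfolding A_def by (rule simple_functionD(2)[OF S])
  define e where "e c = abs_L1 (indicator (A c) :: complex \<Rightarrow> complex)" for c
  have bi: "bochner_integrable (indicator (A c) :: complex \<Rightarrow> complex)" for c
    by (rule bochner_integrable_simple[OF simple_function_indicator[OF A]])
  have ni: "norm (indicator (A c) z :: complex) = indicator (A c) z" for c z
    by (simp add: indicator_def)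
  have bS: "bochner_integrable (\<lambda>z. g (S z))" for g :: "'c \<Rightarrow> 'd::complex_normed_vector"
    by (rule bochner_integrable_simple[OF simple_function_compose1[OF S]])
  have split: "g (S z) = (\<Sum>c\<in>R. indicator (A c) z *\<^sub>R g c)" if "z \<in> space circle"
    for g :: "'c \<Rightarrow> 'd::real_vector" and z
  proof -
    have "(\<Sum>c\<in>R. indicator (A c) z *\<^sub>R g c) = (\<Sum>c\<in>R. if c = S z then g c else 0)"
      using that by (intro sum.cong) (auto simp: A_def indicator_def)
    also have "\<dots> = g (S z)" using R that by (simp add: R_def)
    finally show ?thesis ..
  qed
  have sum_abs: "(\<Sum>c\<in>C. u c *\<^sub>C e c) = abs_L1 (\<lambda>z. \<Sum>c\<in>C. u c * indicator (A c) z)"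
    and sum_int: "bochner_integrable (\<lambda>z. \<Sum>c\<in>C. u c * indicator (A c) z)"
    if "finite C" for C and u :: "'c \<Rightarrow> complex"
  proof -
    have i: "bochner_integrable (\<lambda>z. u c * indicator (A c) z)" for c
      using bochner_integrable_scaleC[OF bi, of "u c" c] by (simp add: scaleC_complex_def)
    show I: "bochner_integrable (\<lambda>z. \<Sum>c\<in>C. u c * indicator (A c) z)" for C
      by (intro bochner_integrable_sum i)
    show "(\<Sum>c\<in>C. u c *\<^sub>C e c) = abs_L1 (\<lambda>z. \<Sum>c\<in>C. u c * indicator (A c) z)"
      using that
    proof (induction C)
      case empty
      show ?case by (simp add: zero_L1_def)
    next
      case (insert c C)
      have "u c *\<^sub>C e c = abs_L1 (\<lambda>z. u c * indicator (A c) z)"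
        by (simp add: e_def scaleC_L1.abs_eq[OF bi[THEN iffD2[OF L1_rel_refl]]] scaleC_complex_def)
      then have "(\<Sum>c\<in>insert c C. u c *\<^sub>C e c)
          = abs_L1 (\<lambda>z. u c * indicator (A c) z) + abs_L1 (\<lambda>z. \<Sum>c\<in>C. u c * indicator (A c) z)"
        by (simp only: sum.insert[OF insert.hyps] insert.IH)
      also have "\<dots> = abs_L1 (\<lambda>z. u c * indicator (A c) z + (\<Sum>c\<in>C. u c * indicator (A c) z))"
        by (rule plus_L1.abs_eq; simp only: L1_rel_refl i I)
      finally show ?case by (simp only: sum.insert[OF insert.hyps])
    qed
  qed
  have dec: "abs_L1 (u \<circ> S) = (\<Sum>c\<in>R. u c *\<^sub>C e c)" for u :: "'c \<Rightarrow> complex"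
  proof -
    have "(u \<circ> S) z = (\<Sum>c\<in>R. u c * indicator (A c) z)" if "z \<in> space circle" for z
    proof -
      have "(u \<circ> S) z = (\<Sum>c\<in>R. indicator (A c) z *\<^sub>R u c)"
        using split[OF that, of u] by simp
      also have "\<dots> = (\<Sum>c\<in>R. u c * indicator (A c) z)"
        by (intro sum.cong) (auto simp: indicator_def)
      finally show ?thesis .
    qed
    then have "AE z in circle. (u \<circ> S) z = (\<Sum>c\<in>R. u c * indicator (A c) z)"
      by (intro AE_I2)
    then have "L1_rel (u \<circ> S) (\<lambda>z. \<Sum>c\<in>R. u c * indicator (A c) z)"
      using bS[of u] by (intro L1_relI sum_int R) (simp_all add: o_def)
    then show ?thesis unfolding sum_abs[OF R] by (rule abs_L1_eqI)
  qed
  define y where "y l c = (\<Sum>(u, x)\<leftarrow>l. u c *\<^sub>C x)" for l :: "(('c \<Rightarrow> complex) \<times> 'a) list" and c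
  have "(\<Sum>(u, x)\<leftarrow>l. B (abs_L1 (u \<circ> S)) x) = (\<Sum>c\<in>R. B (e c) (y l c))"
  proof (induction l)
    case Nil
    show ?case by (simp add: y_def cbilinear_zero_right[OF B])
  next
    case (Cons p l)
    obtain u x where p: "p = (u, x)" by (cases p)
    have "B (abs_L1 (u \<circ> S)) x = (\<Sum>c\<in>R. B (e c) (u c *\<^sub>C x))"
      by (simp add: dec cbilinear_sum_left[OF B] cbilinear_scaleC_left[OF B] cbilinear_scaleC_right[OF B])
    with Cons show ?case
      by (simp add: p y_def cbilinear_add_right[OF B] sum.distrib del: o_apply comp_apply)
  qed
  moreover have "(\<Sum>(u, x)\<leftarrow>l. L1_times (abs_L1 (u \<circ> S)) x) = abs_L1 (\<lambda>z. y l (S z))"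
  proof (induction l)
    case Nil
    show ?case by (simp add: y_def zero_L1_def)
  next
    case (Cons p l)
    obtain u x where p: "p = (u, x)" by (cases p)
    have "L1_times (abs_L1 (u \<circ> S)) x = abs_L1 (\<lambda>z. u (S z) *\<^sub>C x)"
      using bS[of u] by (simp add: L1_times.abs_eq o_def)
    then have "(\<Sum>(u, x)\<leftarrow>p # l. L1_times (abs_L1 (u \<circ> S)) x)
        = abs_L1 (\<lambda>z. u (S z) *\<^sub>C x) + abs_L1 (\<lambda>z. y l (S z))"
      by (simp only: p list.map sum_list.Cons prod.case Cons.IH)
    also have "\<dots> = abs_L1 (\<lambda>z. u (S z) *\<^sub>C x + y l (S z))"
      using bS[of "\<lambda>c. u c *\<^sub>C x"] bS[of "y l"] by (intro plus_L1.abs_eq) (simp_all only: L1_rel_refl)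
    finally show ?case by (simp only: p y_def list.map sum_list.Cons prod.case)
  qed
  moreover have "norm (abs_L1 (\<lambda>z. y l (S z))) = (\<Sum>c\<in>R. norm (e c) * norm (y l c))"
  proof -
    have "norm (abs_L1 (\<lambda>z. y l (S z))) = (LINT z|circle. norm (y l (S z)))"
      by (simp add: norm_L1.abs_eq bS)
    also have "\<dots> = (LINT z|circle. (\<Sum>c\<in>R. indicator (A c) z *\<^sub>R norm (y l c)))"
      by (rule Bochner_Integration.integral_cong[OF refl]) (rule split[of _ "\<lambda>c. norm (y l c)"])
    also have "\<dots> = (\<Sum>c\<in>R. (LINT z|circle. indicator (A c) z *\<^sub>R norm (y l c)))"
      using integrable_norm_bochner[OF bi]
      by (intro Bochner_Integration.integral_sum) (auto simp: ni) 
    also have "\<dots> = (\<Sum>c\<in>R. norm (e c) * norm (y l c))"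
      using integrable_norm_bochner[OF bi]
      by (simp add: e_def norm_L1.abs_eq bi ni)
    finally show ?thesis .
  qed
  moreover have "cmod (\<Sum>c\<in>R. B (e c) (y l c)) \<le> (\<Sum>c\<in>R. K * (norm (e c) * norm (y l c)))"
    by (intro sum_norm_le bd)
  ultimately show ?thesis by (simp add: sum_distrib_left)
qed

text \<open>The projective norm of \<open>L\<^sup>1 \<otimes> X\<close> is at most the norm of \<open>L\<^sup>1(X)\<close>, in dual form.\<close>

lemma L1_tensor_bound:
  fixes B :: "complex L1 \<Rightarrow> 'a::complex_normed_vector \<Rightarrow> complex"
  assumes B: "cbilinear B" and bd: "\<And>f x. cmod (B f x) \<le> K * (norm f * norm x)"
  shows "cmod (\<Sum>(f, x)\<leftarrow>l. B f x) \<le> K * norm (\<Sum>(f, x)\<leftarrow>l. L1_times f x)"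
proof -
  have "\<exists>s. (\<forall>n. simple_function circle (s n)) \<and> (\<lambda>n. abs_L1 (s n)) \<longlonglongrightarrow> f" for f :: "complex L1"
    using simple_functions_dense_L1[of f] by blast
  then obtain a where a: "\<And>f n. simple_function circle (a f n)"
    "\<And>f :: complex L1. (\<lambda>n. abs_L1 (a f n)) \<longlonglongrightarrow> f" by metis
  have le: "cmod (\<Sum>(f, x)\<leftarrow>l. B (abs_L1 (a f n)) x)
      \<le> K * norm (\<Sum>(f, x)\<leftarrow>l. L1_times (abs_L1 (a f n)) x)" for n
  proof -
    obtain S :: "complex \<Rightarrow> complex list" and l' where S: "simple_function circle S"
      and l': "map (\<lambda>(f, x). (a f n, x)) l = map (\<lambda>(u, x). (u \<circ> S, x)) l'"
      by (rule simple_functions_common_refinement[of "map (\<lambda>(f, x). (a f n, x)) l"]) (auto simp: a(1))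
    have "(\<Sum>(f, x)\<leftarrow>l. B (abs_L1 (a f n)) x) = (\<Sum>(u, x)\<leftarrow>l'. B (abs_L1 (u \<circ> S)) x)"
      using arg_cong[OF l', of "\<lambda>k. \<Sum>(s, x)\<leftarrow>k. B (abs_L1 s) x"]
      by (simp add: o_def split_def)
    moreover have "(\<Sum>(f, x)\<leftarrow>l. L1_times (abs_L1 (a f n)) x) = (\<Sum>(u, x)\<leftarrow>l'. L1_times (abs_L1 (u \<circ> S)) x)"
      using arg_cong[OF l', of "\<lambda>k. \<Sum>(s, x)\<leftarrow>k. L1_times (abs_L1 s) x"]
      by (simp add: o_def split_def)
    ultimately show ?thesis using L1_tensor_bound_simple[OF B bd S, of l'] by simp
  qed
  show ?thesis
  proof (rule LIMSEQ_le)
    show "(\<lambda>n. cmod (\<Sum>(f, x)\<leftarrow>l. B (abs_L1 (a f n)) x)) \<longlonglongrightarrow> cmod (\<Sum>(f, x)\<leftarrow>l. B f x)"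
      by (intro tendsto_norm cbilinear_tendsto_sum_list[OF B bd a(2)])
    show "(\<lambda>n. K * norm (\<Sum>(f, x)\<leftarrow>l. L1_times (abs_L1 (a f n)) x))
        \<longlonglongrightarrow> K * norm (\<Sum>(f, x)\<leftarrow>l. L1_times f x)"
      by (intro tendsto_intros cbilinear_tendsto_sum_list[OF cbilinear_L1_times _ a(2), of 1])
        (simp add: norm_L1_times)
  qed (use le in blast)
qed

section \<open>Operators into a dual space\<close>

lemma complex_linear_real_linear:
  assumes "\<And>x y. \<Phi> (x + y) = \<Phi> x + \<Phi> y" "\<And>c x. \<Phi> (c *\<^sub>C x) = c *\<^sub>C \<Phi> x"
  shows "linear (\<Phi> :: 'a::complex_normed_vector \<Rightarrow> 'b::complex_normed_vector)"
  using assms(1) assms(2)[of "complex_of_real r" for r] by (simp add: linear_iff scaleC_of_real)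

text \<open>The complex linear functional with real part \<open>f\<close>, namely \<open>x \<mapsto> f x - i f (i x)\<close>.\<close>

definition complexify :: "('a::complex_normed_vector \<Rightarrow> real) \<Rightarrow> 'a \<Rightarrow> complex"
  where "complexify f x = Complex (f x) (- f (\<i> *\<^sub>C x))"

lemma Re_complexify [simp]: "Re (complexify f x) = f x"
  by (simp add: complexify_def)

lemma complexify_add: "linear f \<Longrightarrow> complexify f (x + y) = complexify f x + complexify f y"
  by (simp add: complexify_def linear_add scaleC_add_right complex_eq_iff)

lemma complexify_scaleC:
  assumes "linear f"
  shows "complexify f (c *\<^sub>C x) = c *\<^sub>C complexify f x"
proof -
  have *: "f (c *\<^sub>C x) = Re c * f x + Im c * f (\<i> *\<^sub>C x)" for c x
  proof -
    have "c *\<^sub>C x = Re c *\<^sub>R x + Im c *\<^sub>R (\<i> *\<^sub>C x)"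
      by (metis complex_eq mult.commute scaleC_add_left scaleC_of_real scaleC_scaleC)
    then show ?thesis by (simp add: linear_add[OF assms] linear_scale[OF assms])
  qed
  have "\<i> *\<^sub>C c *\<^sub>C x = (\<i> * c) *\<^sub>C x" by (simp add: scaleC_scaleC)
  then show ?thesis
    by (simp add: complexify_def complex_eq_iff scaleC_complex_def * [of c x] * [of "\<i> * c" x])
qed

text \<open>Rotating the argument makes the value of a complex linear functional real and positive, so a
  bound on the real part bounds the modulus.\<close>

lemma complex_linear_norm_le:
  fixes \<Phi> :: "'a::complex_normed_vector \<Rightarrow> complex"
  assumes sc: "\<And>c x. \<Phi> (c *\<^sub>C x) = c *\<^sub>C \<Phi> x" and le: "\<And>x. Re (\<Phi> x) \<le> K * norm x"
  shows "cmod (\<Phi> x) \<le> K * norm x"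
proof (cases "\<Phi> x = 0")
  case True
  then show ?thesis using le[of x] by simp
next
  case False
  define c where "c = cnj (sgn (\<Phi> x))"
  have c: "cmod c = 1" using False by (simp add: c_def norm_sgn)
  have "\<Phi> (c *\<^sub>C x) = of_real (cmod (\<Phi> x))"
  proof -
    have "cnj (\<Phi> x) * \<Phi> x = of_real (cmod (\<Phi> x)) * of_real (cmod (\<Phi> x))"
      by (metis complex_norm_square mult.commute of_real_power power2_eq_square of_real_mult)
    then show ?thesis using False
      by (simp add: sc scaleC_complex_def c_def sgn_eq field_simps)
  qed
  then have "cmod (\<Phi> x) \<le> K * norm (c *\<^sub>C x)" using le[of "c *\<^sub>C x"] by simp
  then show ?thesis by (simp add: norm_scaleC c)
qed

text \<open>Evaluation of an element of the dual space.\<close>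

definition dual_apply :: "'a::complex_normed_vector dual \<Rightarrow> 'a \<Rightarrow> complex"
  where "dual_apply \<xi> = blinfun_apply (blinfun_of_dual \<xi>)"

lemma cbilinear_dual_apply: "cbilinear (dual_apply :: 'a::complex_normed_vector dual \<Rightarrow> _)"
proof -
  have "blinfun_of_dual \<xi> \<in> bounded_ops" for \<xi> :: "'a dual" by (rule blinfun_of_dual)
  moreover have "blinfun_apply (Blinfun (\<lambda>x. c * blinfun_apply f x)) = (\<lambda>x. c * blinfun_apply f x)"
    for c and f :: "'a \<Rightarrow>\<^sub>L complex"
    by (simp add: bounded_linear_Blinfun_apply bounded_linear_const_mult blinfun.bounded_linear_right)
  ultimately show ?thesis
    by (simp add: cbilinear_def dual_apply_def plus_dual.rep_eq scaleC_dual.rep_eq blinfun.add_left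
        blinfun.add_right bounded_ops_def scaleC_complex_def)
qed

lemma norm_dual_apply_le: "cmod (dual_apply \<xi> x) \<le> norm \<xi> * norm x"
  by (simp add: dual_apply_def norm_dual.rep_eq norm_blinfun)

lemma dual_eqI: "(\<And>x. dual_apply \<xi> x = dual_apply \<zeta> x) \<Longrightarrow> \<xi> = \<zeta>"
  by (metis blinfun_eqI blinfun_of_dual_inject dual_apply_def)

lemma cbilinear_operator:
  assumes "v \<in> bounded_ops"
  shows "cbilinear (\<lambda>e x. dual_apply (blinfun_apply v e) x)"
  unfolding cbilinear_def using assms
  by (intro conjI allI)
    (simp_all add: bounded_ops_def blinfun.add_right cbilinear_add_left[OF cbilinear_dual_apply]
      cbilinear_add_right[OF cbilinear_dual_apply] cbilinear_scaleC_left[OF cbilinear_dual_apply]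
      cbilinear_scaleC_right[OF cbilinear_dual_apply])

lemma operator_pairing_le:
  "cmod (dual_apply (blinfun_apply v e) x) \<le> norm v * (norm e * norm x)"
proof -
  have "norm (blinfun_apply v e) * norm x \<le> norm v * norm e * norm x"
    by (intro mult_right_mono norm_blinfun norm_ge_zero)
  with norm_dual_apply_le[of "blinfun_apply v e" x] show ?thesis by (simp add: mult.assoc)
qed

lemma blinfun_of_complex_linear:
  fixes \<Phi> :: "'a::complex_normed_vector \<Rightarrow> 'b::complex_normed_vector"
  assumes add: "\<And>x y. \<Phi> (x + y) = \<Phi> x + \<Phi> y" and sc: "\<And>c x. \<Phi> (c *\<^sub>C x) = c *\<^sub>C \<Phi> x"
    and le: "\<And>x. norm (\<Phi> x) \<le> K * norm x" and K: "0 \<le> K"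
  obtains u where "u \<in> bounded_ops" "\<And>x. blinfun_apply u x = \<Phi> x" "norm u \<le> K"
proof -
  have lin: "linear \<Phi>" by (rule complex_linear_real_linear[OF add sc])
  have bl: "bounded_linear \<Phi>"
    using lin le by (intro bounded_linear_intro[where K = K]) (auto simp: linear_add linear_scale mult.commute)
  show thesis
  proof (rule that[of "Blinfun \<Phi>"])
    show *: "blinfun_apply (Blinfun \<Phi>) x = \<Phi> x" for x by (simp add: bounded_linear_Blinfun_apply[OF bl])
    show "Blinfun \<Phi> \<in> bounded_ops" by (simp add: bounded_ops_def * sc)
    show "norm (Blinfun \<Phi>) \<le> K" by (rule norm_blinfun_bound[OF K]) (simp add: * le)
  qed
qed

text \<open>Bounded bilinear forms on \<open>E \<times> X\<close> are operators from \<open>E\<close> to the dual of \<open>X\<close>.\<close>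

lemma operator_of_bilinear_form:
  fixes B :: "'e::complex_normed_vector \<Rightarrow> 'a::complex_normed_vector \<Rightarrow> complex"
  assumes B: "cbilinear B" and bd: "\<And>e x. cmod (B e x) \<le> K * (norm e * norm x)" and K: "0 \<le> K"
  obtains w :: "'e \<Rightarrow>\<^sub>L 'a dual" where "w \<in> bounded_ops"
    "\<And>e x. dual_apply (blinfun_apply w e) x = B e x" "norm w \<le> K"
proof -
  have "\<exists>\<xi>. (\<forall>x. dual_apply \<xi> x = B e x) \<and> norm \<xi> \<le> K * norm e" for e
  proof -
    obtain u where u: "u \<in> bounded_ops" "\<And>x. blinfun_apply u x = B e x" "norm u \<le> K * norm e"
    proof (rule blinfun_of_complex_linear[of "B e" "K * norm e"])
      show "cmod (B e x) \<le> K * norm e * norm x" for x using bd[of e x] by (simp add: mult.assoc)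
    qed (use K in \<open>auto simp: cbilinear_add_right[OF B] cbilinear_scaleC_right[OF B]\<close>)
    then show ?thesis
      by (intro exI[of _ "dual_of_blinfun u"])
        (simp add: dual_apply_def norm_dual.rep_eq dual_of_blinfun_inverse)
  qed
  then obtain D where D: "\<And>e x. dual_apply (D e) x = B e x" "\<And>e. norm (D e) \<le> K * norm e"
    by metis
  obtain w where "w \<in> bounded_ops" "\<And>e. blinfun_apply w e = D e" "norm w \<le> K"
  proof (rule blinfun_of_complex_linear[of D K])
    show "D (e + e') = D e + D e'" for e e'
      by (rule dual_eqI) (simp add: D cbilinear_add_left[OF B] cbilinear_add_left[OF cbilinear_dual_apply])
    show "D (c *\<^sub>C e) = c *\<^sub>C D e" for c e
      by (rule dual_eqI) (simp add: D cbilinear_scaleC_left[OF B] cbilinear_scaleC_left[OF cbilinear_dual_apply])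
  qed (auto simp: D K)
  then show thesis using D(1) by (intro that[of w]) simp_all
qed

section \<open>Duality for the projective norm\<close>

lemma tensor_eqI:
  assumes "\<And>B. cbilinear B \<Longrightarrow> (\<Sum>(x, y)\<leftarrow>l. B x y) = (\<Sum>(x, y)\<leftarrow>l'. B x y :: complex)"
  shows "tensor_sum l = tensor_sum l'"
  using assms by transfer (auto simp: tensor_functional_def fun_eq_iff)

lemma tensor_functional_scaleR:
  "tensor_functional (map (\<lambda>(x, y). (r *\<^sub>R x, y)) l) B = r *\<^sub>R tensor_functional l B"
  by (induction l) (auto simp: tensor_functional_def cbilinear_scaleR_left scaleR_add_right)

text \<open>Real scalars suffice for the Hahn-Banach theorem; complex scalars are recovered from the
  first tensor factor.\<close>

instantiation tensor :: (complex_normed_vector, complex_normed_vector) real_vector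
begin

lift_definition scaleR_tensor :: "real \<Rightarrow> ('a, 'b) tensor \<Rightarrow> ('a, 'b) tensor"
  is "\<lambda>r t B. r *\<^sub>R t B"
  by (auto simp flip: tensor_functional_scaleR)

instance
proof
  fix r r' :: real and s t :: "('a, 'b) tensor"
  show "r *\<^sub>R (s + t) = r *\<^sub>R s + r *\<^sub>R t" by transfer (simp add: scaleR_add_right)
  show "(r + r') *\<^sub>R t = r *\<^sub>R t + r' *\<^sub>R t" by transfer (simp add: scaleR_add_left)
  show "r *\<^sub>R r' *\<^sub>R t = (r * r') *\<^sub>R t" by transfer simp
  show "1 *\<^sub>R t = t" by transfer simp
qed

end

lemma tensor_sum_scaleR: "tensor_sum (map (\<lambda>(x, y). (r *\<^sub>R x, y)) l) = r *\<^sub>R tensor_sum l"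
  by transfer (simp add: tensor_functional_scaleR fun_eq_iff)

lemma linear_tensor_lift:
  fixes B :: "'a::complex_normed_vector \<Rightarrow> 'b::complex_normed_vector \<Rightarrow> 'c::complex_normed_vector"
  assumes B: "cbilinear B"
  shows "linear (tensor_lift B)"
proof (rule linearI)
  fix s t :: "('a, 'b) tensor" and r :: real
  obtain l l' where l: "s = tensor_sum l" "t = tensor_sum l'" by (metis tensor_sum_cases)
  show "tensor_lift B (s + t) = tensor_lift B s + tensor_lift B t"
    by (simp add: l tensor_sum_append[symmetric] tensor_lift_sum[OF B])
  have "(\<Sum>(x, y)\<leftarrow>map (\<lambda>(x, y). (r *\<^sub>R x, y)) l. B x y) = r *\<^sub>R (\<Sum>(x, y)\<leftarrow>l. B x y)"
    by (induction l) (auto simp: cbilinear_scaleR_left[OF B] scaleR_add_right)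
  then show "tensor_lift B (r *\<^sub>R s) = r *\<^sub>R tensor_lift B s"
    by (simp add: l tensor_sum_scaleR[symmetric] tensor_lift_sum[OF B])
qed

lemma sublinear_proj_norm: "sublinear proj_norm"
proof (rule sublinearI)
  fix r :: real and t :: "('a, 'b) tensor" assume r: "0 < r"
  have "proj_norm (r *\<^sub>R t) / r \<le> proj_norm t"
  proof (rule field_le_epsilon)
    fix e :: real assume "0 < e"
    then obtain l where l: "t = tensor_sum l" "(\<Sum>(x, y)\<leftarrow>l. norm x * norm y) < proj_norm t + e"
      by (rule proj_norm_approx[of e t])
    have "proj_norm (r *\<^sub>R t) \<le> (\<Sum>(x, y)\<leftarrow>map (\<lambda>(x, y). (r *\<^sub>R x, y)) l. norm x * norm y)"
      unfolding l(1) tensor_sum_scaleR[symmetric] by (rule proj_norm_le)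
    also have "\<dots> = r * (\<Sum>(x, y)\<leftarrow>l. norm x * norm y)"
      using r by (induction l) (auto simp: algebra_simps)
    finally have "proj_norm (r *\<^sub>R t) / r \<le> (\<Sum>(x, y)\<leftarrow>l. norm x * norm y)"
      using r by (simp add: field_simps)
    with l(2) show "proj_norm (r *\<^sub>R t) / r \<le> proj_norm t + e" by linarith
  qed
  then show "proj_norm (r *\<^sub>R t) \<le> r * proj_norm t" using r by (simp add: field_simps)
qed (auto intro: proj_norm_triangle)

text \<open>The projective norm is the norm of \<open>E \<otimes> X\<close> in duality with the operators from \<open>E\<close> to
  the dual of \<open>X\<close>: every tensor is normed by an operator of norm at most one.\<close>

lemma proj_norm_attained:
  fixes t :: "('e::complex_normed_vector, 'a::complex_normed_vector) tensor"
  obtains v :: "'e \<Rightarrow>\<^sub>L 'a dual" where "v \<in> bounded_ops" "norm v \<le> 1"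
    "Re (tensor_lift (\<lambda>e x. dual_apply (blinfun_apply v e) x) t) = proj_norm t"
proof -
  have "linear (\<lambda>r. r *\<^sub>R t)" by (rule linearI) (simp_all add: scaleR_add_left)
  moreover have "linear (\<lambda>r. r * proj_norm t)" by (rule linearI) (simp_all add: algebra_simps)
  moreover have "r * proj_norm t \<le> proj_norm (r *\<^sub>R t)" for r
  proof (cases "0 \<le> r")
    case False
    then show ?thesis using proj_norm_nonneg[of t] proj_norm_nonneg[of "r *\<^sub>R t"]
      by (meson le_cases mult_nonpos_nonneg order_trans)
  qed (simp add: sublinear_scaleR[OF sublinear_proj_norm])
  ultimately obtain f where f: "linear f" "\<And>s. f s \<le> proj_norm s" "\<And>r. f (r *\<^sub>R t) = r * proj_norm t"
    using hahn_banach_dominated_extension[OF sublinear_proj_norm] by metis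
  \<comment> \<open>The real functional \<open>f\<close> on tensors is the real part of a complex bilinear form.\<close>
  define g where "g x e = f (tensor_sum [(e, x)])" for x :: 'a and e :: 'e
  have g: "linear (g x)" for x
  proof (rule linearI)
    fix e e' :: 'e and r :: real
    have "tensor_sum [(e + e', x)] = tensor_sum [(e, x)] + tensor_sum [(e', x)]"
      unfolding tensor_sum_append[symmetric] by (rule tensor_eqI) (simp add: cbilinear_add_left)
    then show "g x (e + e') = g x e + g x e'" by (simp add: g_def linear_add[OF f(1)])
    have "tensor_sum [(r *\<^sub>R e, x)] = r *\<^sub>R tensor_sum [(e, x)]"
      unfolding tensor_sum_scaleR[symmetric] by simp
    then show "g x (r *\<^sub>R e) = r *\<^sub>R g x e" by (simp add: g_def linear_scale[OF f(1)])
  qed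
  define B where "B e x = complexify (g x) e" for e x
  have gadd: "g (x + x') e = g x e + g x' e" for x x' e
  proof -
    have "tensor_sum [(e, x + x')] = tensor_sum [(e, x)] + tensor_sum [(e, x')]"
      unfolding tensor_sum_append[symmetric] by (rule tensor_eqI) (simp add: cbilinear_add_right)
    then show ?thesis by (simp add: g_def linear_add[OF f(1)])
  qed
  have gsc: "g (c *\<^sub>C x) e = g x (c *\<^sub>C e)" for c x e
  proof -
    have "tensor_sum [(e, c *\<^sub>C x)] = tensor_sum [(c *\<^sub>C e, x)]"
      by (rule tensor_eqI) (simp add: cbilinear_scaleC_left cbilinear_scaleC_right)
    then show ?thesis by (simp add: g_def)
  qed
  have "B e (x + x') = B e x + B e x'" for e x x'
    by (simp add: B_def complexify_def gadd complex_eq_iff)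
  moreover have "B e (c *\<^sub>C x) = c *\<^sub>C B e x" for c e x
  proof -
    have "B e (c *\<^sub>C x) = complexify (g x) (c *\<^sub>C e)"
      by (simp add: B_def complexify_def gsc scaleC_scaleC mult.commute)
    then show ?thesis by (simp only: B_def complexify_scaleC[OF g])
  qed
  moreover have "B (e + e') x = B e x + B e' x" "B (c *\<^sub>C e) x = c *\<^sub>C B e x" for c e e' x
    by (simp_all only: B_def complexify_add[OF g] complexify_scaleC[OF g])
  ultimately have B: "cbilinear B" by (simp only: cbilinear_def simp_thms)
  have bd: "cmod (B e x) \<le> 1 * (norm e * norm x)" for e x
  proof -
    have "Re (complexify (g x) e) \<le> norm x * norm e" for e
      using f(2)[of "tensor_sum [(e, x)]"] proj_norm_le[of "[(e, x)]"] by (simp add: g_def mult.commute)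
    from complex_linear_norm_le[OF complexify_scaleC[OF g] this]
    show ?thesis by (simp add: B_def mult.commute)
  qed
  obtain v :: "'e \<Rightarrow>\<^sub>L 'a dual" where v: "v \<in> bounded_ops"
    "\<And>e x. dual_apply (blinfun_apply v e) x = B e x" "norm v \<le> 1"
    using operator_of_bilinear_form[OF B bd] by auto
  obtain l where l: "t = tensor_sum l" by (rule tensor_sum_cases)
  have "Re (\<Sum>(e, x)\<leftarrow>l. B e x) = f (tensor_sum l)" for l
  proof (induction l)
    case Nil
    have "tensor_sum [] = (0 :: ('e, 'a) tensor)" by transfer (simp add: tensor_functional_def fun_eq_iff)
    then show ?case by (simp add: linear_0[OF f(1)])
  next
    case (Cons p l)
    obtain e x where p: "p = (e, x)" by (cases p)
    have "tensor_sum (p # l) = tensor_sum [(e, x)] + tensor_sum l"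
      unfolding tensor_sum_append[symmetric] by (simp add: p)
    then show ?case using Cons by (simp add: linear_add[OF f(1)] p B_def g_def)
  qed
  moreover have "f t = proj_norm t" using f(3)[of 1] by simp
  ultimately have "Re (tensor_lift B t) = proj_norm t" by (simp add: l tensor_lift_sum[OF B])
  then show thesis using v by (intro that[of v]) simp_all
qed

text \<open>A bilinear form on \<open>H\<^sup>1 \<times> X\<close> that is dominated by the norm of \<open>L\<^sup>1(X)\<close> comes from a
  functional on \<open>L\<^sup>1(X)\<close>.\<close>

lemma extend_bilinear_form:
  fixes B :: "H1 \<Rightarrow> 'a::complex_normed_vector \<Rightarrow> complex"
  assumes B: "cbilinear B" and K: "0 \<le> K"
    and le: "\<And>t. cmod (tensor_lift B t) \<le> K * norm (tensor_lift H1_times t)"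
  obtains \<Psi> :: "'a L1 \<Rightarrow>\<^sub>L complex" where "\<Psi> \<in> bounded_ops" "norm \<Psi> \<le> K"
    "\<And>t. blinfun_apply \<Psi> (tensor_lift H1_times t) = tensor_lift B t"
proof -
  have sub: "sublinear (\<lambda>F :: 'a L1. K * norm F)"
    using K by (intro sublinearI) (auto simp: distrib_left[symmetric] intro!: mult_left_mono norm_triangle_ineq)
  have lin: "linear (\<lambda>t. Re (tensor_lift B t))"
    using linear_compose[OF linear_tensor_lift[OF B] bounded_linear.linear[OF bounded_linear_Re]]
    by (simp add: o_def)
  have re: "Re (tensor_lift B t) \<le> K * norm (tensor_lift H1_times t)" for t
    using le[of t] complex_Re_le_cmod[of "tensor_lift B t"] by linarith
  obtain f where f: "linear f" "\<And>F :: 'a L1. f F \<le> K * norm F"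
    "\<And>t. f (tensor_lift H1_times t) = Re (tensor_lift B t)"
    using hahn_banach_dominated_extension[OF sub linear_tensor_lift[OF cbilinear_H1_times] lin re] by blast
  have simple: "complexify f (H1_times h x) = B h x" for h and x :: 'a
  proof -
    have "f (H1_times h x) = Re (B h x)" for h
      using f(3)[of "tensor_sum [(h, x)]"] by (simp add: tensor_lift_sum[OF B] tensor_lift_sum[OF cbilinear_H1_times])
    from this[of h] this[of "\<i> *\<^sub>C h"] show ?thesis
      by (simp add: complexify_def complex_eq_iff cbilinear_scaleC_left[OF B]
          cbilinear_scaleC_left[OF cbilinear_H1_times] scaleC_complex_def)
  qed
  have sc: "complexify f (c *\<^sub>C F) = c *\<^sub>C complexify f F" for c F by (rule complexify_scaleC[OF f(1)])
  obtain \<Psi> where \<Psi>: "\<Psi> \<in> bounded_ops" "\<And>F. blinfun_apply \<Psi> F = complexify f F" "norm \<Psi> \<le> K"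
  proof (rule blinfun_of_complex_linear[of "complexify f" K])
    show "complexify f (F + G) = complexify f F + complexify f G" for F G by (rule complexify_add[OF f(1)])
    show "cmod (complexify f F) \<le> K * norm F" for F by (rule complex_linear_norm_le[OF sc]) (simp add: f(2))
  qed (use K sc in auto)
  show thesis
  proof (rule that[OF \<Psi>(1,3)])
    fix t :: "(H1, 'a) tensor"
    obtain l where l: "t = tensor_sum l" by (rule tensor_sum_cases)
    have "complexify f 0 = 0" using sc[of 0 0] by simp
    then have "complexify f (\<Sum>(h, x)\<leftarrow>l. H1_times h x) = (\<Sum>(h, x)\<leftarrow>l. B h x)"
      by (induction l) (auto simp: complexify_add[OF f(1)] simple)
    then show "blinfun_apply \<Psi> (tensor_lift H1_times t) = tensor_lift B t"
      by (simp add: \<Psi>(2) l tensor_lift_sum[OF B] tensor_lift_sum[OF cbilinear_H1_times])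
  qed
qed

section \<open>Fourier coefficients\<close>

lemma bochner_integrable_complex_iff:
  fixes f :: "complex \<Rightarrow> complex"
  shows "bochner_integrable f \<longleftrightarrow> integrable circle f"
proof
  assume "bochner_integrable f"
  then have "strongly_measurable f" "integrable circle (\<lambda>z. norm (f z))"
    by (simp_all add: bochner_integrable_def)
  then show "integrable circle f"
    using integrable_norm_iff[OF strongly_measurable_borel] by blast
next
  assume "integrable circle f"
  then show "bochner_integrable f"
    by (simp add: bochner_integrable_def strongly_measurable_complex)
qed

lemma integrable_powi_mult:
  fixes f :: "complex \<Rightarrow> complex"
  assumes f: "integrable circle f"
  shows "integrable circle (\<lambda>z. z powi n * f z)"
proof (rule Bochner_Integration.integrable_bound[OF f])
  have "(\<lambda>z. z powi n) \<in> borel_measurable circle"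
    using bochner_integrable_power[of n]
    by (simp add: bochner_integrable_complex_iff borel_measurable_integrable)
  then show "(\<lambda>z. z powi n * f z) \<in> borel_measurable circle"
    by (rule borel_measurable_times[OF _ borel_measurable_integrable[OF f]])
  show "AE z in circle. norm (z powi n * f z) \<le> norm (f z)"
    by (intro AE_I2) (simp add: norm_mult norm_power_int)
qed

text \<open>The Fourier coefficients of a scalar function.\<close>

lift_definition fourier :: "complex L1 \<Rightarrow> int \<Rightarrow> complex"
  is "\<lambda>f n. LINT z|circle. z powi (- n) * f z"
proof -
  fix f g :: "complex \<Rightarrow> complex" assume fg: "L1_rel f g"
  show "(\<lambda>n. LINT z|circle. z powi (- n) * f z) = (\<lambda>n. LINT z|circle. z powi (- n) * g z)"
  proof (rule ext, rule integral_cong_AE)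
    fix n
    show "AE z in circle. z powi (- n) * f z = z powi (- n) * g z"
      using fg by (auto simp: L1_rel_def elim: eventually_mono)
  qed (use fg in \<open>auto simp: L1_rel_def bochner_integrable_complex_iff
      intro!: borel_measurable_integrable integrable_powi_mult\<close>)
qed

lemma fourier_abs: "integrable circle f \<Longrightarrow> fourier (abs_L1 f) n = (LINT z|circle. z powi (- n) * f z)"
  by (simp add: fourier.abs_eq bochner_integrable_complex_iff)

lemma L1_complex_cases:
  fixes F :: "complex L1"
  obtains f where "integrable circle f" "F = abs_L1 f"
  by (metis L1_cases bochner_integrable_complex_iff)

lemma fourier_add: "fourier (F + G) n = fourier F n + fourier G n"
proof -
  obtain f g where fg: "integrable circle f" "F = abs_L1 f" "integrable circle g" "G = abs_L1 g"
    by (metis L1_complex_cases)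
  then show ?thesis
    by (simp add: plus_L1.abs_eq bochner_integrable_complex_iff fourier_abs distrib_left
        integrable_powi_mult)
qed

lemma fourier_scaleC: "fourier (c *\<^sub>C F) n = c *\<^sub>C fourier F n"
proof -
  obtain f where f: "integrable circle f" "F = abs_L1 f" by (rule L1_complex_cases)
  then show ?thesis
    by (simp add: scaleC_L1.abs_eq bochner_integrable_complex_iff fourier_abs scaleC_complex_def
        mult.left_commute[of _ c])
qed

lemma norm_fourier_le: "cmod (fourier F n) \<le> norm F"
proof -
  obtain f where f: "integrable circle f" "F = abs_L1 f" by (rule L1_complex_cases)
  have "cmod (LINT z|circle. z powi (- n) * f z) \<le> (LINT z|circle. cmod (z powi (- n) * f z))"
    by (rule integral_norm_bound)
  also have "\<dots> = (LINT z|circle. cmod (f z))"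
    by (rule Bochner_Integration.integral_cong) (simp_all add: norm_mult norm_power_int)
  finally show ?thesis using f by (simp add: fourier_abs norm_L1.abs_eq bochner_integrable_complex_iff)
qed

lemma fourier_exp: "fourier (L1_exp m) n = (if m = n then 1 else 0)"
proof -
  have "fourier (L1_exp m) n = (LINT z|circle. z powi (- n) * z powi m)"
    using bochner_integrable_power[of m]
    by (simp add: L1_exp_def fourier_abs bochner_integrable_complex_iff)
  also have "\<dots> = (LINT z|circle. z powi (m - n))"
  proof (rule Bochner_Integration.integral_cong)
    fix z :: complex assume "z \<in> space circle"
    then have "z \<noteq> 0" by auto
    then show "z powi (- n) * z powi m = z powi (m - n)"
      by (simp add: power_int_diff power_int_minus divide_inverse mult.commute)
  qed simp
  finally show ?thesis by (simp add: integral_circle_powi)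
qed

lemma norm_L1_exp: "norm (L1_exp n) = 1"
proof -
  have "measure circle (space circle) = 1"
    by (simp only: measure_def emeasure_circle_space enn2real_1)
  moreover have "norm (L1_exp n) = (LINT z|circle. cmod (z powi n))"
    by (simp add: L1_exp_def norm_L1.abs_eq bochner_integrable_power)
  moreover have "\<dots> = (LINT z|circle. 1)"
    by (rule Bochner_Integration.integral_cong) (simp_all add: norm_power_int)
  ultimately show ?thesis by simp
qed

lemma abs_L1_sum:
  assumes "\<And>i. i \<in> I \<Longrightarrow> bochner_integrable (f i)"
  shows "(\<Sum>i\<in>I. abs_L1 (f i)) = abs_L1 (\<lambda>z. \<Sum>i\<in>I. f i z)"
  using assms
proof (induction I rule: infinite_finite_induct)
  case (insert i I)
  have "(\<Sum>i\<in>insert i I. abs_L1 (f i)) = abs_L1 (f i) + abs_L1 (\<lambda>z. \<Sum>i\<in>I. f i z)"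
    using insert by simp
  also have "\<dots> = abs_L1 (\<lambda>z. f i z + (\<Sum>i\<in>I. f i z))"
    using insert.prems by (intro plus_L1.abs_eq) (auto intro: bochner_integrable_sum)
  finally show ?case using insert.hyps by simp
qed (simp_all add: zero_L1_def)

section \<open>Trigonometric kernels\<close>

text \<open>Convolution with the trigonometric polynomial \<open>\<Sum>\<^bsub>i < p, j < q\<^esub> z\<^bsup>j - i\<^esup>\<close>, which is
  \<open>cnj (\<Sum>\<^bsub>i < p\<^esub> z\<^bsup>i\<^esup>) (\<Sum>\<^bsub>j < q\<^esub> z\<^bsup>j\<^esup>)\<close> on the circle, written in Fourier coefficients.\<close>

definition kernel_op :: "nat \<Rightarrow> nat \<Rightarrow> complex L1 \<Rightarrow> complex L1"
  where "kernel_op p q F =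
    (\<Sum>i<p. \<Sum>j<q. fourier F (int j - int i) *\<^sub>C L1_exp (int j - int i))"

lemma unimodular_kernel:
  assumes w: "cmod w = 1"
  shows "(\<Sum>i<p. \<Sum>j<q. w powi (int j - int i)) = cnj (\<Sum>i<p. w ^ i) * (\<Sum>j<q. w ^ j)"
proof -
  have w0: "w \<noteq> 0" using w by auto
  have "cnj w = inverse w"
    using w w0 by (simp add: inverse_complex_def complex_eq_iff cmod_def) 
  then have "w powi (int j - int i) = cnj (w ^ i) * w ^ j" for i j
    using w0 by (simp add: power_int_diff power_inverse divide_inverse mult.commute)
  then show ?thesis by (simp add: sum_product)
qed

lemma unimodular_kernel_le:
  assumes w: "cmod w = 1"
  shows "cmod (\<Sum>i<p. \<Sum>j<q. w powi (int j - int i))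
    \<le> Re ((\<Sum>i<p. \<Sum>j<p. w powi (int j - int i)) + (\<Sum>i<q. \<Sum>j<q. w powi (int j - int i))) / 2"
proof -
  have sq: "Re (cnj a * a) = (cmod a)\<^sup>2" for a
  proof -
    have "cnj a * a = complex_of_real ((cmod a)\<^sup>2)" 
      unfolding complex_norm_square by (rule mult.commute)
    then show ?thesis by (simp only: Re_complex_of_real)
  qed
  have "2 * (cmod a * cmod b) \<le> (cmod a)\<^sup>2 + (cmod b)\<^sup>2" for a b
    using zero_le_power2[of "cmod a - cmod b"] by (simp add: power2_diff)
  from this[of "\<Sum>i<p. w ^ i" "\<Sum>i<q. w ^ i"] show ?thesis
    by (simp only: unimodular_kernel[OF w] norm_mult complex_mod_cnj plus_complex.sel sq) simp
qed

text \<open>A finite Fourier sum as an integral against the kernel; only finite sums are interchanged with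
  integrals, so Fubini's theorem is not needed.\<close>

lemma kernel_sum_integral:
  assumes g: "integrable circle g" and z: "cmod z = 1"
  shows "(\<Sum>i<p. \<Sum>j<q. (LINT \<zeta>|circle. \<zeta> powi (- (int j - int i)) * g \<zeta>) * z powi (int j - int i))
    = (LINT \<zeta>|circle. (\<Sum>i<p. \<Sum>j<q. (z / \<zeta>) powi (int j - int i)) * g \<zeta>)"
  and "integrable circle (\<lambda>\<zeta>. (\<Sum>i<p. \<Sum>j<q. (z / \<zeta>) powi (int j - int i)) * g \<zeta>)"
proof -
  have "(z / \<zeta>) powi n * g \<zeta> = \<zeta> powi (- n) * g \<zeta> * z powi n" for n \<zeta>
    unfolding power_int_divide_distrib power_int_minus by (simp add: divide_inverse mult_ac)
  then have eq: "(\<Sum>i<p. \<Sum>j<q. (z / \<zeta>) powi (int j - int i)) * g \<zeta>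
      = (\<Sum>i<p. \<Sum>j<q. \<zeta> powi (- (int j - int i)) * g \<zeta> * z powi (int j - int i))" for \<zeta>
    by (simp only: sum_distrib_right)
  have i: "integrable circle (\<lambda>\<zeta>. \<zeta> powi (- (int j - int i)) * g \<zeta> * z powi (int j - int i))" for i j
    by (intro integrable_mult_left integrable_powi_mult g)
  show "integrable circle (\<lambda>\<zeta>. (\<Sum>i<p. \<Sum>j<q. (z / \<zeta>) powi (int j - int i)) * g \<zeta>)"
    unfolding eq by (intro Bochner_Integration.integrable_sum i)
  have "(LINT \<zeta>|circle. (\<Sum>i<p. \<Sum>j<q. (z / \<zeta>) powi (int j - int i)) * g \<zeta>)
    = (\<Sum>i<p. \<Sum>j<q. LINT \<zeta>|circle. \<zeta> powi (- (int j - int i)) * g \<zeta> * z powi (int j - int i))"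
    unfolding eq by (simp only: Bochner_Integration.integral_sum Bochner_Integration.integrable_sum i)
  also have "\<dots> = (\<Sum>i<p. \<Sum>j<q. (LINT \<zeta>|circle. \<zeta> powi (- (int j - int i)) * g \<zeta>) * z powi (int j - int i))"
    by (simp only: integral_mult_left_zero)
  finally show "(\<Sum>i<p. \<Sum>j<q. (LINT \<zeta>|circle. \<zeta> powi (- (int j - int i)) * g \<zeta>) * z powi (int j - int i))
    = (LINT \<zeta>|circle. (\<Sum>i<p. \<Sum>j<q. (z / \<zeta>) powi (int j - int i)) * g \<zeta>)" ..
qed

lemma integral_kernel_diagonal:
  "integrable circle (\<lambda>z. \<Sum>i<p. \<Sum>j<p. b (int j - int i) * z powi (int j - int i))"
  "(LINT z|circle. (\<Sum>i<p. \<Sum>j<p. b (int j - int i) * z powi (int j - int i))) = of_nat p * b 0"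
proof -
  have i: "integrable circle (\<lambda>z. b n * z powi n)" for n
    using bochner_integrable_power[of n] by (simp add: bochner_integrable_complex_iff)
  show "integrable circle (\<lambda>z. \<Sum>i<p. \<Sum>j<p. b (int j - int i) * z powi (int j - int i))"
    by (intro Bochner_Integration.integrable_sum i)
  have "(LINT z|circle. (\<Sum>i<p. \<Sum>j<p. b (int j - int i) * z powi (int j - int i)))
      = (\<Sum>i<p. \<Sum>j<p. b (int j - int i) * (if int j - int i = 0 then 1 else 0))"
    by (simp only: Bochner_Integration.integral_sum Bochner_Integration.integrable_sum i
        integral_mult_right_zero integral_circle_powi)
  also have "\<dots> = (\<Sum>i<p. \<Sum>j<p. if j = i then b 0 else 0)"
    by (intro sum.cong refl) auto
  also have "\<dots> = of_nat p * b 0" by simp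
  finally show "(LINT z|circle. (\<Sum>i<p. \<Sum>j<p. b (int j - int i) * z powi (int j - int i))) = of_nat p * b 0" .
qed

text \<open>Since \<open>|a b| \<le> (|a|\<^sup>2 + |b|\<^sup>2) / 2\<close>, the kernel is dominated by the mean of two positive
  kernels, whose integrals are their constant coefficients.\<close>

lemma norm_kernel_op_le: "norm (kernel_op p q F) \<le> (real p + real q) / 2 * norm F"
proof -
  obtain g where g: "integrable circle g" "F = abs_L1 g" by (rule L1_complex_cases)
  define a where "a n = (LINT \<zeta>|circle. \<zeta> powi (- n) * g \<zeta>)" for n
  define b where "b n = (LINT \<zeta>|circle. \<zeta> powi (- n) * complex_of_real (cmod (g \<zeta>)))" for n
  have ng: "integrable circle (\<lambda>\<zeta>. complex_of_real (cmod (g \<zeta>)))" using g(1) by simp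
  define V where "V z = (\<Sum>i<p. \<Sum>j<q. a (int j - int i) * z powi (int j - int i))" for z
  define W where "W r z = (\<Sum>i<r. \<Sum>j<r. b (int j - int i) * z powi (int j - int i))" for r z
  have iW: "integrable circle (W r)" for r unfolding W_def by (rule integral_kernel_diagonal)
  have V1: "bochner_integrable (\<lambda>z. a n * z powi n)" for n
    using bochner_integrable_power[of n] by (simp add: bochner_integrable_complex_iff)
  have bV: "bochner_integrable V" unfolding V_def by (intro bochner_integrable_sum V1)
  have "a n *\<^sub>C L1_exp n = abs_L1 (\<lambda>z. a n * z powi n)" for n
    by (simp add: L1_exp_def scaleC_L1.abs_eq bochner_integrable_power scaleC_complex_def)
  moreover have "fourier F n = a n" for n by (simp add: g fourier_abs a_def)
  ultimately have "kernel_op p q F = abs_L1 V"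
    by (simp add: kernel_op_def V_def [abs_def] abs_L1_sum V1 bochner_integrable_sum)
  then have "norm (kernel_op p q F) = (LINT z|circle. cmod (V z))"
    by (simp add: norm_L1.abs_eq bV)
  also have "\<dots> \<le> (LINT z|circle. Re (W p z + W q z) / 2)"
  proof (rule integral_mono)
    show "integrable circle (\<lambda>z. cmod (V z))" by (rule integrable_norm_bochner[OF bV])
    show "integrable circle (\<lambda>z. Re (W p z + W q z) / 2)"
      by (intro integrable_divide_zero integrable_Re Bochner_Integration.integrable_add iW)
    fix z assume "z \<in> space circle"
    then have z: "cmod z = 1" by simp
    let ?K = "\<lambda>p q \<zeta>. \<Sum>i<p. \<Sum>j<q. (z / \<zeta>) powi (int j - int i)"
    have Wz: "W r z = (LINT \<zeta>|circle. ?K r r \<zeta> * complex_of_real (cmod (g \<zeta>)))"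
      and iK: "integrable circle (\<lambda>\<zeta>. ?K r r \<zeta> * complex_of_real (cmod (g \<zeta>)))" for r
      using kernel_sum_integral[OF ng z, of r r] by (simp_all only: W_def b_def)
    have "V z = (LINT \<zeta>|circle. ?K p q \<zeta> * g \<zeta>)" and iV: "integrable circle (\<lambda>\<zeta>. ?K p q \<zeta> * g \<zeta>)"
      using kernel_sum_integral[OF g(1) z, of q p] by (simp_all only: V_def a_def)
    then have "cmod (V z) \<le> (LINT \<zeta>|circle. cmod (?K p q \<zeta> * g \<zeta>))"
      by (simp only: integral_norm_bound)
    also have "\<dots> \<le> (LINT \<zeta>|circle. Re (?K p p \<zeta> * complex_of_real (cmod (g \<zeta>))
        + ?K q q \<zeta> * complex_of_real (cmod (g \<zeta>))) / 2)"
    proof (rule integral_mono)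
      show "integrable circle (\<lambda>\<zeta>. cmod (?K p q \<zeta> * g \<zeta>))" by (rule integrable_norm[OF iV])
      show "integrable circle (\<lambda>\<zeta>. Re (?K p p \<zeta> * complex_of_real (cmod (g \<zeta>))
          + ?K q q \<zeta> * complex_of_real (cmod (g \<zeta>))) / 2)"
        by (intro integrable_divide_zero integrable_Re Bochner_Integration.integrable_add iK)
      fix \<zeta> assume "\<zeta> \<in> space circle"
      then have w: "cmod (z / \<zeta>) = 1" using z by (simp add: norm_divide)
      have "cmod (?K p q \<zeta> * g \<zeta>) \<le> Re (?K p p \<zeta> + ?K q q \<zeta>) / 2 * cmod (g \<zeta>)"
        unfolding norm_mult by (rule mult_right_mono[OF unimodular_kernel_le[OF w] norm_ge_zero])
      also have "\<dots> = Re (?K p p \<zeta> * complex_of_real (cmod (g \<zeta>))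
          + ?K q q \<zeta> * complex_of_real (cmod (g \<zeta>))) / 2"
        by (simp only: distrib_right[symmetric] Re_complex_of_real Im_complex_of_real times_complex.sel) simp
      finally show "cmod (?K p q \<zeta> * g \<zeta>) \<le> Re (?K p p \<zeta> * complex_of_real (cmod (g \<zeta>))
          + ?K q q \<zeta> * complex_of_real (cmod (g \<zeta>))) / 2" .
    qed
    also have "\<dots> = Re (W p z + W q z) / 2"
      unfolding Wz using iK by (simp only: integral_divide_zero integral_Re Bochner_Integration.integrable_add
          Bochner_Integration.integral_add)
    finally show "cmod (V z) \<le> Re (W p z + W q z) / 2" .
  qed
  also have "\<dots> = Re (of_nat p * b 0 + of_nat q * b 0) / 2"
  proof -
    have "(LINT z|circle. W r z) = of_nat r * b 0" for r
      unfolding W_def by (rule integral_kernel_diagonal)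
    then show ?thesis
      using iW by (simp only: integral_divide_zero integral_Re Bochner_Integration.integrable_add
          Bochner_Integration.integral_add)
  qed
  also have "b 0 = complex_of_real (norm F)"
    using g by (simp add: b_def norm_L1.abs_eq bochner_integrable_complex_iff)
  finally show ?thesis by (simp add: field_simps)
qed

section \<open>Finite rank approximation on the Hardy space\<close>

lemma scaleC_sum_right: "c *\<^sub>C (\<Sum>i\<in>I. f i) = (\<Sum>i\<in>I. c *\<^sub>C (f i :: 'a::complex_normed_vector))"
  by (induction I rule: infinite_finite_induct) (simp_all add: scaleC_add_right)

lemma scaleC_sum_left: "(\<Sum>i\<in>I. f i) *\<^sub>C x = (\<Sum>i\<in>I. f i *\<^sub>C (x :: 'a::complex_normed_vector))"
  by (induction I rule: infinite_finite_induct) (simp_all add: scaleC_add_left)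

lemma L1_of_H1_sum: "L1_of_H1 (\<Sum>i\<in>I. f i) = (\<Sum>i\<in>I. L1_of_H1 (f i))"
  by (induction I rule: infinite_finite_induct) (simp_all add: zero_H1.rep_eq plus_H1.rep_eq)

lemma norm_H1_exp: "norm (H1_exp n) = 1"
  by (simp add: norm_H1.rep_eq H1_exp.rep_eq norm_L1_exp)

lemma bounded_ops_scaleC: "u \<in> bounded_ops \<Longrightarrow> blinfun_apply u (c *\<^sub>C x) = c *\<^sub>C blinfun_apply u x"
  by (simp add: bounded_ops_def)

lemma bounded_ops_compose: "u \<in> bounded_ops \<Longrightarrow> v \<in> bounded_ops \<Longrightarrow> u o\<^sub>L v \<in> bounded_ops"
  by (simp add: bounded_ops_def)

lemma blinfun_apply_tendsto: "(f \<longlongrightarrow> x) F \<Longrightarrow> ((\<lambda>i. blinfun_apply u (f i)) \<longlongrightarrow> blinfun_apply u x) F"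
  by (rule bounded_linear.tendsto[OF blinfun.bounded_linear_right])

lemma analytic_poly_eq: "analytic_poly n x = (\<Sum>k\<le>n. L1_times (L1_exp (int k)) (x k))"
proof -
  have b: "bochner_integrable (\<lambda>z. z powi int k *\<^sub>C x k)" for k
    by (rule bochner_integrable_scaleC_const[OF bochner_integrable_power])
  have "L1_times (L1_exp (int k)) (x k) = abs_L1 (\<lambda>z. z powi int k *\<^sub>C x k)" for k
    unfolding L1_exp_def by (simp add: L1_times.abs_eq bochner_integrable_power del: power_int_of_nat)
  then have "(\<Sum>k\<le>n. L1_times (L1_exp (int k)) (x k)) = abs_L1 (\<lambda>z. \<Sum>k\<le>n. z powi int k *\<^sub>C x k)"
    by (simp only: abs_L1_sum b)
  then show ?thesis by (simp add: analytic_poly_def)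
qed

lemma L1_times_complex: "L1_times F c = c *\<^sub>C F"
proof -
  obtain f where f: "bochner_integrable f" "F = abs_L1 f" by (rule L1_cases)
  then show ?thesis
    by (simp add: L1_times.abs_eq scaleC_L1.abs_eq scaleC_complex_def mult.commute)
qed

text \<open>The inclusion of \<open>H\<^sup>1\<close> into \<open>L\<^sup>1\<close> as a bounded operator.\<close>

definition H1_embed :: "H1 \<Rightarrow>\<^sub>L complex L1"
  where "H1_embed = Blinfun L1_of_H1"

lemma H1_embed_apply [simp]: "blinfun_apply H1_embed h = L1_of_H1 h"
proof -
  have "bounded_linear L1_of_H1"
    by (rule bounded_linear_intro[where K = 1])
      (simp_all add: plus_H1.rep_eq scaleR_H1.rep_eq norm_H1.rep_eq)
  then show ?thesis by (simp add: H1_embed_def bounded_linear_Blinfun_apply)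
qed

lemma H1_embed_bounded_ops: "H1_embed \<in> bounded_ops"
  by (simp add: bounded_ops_def scaleC_H1.rep_eq)

lemma H1_polynomials_dense:
  obtains p :: "nat \<Rightarrow> H1" and d :: "nat \<Rightarrow> nat" and x :: "nat \<Rightarrow> nat \<Rightarrow> complex"
  where "\<And>m. p m = (\<Sum>k\<le>d m. x m k *\<^sub>C H1_exp k)" "p \<longlonglongrightarrow> h"
proof -
  have "L1_of_H1 h \<in> closure {analytic_poly n x |n x. True}"
    using L1_of_H1[of h] by (simp add: Htilde1_def)
  then obtain u where u: "\<And>m. u m \<in> {analytic_poly n x |n x. True}" "u \<longlonglongrightarrow> L1_of_H1 h"
    unfolding closure_sequential by blast
  have "\<forall>m. \<exists>n x. u m = analytic_poly n x" using u(1) by blast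
  then obtain d x where dx: "\<And>m. u m = analytic_poly (d m) (x m)" by metis
  define p where "p m = (\<Sum>k\<le>d m. x m k *\<^sub>C H1_exp k)" for m
  have "L1_of_H1 (p m) = u m" for m
    by (simp add: p_def dx analytic_poly_eq L1_times_complex L1_of_H1_sum scaleC_H1.rep_eq H1_exp.rep_eq)
  then have "norm (p m - h) = norm (u m - L1_of_H1 h)" for m
    by (simp add: norm_H1.rep_eq minus_H1.rep_eq)
  moreover have "(\<lambda>m. norm (u m - L1_of_H1 h)) \<longlonglongrightarrow> 0"
    by (rule tendsto_norm_zero[OF LIM_zero[OF u(2)]])
  ultimately have "(\<lambda>m. norm (p m - h)) \<longlonglongrightarrow> 0" by simp
  then have "p \<longlonglongrightarrow> h" by (simp add: LIM_zero_iff tendsto_norm_zero_iff)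
  with p_def show thesis by (rule that)
qed

lemma H1_operator_eqI:
  fixes u v :: "H1 \<Rightarrow>\<^sub>L 'z::complex_normed_vector"
  assumes u: "u \<in> bounded_ops" and v: "v \<in> bounded_ops"
    and eq: "\<And>n. blinfun_apply u (H1_exp n) = blinfun_apply v (H1_exp n)"
  shows "u = v"
proof (rule blinfun_eqI)
  fix h
  obtain p :: "nat \<Rightarrow> H1" and d :: "nat \<Rightarrow> nat" and x :: "nat \<Rightarrow> nat \<Rightarrow> complex"
    where p: "\<And>m. p m = (\<Sum>k\<le>d m. x m k *\<^sub>C H1_exp k)" "p \<longlonglongrightarrow> h"
    using H1_polynomials_dense[of h] by blast
  have "blinfun_apply u (p m) = blinfun_apply v (p m)" for m
    by (simp add: p(1) blinfun.sum_right bounded_ops_scaleC[OF u] bounded_ops_scaleC[OF v] eq)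
  then show "blinfun_apply u h = blinfun_apply v h"
    using blinfun_apply_tendsto[OF p(2), of u] blinfun_apply_tendsto[OF p(2), of v]
    by (simp add: LIMSEQ_unique)
qed

lemma fourier_H1_negative:
  assumes "n < 0"
  shows "fourier (L1_of_H1 h) n = 0"
proof -
  obtain u where u: "u \<in> bounded_ops" "\<And>F. blinfun_apply u F = fourier F n"
    using blinfun_of_complex_linear[of "\<lambda>F. fourier F n" 1]
    by (auto simp: fourier_add fourier_scaleC norm_fourier_le)
  have "u o\<^sub>L H1_embed = 0"
  proof (rule H1_operator_eqI)
    show "blinfun_apply (u o\<^sub>L H1_embed) (H1_exp m) = blinfun_apply 0 (H1_exp m)" for m
      using assms by (simp add: u(2) H1_exp.rep_eq fourier_exp)
  qed (rule bounded_ops_compose[OF u(1) H1_embed_bounded_ops], simp add: bounded_ops_def)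
  from arg_cong[OF this, of "\<lambda>w. blinfun_apply w h"] show ?thesis by (simp add: u(2))
qed

lemma kernel_op_add: "kernel_op p q (F + G) = kernel_op p q F + kernel_op p q G"
  by (simp add: kernel_op_def fourier_add scaleC_add_left sum.distrib)

lemma kernel_op_scaleC: "kernel_op p q (c *\<^sub>C F) = c *\<^sub>C kernel_op p q F"
  by (simp add: kernel_op_def fourier_scaleC scaleC_sum_right scaleC_scaleC scaleC_complex_def)

lemma kernel_op_exp:
  "kernel_op p q (L1_exp n) = (\<Sum>i<p. \<Sum>j<q. if n = int j - int i then 1 else 0) *\<^sub>C L1_exp n"
  unfolding kernel_op_def scaleC_sum_left
  by (intro sum.cong refl) (simp add: fourier_exp)

text \<open>De la Vallee-Poussin operators \<open>V\<close>: almost contractive, the identity on analytic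
  polynomials of degree at most \<open>k\<close>, and of finite rank.  The operator \<open>R\<close> agrees with \<open>V\<close> on
  \<open>H\<^sup>1\<close>; dropping the negative frequencies makes it map \<open>L\<^sup>1\<close> into \<open>H\<^sup>1\<close>.\<close>

lemma de_la_Vallee_Poussin:
  fixes k L :: nat
  assumes L: "0 < L"
  obtains V :: "complex L1 \<Rightarrow>\<^sub>L complex L1" and R :: "complex L1 \<Rightarrow>\<^sub>L H1"
  where "V \<in> bounded_ops" "norm V \<le> 1 + real k / (2 * real L)"
    "\<And>n. \<exists>c. blinfun_apply V (L1_exp n) = c *\<^sub>C L1_exp n"
    "\<And>n. n \<le> k \<Longrightarrow> blinfun_apply V (L1_exp (int n)) = L1_exp (int n)"
    "\<And>n. n \<notin> {- int (L + k)..int (L + k)} \<Longrightarrow> blinfun_apply V (L1_exp n) = 0"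
    "R \<in> bounded_ops" "\<And>h. L1_of_H1 (blinfun_apply R (L1_of_H1 h)) = blinfun_apply V (L1_of_H1 h)"
proof -
  define c where "c = complex_of_real (1 / real L)"
  have c: "cmod c = 1 / real L" "c * of_nat L = 1" using L by (simp_all add: c_def norm_divide)
  obtain V where V: "V \<in> bounded_ops" "\<And>F. blinfun_apply V F = c *\<^sub>C kernel_op L (L + k) F"
    "norm V \<le> 1 + real k / (2 * real L)"
  proof (rule blinfun_of_complex_linear[of "\<lambda>F. c *\<^sub>C kernel_op L (L + k) F" "1 + real k / (2 * real L)"])
    show "norm (c *\<^sub>C kernel_op L (L + k) F) \<le> (1 + real k / (2 * real L)) * norm F" for F
    proof -
      have "norm (c *\<^sub>C kernel_op L (L + k) F)
          \<le> 1 / real L * ((real L + real (L + k)) / 2 * norm F)"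
        unfolding norm_scaleC c(1) by (intro mult_left_mono norm_kernel_op_le) simp
      also have "\<dots> = (1 + real k / (2 * real L)) * norm F" using L by (simp add: field_simps)
      finally show ?thesis .
    qed
  qed (simp_all add: kernel_op_add kernel_op_scaleC scaleC_add_right scaleC_scaleC mult.commute)
  define r where "r F = c *\<^sub>C (\<Sum>i<L. \<Sum>j<L + k.
    fourier F (int j - int i) *\<^sub>C (if i \<le> j then H1_exp (j - i) else 0))" for F
  obtain R where R: "R \<in> bounded_ops" "\<And>F. blinfun_apply R F = r F"
  proof (rule blinfun_of_complex_linear[of r "real (L + k)"])
    show "r (F + G) = r F + r G" for F G
      by (simp add: r_def fourier_add scaleC_add_left sum.distrib scaleC_add_right)
    show "r (d *\<^sub>C F) = d *\<^sub>C r F" for d F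
      by (simp add: r_def fourier_scaleC scaleC_sum_right scaleC_scaleC scaleC_complex_def mult_ac)
    show "norm (r F) \<le> real (L + k) * norm F" for F
    proof -
      have "norm (\<Sum>i<L. \<Sum>j<L + k. fourier F (int j - int i) *\<^sub>C (if i \<le> j then H1_exp (j - i) else 0))
          \<le> (\<Sum>i<L. \<Sum>j<L + k. norm F)"
        by (intro sum_norm_le) (auto simp: norm_scaleC norm_H1_exp norm_fourier_le)
      then have "norm (r F) \<le> 1 / real L * (real L * (real (L + k) * norm F))"
        unfolding r_def norm_scaleC c(1) by (intro mult_left_mono) auto
      then show ?thesis using L by simp
    qed
  qed auto
  have eq: "L1_of_H1 (blinfun_apply R (L1_of_H1 h)) = blinfun_apply V (L1_of_H1 h)" for h
    unfolding V(2) R(2) r_def kernel_op_def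
    by (simp add: scaleC_H1.rep_eq L1_of_H1_sum)
      (intro arg_cong[of _ _ "scaleC c"] sum.cong refl,
        auto simp: zero_H1.rep_eq H1_exp.rep_eq fourier_H1_negative of_nat_diff)
  have "blinfun_apply V (L1_exp (int n)) = L1_exp (int n)" if n: "n \<le> k" for n
  proof -
    have "(\<Sum>i<L. \<Sum>j<L + k. if int n = int j - int i then 1 else 0) = (\<Sum>i<L. 1 :: complex)"
    proof (rule sum.cong)
      fix i assume "i \<in> {..<L}"
      have "(\<Sum>j<L + k. if int n = int j - int i then 1 else 0)
          = (\<Sum>j<L + k. if j = n + i then 1 else 0 :: complex)"
        by (intro sum.cong) auto
      also have "\<dots> = 1" using \<open>i \<in> {..<L}\<close> n by simp
      finally show "(\<Sum>j<L + k. if int n = int j - int i then 1 else 0) = (1 :: complex)" .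
    qed simp
    then show ?thesis using c(2) by (simp add: V(2) kernel_op_exp scaleC_scaleC)
  qed
  moreover have "blinfun_apply V (L1_exp n) = 0" if "n \<notin> {- int (L + k)..int (L + k)}" for n
  proof -
    have "(\<Sum>i<L. \<Sum>j<L + k. if n = int j - int i then 1 else 0) = (0 :: complex)"
      using that by (intro sum.neutral) auto
    then show ?thesis by (simp only: V(2) kernel_op_exp scaleC_zero_left scaleC_zero_right)
  qed
  moreover have "\<exists>c. blinfun_apply V (L1_exp n) = c *\<^sub>C L1_exp n" for n
    by (auto simp: V(2) kernel_op_exp scaleC_scaleC)
  ultimately show thesis using V(1,3) R(1) eq that by blast
qed

text \<open>Finite rank operators \<open>R n : L\<^sup>1 \<rightarrow> H\<^sup>1\<close> whose restrictions to \<open>H\<^sup>1\<close> are multipliers of norm at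
  most \<open>1 + 1 / (n + 1)\<close> converging strongly to the identity.  No uniform bound on all of \<open>L\<^sup>1\<close> is
  claimed.\<close>

lemma H1_finite_rank_approximation:
  obtains R :: "nat \<Rightarrow> complex L1 \<Rightarrow>\<^sub>L H1" where "\<And>n. R n \<in> bounded_ops"
    "\<And>n h. norm (blinfun_apply (R n) (L1_of_H1 h)) \<le> (1 + 1 / real (Suc n)) * norm h"
    "\<And>h. (\<lambda>n. blinfun_apply (R n) (L1_of_H1 h)) \<longlonglongrightarrow> h"
    "\<And>n. \<exists>N>0. \<forall>m>N. blinfun_apply (R n) (L1_of_H1 (H1_exp m)) = 0"
proof -
  have "\<exists>R :: complex L1 \<Rightarrow>\<^sub>L H1. R \<in> bounded_ops \<and>
      (\<forall>h. norm (blinfun_apply R (L1_of_H1 h)) \<le> (1 + 1 / real (Suc n)) * norm h) \<and>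
      (\<forall>m\<le>n. blinfun_apply R (L1_of_H1 (H1_exp m)) = H1_exp m) \<and>
      (\<exists>N>0. \<forall>m>N. blinfun_apply R (L1_of_H1 (H1_exp m)) = 0)" for n
  proof -
    \<comment> \<open>Any \<open>L\<close> with \<open>n / (2 L) \<le> 1 / (n + 1)\<close> would do.\<close>
    define L where "L = Suc n * Suc n"
    have L: "0 < L" by (simp add: L_def)
    obtain V :: "complex L1 \<Rightarrow>\<^sub>L complex L1" and R :: "complex L1 \<Rightarrow>\<^sub>L H1"
      where V: "norm V \<le> 1 + real n / (2 * real L)"
        "\<And>m. m \<le> n \<Longrightarrow> blinfun_apply V (L1_exp (int m)) = L1_exp (int m)"
        "\<And>m. m \<notin> {- int (L + n)..int (L + n)} \<Longrightarrow> blinfun_apply V (L1_exp m) = 0"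
        and R: "R \<in> bounded_ops" "\<And>h. L1_of_H1 (blinfun_apply R (L1_of_H1 h)) = blinfun_apply V (L1_of_H1 h)"
      by (rule de_la_Vallee_Poussin[OF L, of n]) blast
    have "real n / (2 * real L) \<le> real (Suc n) / real L"
      by (rule frac_le) (use L in auto)
    also have "\<dots> = 1 / real (Suc n)" unfolding L_def of_nat_mult by (simp del: of_nat_Suc)
    finally have "real n / (2 * real L) \<le> 1 / real (Suc n)" .
    then have nV: "norm V \<le> 1 + 1 / real (Suc n)" using V(1) by linarith
    have "norm (blinfun_apply R (L1_of_H1 h)) \<le> (1 + 1 / real (Suc n)) * norm h" for h
    proof -
      have "norm (blinfun_apply V (L1_of_H1 h)) \<le> norm V * norm (L1_of_H1 h)" by (rule norm_blinfun)
      also have "\<dots> \<le> (1 + 1 / real (Suc n)) * norm (L1_of_H1 h)"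
        by (rule mult_right_mono[OF nV norm_ge_zero])
      finally show ?thesis by (simp add: norm_H1.rep_eq R(2))
    qed
    moreover have "blinfun_apply R (L1_of_H1 (H1_exp m)) = H1_exp m" if "m \<le> n" for m
      by (rule L1_of_H1_inject[THEN iffD1], unfold R(2)) (simp add: H1_exp.rep_eq V(2) that)
    moreover have "blinfun_apply R (L1_of_H1 (H1_exp m)) = 0" if "L + n < m" for m
      by (rule L1_of_H1_inject[THEN iffD1], unfold R(2)) (use that in \<open>simp add: H1_exp.rep_eq zero_H1.rep_eq V(3)\<close>)
    ultimately show ?thesis using R(1) L by (intro exI[of _ R]) (auto intro!: exI[of _ "L + n"])
  qed
  then obtain R :: "nat \<Rightarrow> complex L1 \<Rightarrow>\<^sub>L H1" where R: "\<And>n. R n \<in> bounded_ops"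
    "\<And>n h. norm (blinfun_apply (R n) (L1_of_H1 h)) \<le> (1 + 1 / real (Suc n)) * norm h"
    "\<And>n m. m \<le> n \<Longrightarrow> blinfun_apply (R n) (L1_of_H1 (H1_exp m)) = H1_exp m"
    "\<And>n. \<exists>N>0. \<forall>m>N. blinfun_apply (R n) (L1_of_H1 (H1_exp m)) = 0"
    by metis
  have "(\<lambda>n. blinfun_apply (R n) (L1_of_H1 h)) \<longlonglongrightarrow> h" for h
  proof (rule LIMSEQ_I)
    fix e :: real assume e: "0 < e"
    obtain p :: "nat \<Rightarrow> H1" and d :: "nat \<Rightarrow> nat" and x :: "nat \<Rightarrow> nat \<Rightarrow> complex"
      where p: "\<And>m. p m = (\<Sum>k\<le>d m. x m k *\<^sub>C H1_exp k)" "p \<longlonglongrightarrow> h"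
      using H1_polynomials_dense[of h] by blast
    obtain m where m: "norm (p m - h) < e / 3" using LIMSEQ_D[OF p(2), of "e / 3"] e by auto
    have "norm (blinfun_apply (R n) (L1_of_H1 h) - h) < e" if n: "d m \<le> n" for n
    proof -
      have "blinfun_apply (R n) (L1_of_H1 (p m)) = p m"
        using n by (simp add: p(1) L1_of_H1_sum blinfun.sum_right scaleC_H1.rep_eq bounded_ops_scaleC[OF R(1)] R(3))
      then have eq: "blinfun_apply (R n) (L1_of_H1 h) - h
          = (p m - h) - blinfun_apply (R n) (L1_of_H1 (p m - h))"
        by (simp add: minus_H1.rep_eq blinfun.diff_right)
      have "norm (blinfun_apply (R n) (L1_of_H1 (p m - h))) \<le> (1 + 1 / real (Suc n)) * norm (p m - h)"
        by (rule R(2))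
      also have "\<dots> \<le> 2 * norm (p m - h)" by (intro mult_right_mono) (auto simp: field_simps)
      finally show ?thesis
        unfolding eq using m norm_triangle_ineq4[of "p m - h" "blinfun_apply (R n) (L1_of_H1 (p m - h))"]
        by linarith
    qed
    then show "\<exists>no. \<forall>n\<ge>no. norm (blinfun_apply (R n) (L1_of_H1 h) - h) < e" by blast
  qed
  from that[OF R(1) R(2) this R(4)] show thesis .
qed

section \<open>The uniform boundedness principle\<close>

text \<open>The uniform boundedness principle for continuous seminorms on a closed subspace.\<close>

lemma uniform_boundedness_seminorms:
  fixes M :: "'b::banach set" and \<Phi> :: "('b \<Rightarrow> real) set"
  assumes M: "closed M" "0 \<in> M" "\<And>x y. x \<in> M \<Longrightarrow> y \<in> M \<Longrightarrow> x + y \<in> M"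
      "\<And>r x. x \<in> M \<Longrightarrow> r *\<^sub>R x \<in> M"
    and cont: "\<And>\<phi>. \<phi> \<in> \<Phi> \<Longrightarrow> continuous_on UNIV \<phi>"
    and add: "\<And>\<phi> x y. \<phi> \<in> \<Phi> \<Longrightarrow> \<phi> (x + y) \<le> \<phi> x + \<phi> y"
    and sc: "\<And>\<phi> r x. \<phi> \<in> \<Phi> \<Longrightarrow> \<phi> (r *\<^sub>R x) = \<bar>r\<bar> * \<phi> x"
    and pw: "\<And>x. x \<in> M \<Longrightarrow> \<exists>C. \<forall>\<phi>\<in>\<Phi>. \<phi> x \<le> C"
  obtains c where "0 \<le> c" "\<And>\<phi> x. \<phi> \<in> \<Phi> \<Longrightarrow> x \<in> M \<Longrightarrow> \<phi> x \<le> c * norm x"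
proof -
  define A where "A m = {x \<in> M. \<forall>\<phi>\<in>\<Phi>. \<phi> x \<le> real m}" for m :: nat
  have "closed (A m)" for m
  proof -
    have "A m = M \<inter> (\<Inter>\<phi>\<in>\<Phi>. {x. \<phi> x \<le> real m})" by (auto simp: A_def)
    moreover have "closed {x. \<phi> x \<le> real m}" if "\<phi> \<in> \<Phi>" for \<phi>
      by (rule closed_Collect_le[OF cont[OF that] continuous_on_const])
    ultimately show ?thesis using M(1) by (simp only:) (intro closed_Int closed_INT ballI)
  qed
  then have cl: "closedin (top_of_set M) (A m)" for m
    by (intro closed_subset) (auto simp: A_def)
  have union: "(\<Union>m. A m) = M"
  proof
    show "M \<subseteq> (\<Union>m. A m)"
    proof
      fix x assume x: "x \<in> M"
      then obtain C where C: "\<forall>\<phi>\<in>\<Phi>. \<phi> x \<le> C" using pw by blast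
      obtain m :: nat where "C \<le> real m" using real_arch_simple by blast
      with C have "\<forall>\<phi>\<in>\<Phi>. \<phi> x \<le> real m" by (meson order_trans)
      with x have "x \<in> A m" by (simp add: A_def)
      then show "x \<in> (\<Union>m. A m)" by blast
    qed
  qed (auto simp: A_def)
  have "\<exists>m. top_of_set M interior_of A m \<noteq> {}"
  proof (rule ccontr)
    assume "\<not> ?thesis"
    then have "top_of_set M interior_of \<Union>(range A) = {}"
      using cl M(1)
      by (intro Baire_category_alt disjI1 completely_metrizable_space_closedin
          completely_metrizable_space_euclidean) auto
    moreover have "top_of_set M interior_of M = M"
      using interior_of_topspace[of "top_of_set M"] by simp
    ultimately show False using union M(2) by auto
  qed
  then obtain m x0 where "x0 \<in> top_of_set M interior_of A m" by auto
  then obtain U where U: "openin (top_of_set M) U" "x0 \<in> U" "U \<subseteq> A m" by (auto simp: interior_of_def)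
  then obtain r where r: "0 < r" "cball x0 r \<inter> M \<subseteq> A m"
    unfolding openin_contains_cball by blast
  have x0: "x0 \<in> A m" using U by blast
  have "\<phi> x \<le> 2 * real m / r * norm x" if \<phi>: "\<phi> \<in> \<Phi>" and x: "x \<in> M" for \<phi> x
  proof (cases "x = 0")
    case True
    then show ?thesis using sc[OF \<phi>, of 0 0] by simp
  next
    case False
    define s where "s = r / norm x"
    have s: "0 < s" using False r by (simp add: s_def)
    have "x0 + s *\<^sub>R x \<in> cball x0 r" using False r by (simp add: s_def dist_norm)
    moreover have "x0 + s *\<^sub>R x \<in> M" using x0 x by (simp add: A_def M(3,4))
    ultimately have "\<phi> (x0 + s *\<^sub>R x) \<le> real m" "\<phi> x0 \<le> real m"
      using r x0 \<phi> by (auto simp: A_def)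
    moreover have "\<phi> (s *\<^sub>R x) \<le> \<phi> (x0 + s *\<^sub>R x) + \<phi> (- x0)" using add[OF \<phi>, of "x0 + s *\<^sub>R x" "- x0"] by simp
    moreover have "\<phi> (- x0) = \<phi> x0" using sc[OF \<phi>, of "-1" x0] by simp
    moreover have "\<phi> (s *\<^sub>R x) = s * \<phi> x" using sc[OF \<phi>, of s x] s by simp
    ultimately have "s * \<phi> x \<le> 2 * real m" by linarith
    then show ?thesis using s False r by (simp add: s_def field_simps)
  qed
  moreover have "0 \<le> 2 * real m / r" using r by simp
  ultimately show thesis using that by blast
qed

section \<open>The inequality between the projective and the Bochner norm\<close>

lemma norm_tensor_lift_le_const:
  assumes B: "cbilinear B" and bd: "\<And>x y. norm (B x y) \<le> K * (norm x * norm y)" and K: "0 \<le> K"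
  shows "norm (tensor_lift B t) \<le> K * proj_norm t"
proof -
  have "norm (\<Sum>(x, y)\<leftarrow>l. B x y) \<le> K * (\<Sum>(x, y)\<leftarrow>l. norm x * norm y)" for l
  proof (induction l)
    case (Cons p l)
    obtain x y where p: "p = (x, y)" by (cases p)
    show ?case using norm_triangle_mono[OF bd[of x y] Cons.IH] by (simp add: p distrib_left)
  qed simp
  then have le: "norm (tensor_lift B t) \<le> K * (proj_norm t + e)" if "0 < e" for e
    using proj_norm_approx[OF that, of t] K
    by (metis (no_types, lifting) tensor_lift_sum[OF B] less_imp_le mult_left_mono order_trans)
  show ?thesis
  proof (cases "K = 0")
    case False
    with K have K: "0 < K" by simp
    show ?thesis
    proof (rule field_le_epsilon)
      fix e :: real assume "0 < e"
      then show "norm (tensor_lift B t) \<le> K * proj_norm t + e"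
        using le[of "e / K"] K by (simp add: distrib_left)
    qed
  qed (use le[of 1] in simp)
qed

lemma cbilinear_compose_L1_of_H1:
  "cbilinear B \<Longrightarrow> cbilinear (\<lambda>h x. B (L1_of_H1 h) x)"
  by (simp add: cbilinear_def plus_H1.rep_eq scaleC_H1.rep_eq)

lemma tensor_lift_L1_bound:
  fixes B :: "complex L1 \<Rightarrow> 'a::complex_normed_vector \<Rightarrow> complex"
  assumes B: "cbilinear B" and bd: "\<And>f x. cmod (B f x) \<le> K * (norm f * norm x)"
  shows "cmod (tensor_lift (\<lambda>h x. B (L1_of_H1 h) x) t) \<le> K * norm (tensor_lift H1_times t)"
proof -
  obtain l where l: "t = tensor_sum l" by (rule tensor_sum_cases)
  have "(\<Sum>(f, x)\<leftarrow>map (\<lambda>(h, x). (L1_of_H1 h, x)) l. B f x) = (\<Sum>(h, x)\<leftarrow>l. B (L1_of_H1 h) x)"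
    by (simp add: o_def split_def)
  moreover have "(\<Sum>(f, x)\<leftarrow>map (\<lambda>(h, x). (L1_of_H1 h, x)) l. L1_times f x) = (\<Sum>(h, x)\<leftarrow>l. H1_times h x)"
    by (simp add: o_def split_def H1_times_def)
  ultimately show ?thesis
    using L1_tensor_bound[OF B bd, of "map (\<lambda>(h, x). (L1_of_H1 h, x)) l"]
    by (simp add: l tensor_lift_sum[OF cbilinear_compose_L1_of_H1[OF B]] tensor_lift_sum[OF cbilinear_H1_times])
qed

lemma tensor_lift_tendsto:
  assumes B: "cbilinear B" and bd: "\<And>x y. norm (B x y) \<le> K * (norm x * norm y)"
    and Bn: "\<And>n. cbilinear (\<lambda>x y. B (a x n) y)" and lim: "\<And>x. (\<lambda>n. a x n) \<longlonglongrightarrow> x"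
  shows "(\<lambda>n. tensor_lift (\<lambda>x y. B (a x n) y) t) \<longlonglongrightarrow> tensor_lift B t"
proof -
  obtain l where l: "t = tensor_sum l" by (rule tensor_sum_cases)
  show ?thesis
    unfolding l tensor_lift_sum[OF B] tensor_lift_sum[OF Bn]
    by (rule cbilinear_tendsto_sum_list[OF B bd lim])
qed

text \<open>The inequality whose optimal constant is \<open>\<eta>\<close>, stated on the algebraic tensor product;
  \<open>proj_bound_iff\<close> transfers it to the completion.\<close>

definition proj_bound :: "'a::complex_banach itself \<Rightarrow> real \<Rightarrow> bool"
  where "proj_bound _ c \<longleftrightarrow>
    0 \<le> c \<and> (\<forall>t :: (H1, 'a) tensor. proj_norm t \<le> c * norm (tensor_lift H1_times t))"

lemma norm_tensor_lift_H1_times: "norm (tensor_lift H1_times t) \<le> proj_norm t"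
  by (rule norm_tensor_lift_le[OF cbilinear_H1_times]) (simp add: norm_H1_times)

lemma proj_Cauchy_canonical:
  fixes u :: "nat \<Rightarrow> (H1, 'a::complex_banach) tensor"
  assumes u: "proj_Cauchy u"
  shows "(\<lambda>n. tensor_lift H1_times (u n)) \<longlonglongrightarrow> canonical_map (abs_ptensor u)"
proof -
  have "Cauchy (\<lambda>n. tensor_lift H1_times (u n))"
  proof (rule CauchyI)
    fix e :: real assume "0 < e"
    then obtain N where N: "\<forall>m\<ge>N. \<forall>n\<ge>N. proj_norm (u m - u n) < e"
      using u by (auto simp: proj_Cauchy_def)
    have "norm (tensor_lift H1_times (u m) - tensor_lift H1_times (u n)) < e" if "N \<le> m" "N \<le> n" for m n
      using N that norm_tensor_lift_H1_times[of "u m - u n"]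
      by (auto simp: tensor_lift_diff[OF cbilinear_H1_times, symmetric] intro: le_less_trans)
    then show "\<exists>N. \<forall>m\<ge>N. \<forall>n\<ge>N. norm (tensor_lift H1_times (u m) - tensor_lift H1_times (u n)) < e"
      by blast
  qed
  then have "(\<lambda>n. tensor_lift H1_times (u n)) \<longlonglongrightarrow> lim (\<lambda>n. tensor_lift H1_times (u n))"
    by (simp add: Cauchy_convergent_iff convergent_LIMSEQ_iff)
  then show ?thesis using u by (simp add: canonical_map.abs_eq ptensor_rel_def)
qed

lemma proj_Cauchy_norm:
  assumes u: "proj_Cauchy u"
  shows "(\<lambda>n. proj_norm (u n)) \<longlonglongrightarrow> ptensor_norm (abs_ptensor u)"
proof -
  have "Cauchy (\<lambda>n. proj_norm (u n))"
  proof (rule CauchyI)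
    fix e :: real assume "0 < e"
    then obtain N where N: "\<forall>m\<ge>N. \<forall>n\<ge>N. proj_norm (u m - u n) < e"
      using u by (auto simp: proj_Cauchy_def)
    have "norm (proj_norm (u m) - proj_norm (u n)) < e" if "N \<le> m" "N \<le> n" for m n
      using N that proj_norm_diff_abs[of "u m" "u n"] by (auto intro: le_less_trans)
    then show "\<exists>N. \<forall>m\<ge>N. \<forall>n\<ge>N. norm (proj_norm (u m) - proj_norm (u n)) < e" by blast
  qed
  then have "(\<lambda>n. proj_norm (u n)) \<longlonglongrightarrow> lim (\<lambda>n. proj_norm (u n))"
    by (simp add: Cauchy_convergent_iff convergent_LIMSEQ_iff)
  then show ?thesis using u by (simp add: ptensor_norm.abs_eq ptensor_rel_def)
qed

lemma ptensor_cases: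
  obtains u where "proj_Cauchy u" "F = abs_ptensor u"
  by (induction F rule: ptensor.abs_induct) (simp add: ptensor_rel_def)

lemma proj_Cauchy_const: "proj_Cauchy (\<lambda>n. t)"
  by (simp add: proj_Cauchy_def)

lemma proj_bound_iff:
  "proj_bound TYPE('a::complex_banach) c \<longleftrightarrow>
    0 \<le> c \<and> (\<forall>F :: (H1, 'a) ptensor. ptensor_norm F \<le> c * norm (canonical_map F))"
proof (intro iffI conjI allI)
  fix F :: "(H1, 'a) ptensor" assume c: "proj_bound TYPE('a) c"
  obtain u where u: "proj_Cauchy u" "F = abs_ptensor u" by (rule ptensor_cases)
  show "ptensor_norm F \<le> c * norm (canonical_map F)"
    unfolding u(2)
  proof (rule LIMSEQ_le[OF proj_Cauchy_norm[OF u(1)]])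
    show "(\<lambda>n. c * norm (tensor_lift H1_times (u n))) \<longlonglongrightarrow> c * norm (canonical_map (abs_ptensor u))"
      by (intro tendsto_intros proj_Cauchy_canonical u)
  qed (use c in \<open>auto simp: proj_bound_def\<close>)
next
  assume c: "0 \<le> c \<and> (\<forall>F :: (H1, 'a) ptensor. ptensor_norm F \<le> c * norm (canonical_map F))"
  have "proj_norm t \<le> c * norm (tensor_lift H1_times t)" for t :: "(H1, 'a) tensor"
    using c LIMSEQ_unique[OF proj_Cauchy_norm[OF proj_Cauchy_const, of t] tendsto_const]
      LIMSEQ_unique[OF proj_Cauchy_canonical[OF proj_Cauchy_const, of t] tendsto_const]
    by metis
  with c show "proj_bound TYPE('a) c" by (simp add: proj_bound_def)
qed (simp add: proj_bound_def)

lemma H1_times_in_Htilde1: "H1_times h x \<in> Htilde1"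
proof -
  obtain p :: "nat \<Rightarrow> H1" and d :: "nat \<Rightarrow> nat" and a :: "nat \<Rightarrow> nat \<Rightarrow> complex"
    where p: "\<And>m. p m = (\<Sum>k\<le>d m. a m k *\<^sub>C H1_exp k)" "p \<longlonglongrightarrow> h"
    using H1_polynomials_dense[of h] by blast
  have "H1_times (p m) x = analytic_poly (d m) (\<lambda>k. a m k *\<^sub>C x)" for m
    by (simp add: p(1) analytic_poly_eq cbilinear_sum_left[OF cbilinear_H1_times]
        cbilinear_scaleC_left[OF cbilinear_H1_times] cbilinear_scaleC_right[OF cbilinear_L1_times])
      (simp add: H1_times_def H1_exp.rep_eq)
  then have "H1_times (p m) x \<in> Htilde1" for m by (simp add: analytic_poly_in_Htilde1)
  moreover have "(\<lambda>m. H1_times (p m) x) \<longlonglongrightarrow> H1_times h x"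
  proof -
    have "(\<lambda>m. norm (p m - h) * norm x) \<longlonglongrightarrow> 0 * norm x"
      by (intro tendsto_intros tendsto_norm_zero LIM_zero p(2))
    then have "(\<lambda>m. norm (H1_times (p m) x - H1_times h x)) \<longlonglongrightarrow> 0"
      by (simp add: cbilinear_diff_left[OF cbilinear_H1_times, symmetric] norm_H1_times)
    then show ?thesis by (simp add: LIM_zero_iff tendsto_norm_zero_iff)
  qed
  ultimately show ?thesis by (rule closed_sequentially[rotated]) (simp add: Htilde1_def)
qed

lemma tensor_lift_in_Htilde1: "tensor_lift H1_times t \<in> Htilde1"
proof -
  obtain l where l: "t = tensor_sum l" by (rule tensor_sum_cases)
  have "(\<Sum>(h, x)\<leftarrow>l. H1_times h x) \<in> Htilde1"
    by (induction l) (auto intro: Htilde1_zero Htilde1_add H1_times_in_Htilde1)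
  then show ?thesis by (simp add: l tensor_lift_sum[OF cbilinear_H1_times])
qed

text \<open>The estimate makes the range of the canonical map complete, hence closed.\<close>

lemma H1_projective_if_proj_bound:
  assumes c: "proj_bound TYPE('a::complex_banach) c"
  shows "H1_projective TYPE('a)"
  unfolding H1_projective_def
proof
  show "range (canonical_map :: (H1, 'a) ptensor \<Rightarrow> 'a L1) \<subseteq> Htilde1"
  proof
    fix G :: "'a L1" assume "G \<in> range canonical_map"
    then obtain F :: "(H1, 'a) ptensor" where F: "G = canonical_map F" by blast
    obtain u where u: "proj_Cauchy u" "F = abs_ptensor u" by (rule ptensor_cases)
    show "G \<in> Htilde1"
      unfolding F u(2)
      by (rule closed_sequentially[OF _ tensor_lift_in_Htilde1 proj_Cauchy_canonical[OF u(1)]])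
        (simp add: Htilde1_def)
  qed
  show "Htilde1 \<subseteq> range (canonical_map :: (H1, 'a) ptensor \<Rightarrow> 'a L1)"
  proof
    fix G :: "'a L1" assume "G \<in> Htilde1"
    then obtain p where p: "\<And>m. p m \<in> {analytic_poly n x |n x. True}" "p \<longlonglongrightarrow> G"
      unfolding Htilde1_def closure_sequential by blast
    have "\<exists>t. tensor_lift H1_times t = p m" for m
    proof -
      obtain n x where nx: "p m = analytic_poly n x" using p(1)[of m] by blast
      have "tensor_lift H1_times (tensor_sum (map (\<lambda>k. (H1_exp k, x k)) [0..<Suc n])) = p m"
        unfolding tensor_lift_sum[OF cbilinear_H1_times] nx analytic_poly_eq
        by (simp add: o_def H1_times_def H1_exp.rep_eq sum_list_distinct_conv_sum_set atLeast0LessThan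
            lessThan_Suc_atMost del: upt_Suc)
      then show ?thesis by blast
    qed
    then obtain u where u: "\<And>m. tensor_lift H1_times (u m) = p m" by metis
    have le: "proj_norm (u m - u n) \<le> c * norm (p m - p n)" for m n
      using c by (simp add: proj_bound_def u[symmetric] tensor_lift_diff[OF cbilinear_H1_times, symmetric])
    have c0: "0 \<le> c" using c by (simp add: proj_bound_def)
    have "proj_Cauchy u"
      unfolding proj_Cauchy_def
    proof (intro allI impI)
      fix e :: real assume e: "0 < e"
      have "Cauchy p" using p(2) by (rule LIMSEQ_imp_Cauchy)
      then obtain N where N: "\<And>m n. N \<le> m \<Longrightarrow> N \<le> n \<Longrightarrow> norm (p m - p n) < e / (c + 1)"
        using CauchyD[of p "e / (c + 1)"] e c0 by auto
      have "proj_norm (u m - u n) < e" if "N \<le> m" "N \<le> n" for m n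
      proof -
        have "c * norm (p m - p n) \<le> (c + 1) * norm (p m - p n)" by (simp add: distrib_right)
        also have "\<dots> < (c + 1) * (e / (c + 1))" using N[OF that] c0 by (intro mult_strict_left_mono) auto
        also have "\<dots> = e" using c0 by simp
        finally show ?thesis using le[of m n] by linarith
      qed
      then show "\<exists>N. \<forall>m\<ge>N. \<forall>n\<ge>N. proj_norm (u m - u n) < e" by blast
    qed
    from proj_Cauchy_canonical[OF this] have "p \<longlonglongrightarrow> canonical_map (abs_ptensor u)" by (simp add: u)
    then have "G = canonical_map (abs_ptensor u)" using p(2) by (simp add: LIMSEQ_unique)
    then show "G \<in> range (canonical_map :: (H1, 'a) ptensor \<Rightarrow> 'a L1)" by blast
  qed
qed

section \<open>Projectivity and extension of operators\<close>

text \<open>The seminorms of \<open>\<Phi>\<close> are the moduli of functionals on \<open>L\<^sup>1(X)\<close> representing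
  \<open>(h, x) \<mapsto> \<langle>v (R\<^sub>n h), x\<rangle>\<close> with \<open>\<parallel>v\<parallel> \<le> 1\<close>.  Each is continuous because \<open>R\<^sub>n\<close> is bounded on \<open>L\<^sup>1\<close>;
  at the image of an element \<open>F\<close> of the completed tensor product all of them are at most
  \<open>2 \<parallel>F\<parallel>\<^sub>\<pi>\<close>, because \<open>R\<^sub>n\<close> has norm at most \<open>2\<close> on \<open>H\<^sup>1\<close>.\<close>

lemma proj_bound_if_H1_projective:
  assumes proj: "H1_projective TYPE('a::complex_banach)"
  obtains c where "proj_bound TYPE('a) c"
proof -
  obtain R :: "nat \<Rightarrow> complex L1 \<Rightarrow>\<^sub>L H1" where R: "\<And>n. R n \<in> bounded_ops"
    "\<And>n h. norm (blinfun_apply (R n) (L1_of_H1 h)) \<le> (1 + 1 / real (Suc n)) * norm h"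
    "\<And>h. (\<lambda>n. blinfun_apply (R n) (L1_of_H1 h)) \<longlonglongrightarrow> h"
    by (rule H1_finite_rank_approximation) blast
  define B where "B v n h x = dual_apply (blinfun_apply v (blinfun_apply (R n) (L1_of_H1 h))) x"
    for v :: "H1 \<Rightarrow>\<^sub>L 'a dual" and n h x
  have B: "cbilinear (B v n)" if v: "v \<in> bounded_ops" for v n
    unfolding B_def
    using cbilinear_compose_L1_of_H1[OF cbilinear_operator[OF bounded_ops_compose[OF v R(1)]]] by simp
  have B_le: "cmod (B v n h x) \<le> 2 * (norm h * norm x)" if v: "norm v \<le> 1" for v n h x
  proof -
    have "cmod (B v n h x) \<le> norm v * (norm (blinfun_apply (R n) (L1_of_H1 h)) * norm x)"
      unfolding B_def by (rule operator_pairing_le)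
    also have "\<dots> \<le> 1 * (norm (blinfun_apply (R n) (L1_of_H1 h)) * norm x)"
      using v by (intro mult_right_mono) auto
    also have "norm (blinfun_apply (R n) (L1_of_H1 h)) \<le> 2 * norm h"
    proof -
      have "(1 + 1 / real (Suc n)) * norm h \<le> 2 * norm h"
        by (intro mult_right_mono) (auto simp: field_simps)
      with R(2)[of n h] show ?thesis by linarith
    qed
    then have "1 * (norm (blinfun_apply (R n) (L1_of_H1 h)) * norm x) \<le> 2 * (norm h * norm x)"
      by (simp add: mult.assoc[symmetric] mult_right_mono)
    finally show ?thesis .
  qed
  have B_L1: "cmod (tensor_lift (B v n) t) \<le> norm (v o\<^sub>L R n) * norm (tensor_lift H1_times t)"
    if v: "v \<in> bounded_ops" for v n t
    using tensor_lift_L1_bound[OF cbilinear_operator[OF bounded_ops_compose[OF v R(1)]] operator_pairing_le, of n t]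
    by (simp add: B_def [abs_def])
  define \<Phi> where "\<Phi> = {\<lambda>F. cmod (blinfun_apply w F) |w. w \<in> bounded_ops \<and>
    (\<exists>v\<in>bounded_ops. norm v \<le> 1 \<and>
      (\<exists>n. \<forall>t. blinfun_apply w (tensor_lift H1_times t) = tensor_lift (B v n) t))}"
  have \<Phi>D: "\<exists>w. w \<in> bounded_ops \<and> \<phi> = (\<lambda>F. cmod (blinfun_apply w F)) \<and>
    (\<exists>v\<in>bounded_ops. norm v \<le> 1 \<and>
      (\<exists>n. \<forall>t. blinfun_apply w (tensor_lift H1_times t) = tensor_lift (B v n) t))" if "\<phi> \<in> \<Phi>" for \<phi>
    using that unfolding \<Phi>_def by blast
  obtain c where c: "0 \<le> c" "\<And>\<phi> F. \<phi> \<in> \<Phi> \<Longrightarrow> F \<in> Htilde1 \<Longrightarrow> \<phi> F \<le> c * norm F"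
  proof (rule uniform_boundedness_seminorms[of "Htilde1 :: 'a L1 set" \<Phi>])
    show "closed (Htilde1 :: 'a L1 set)" by (simp add: Htilde1_def)
    show "r *\<^sub>R F \<in> Htilde1" if "F \<in> Htilde1" for r and F :: "'a L1"
      using Htilde1_scaleC[OF that, of "complex_of_real r"] by (simp add: scaleC_of_real)
    fix \<phi> assume "\<phi> \<in> \<Phi>"
    then obtain w where \<phi>: "\<phi> = (\<lambda>F. cmod (blinfun_apply w F))" using \<Phi>D by blast
    show "continuous_on UNIV \<phi>" unfolding \<phi> by (intro continuous_intros)
    show "\<phi> (F + G) \<le> \<phi> F + \<phi> G" for F G by (simp add: \<phi> blinfun.add_right norm_triangle_ineq)
    show "\<phi> (r *\<^sub>R F) = \<bar>r\<bar> * \<phi> F" for r F by (simp add: \<phi> blinfun.scaleR_right)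
  next
    fix G :: "'a L1" assume "G \<in> Htilde1"
    then obtain F where F: "G = canonical_map F" using proj unfolding H1_projective_def by blast
    obtain u where u: "proj_Cauchy u" "F = abs_ptensor u" by (rule ptensor_cases)
    have lim: "(\<lambda>i. tensor_lift H1_times (u i)) \<longlonglongrightarrow> G"
      unfolding F u(2) by (rule proj_Cauchy_canonical[OF u(1)])
    have "\<phi> G \<le> 2 * ptensor_norm F" if "\<phi> \<in> \<Phi>" for \<phi>
    proof -
      obtain w v n where \<phi>: "\<phi> = (\<lambda>F. cmod (blinfun_apply w F))"
        and v: "v \<in> bounded_ops" "norm v \<le> 1"
          "\<And>t. blinfun_apply w (tensor_lift H1_times t) = tensor_lift (B v n) t"
        using \<Phi>D[OF \<open>\<phi> \<in> \<Phi>\<close>] by auto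
      have "(\<lambda>i. cmod (tensor_lift (B v n) (u i))) \<longlonglongrightarrow> cmod (blinfun_apply w G)"
        using tendsto_norm[OF blinfun_apply_tendsto[OF lim, of w]] unfolding v(3) .
      moreover have "(\<lambda>i. 2 * proj_norm (u i)) \<longlonglongrightarrow> 2 * ptensor_norm F"
        unfolding u(2) by (intro tendsto_intros proj_Cauchy_norm u(1))
      ultimately have "cmod (blinfun_apply w G) \<le> 2 * ptensor_norm F"
        by (rule LIMSEQ_le) (use norm_tensor_lift_le_const[OF B[OF v(1)] B_le[OF v(2)]] in auto)
      then show ?thesis by (simp only: \<phi>)
    qed
    then show "\<exists>C. \<forall>\<phi>\<in>\<Phi>. \<phi> G \<le> C" by blast
  qed (simp_all add: Htilde1_zero Htilde1_add)
  have "proj_norm t \<le> c * norm (tensor_lift H1_times t)" for t :: "(H1, 'a) tensor"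
  proof -
    obtain v :: "H1 \<Rightarrow>\<^sub>L 'a dual" where v: "v \<in> bounded_ops" "norm v \<le> 1"
      "Re (tensor_lift (\<lambda>h x. dual_apply (blinfun_apply v h) x) t) = proj_norm t"
      by (rule proj_norm_attained)
    have "cmod (tensor_lift (B v n) t) \<le> c * norm (tensor_lift H1_times t)" for n
    proof -
      obtain w :: "'a L1 \<Rightarrow>\<^sub>L complex" where w: "w \<in> bounded_ops" "norm w \<le> norm (v o\<^sub>L R n)"
        "\<And>t. blinfun_apply w (tensor_lift H1_times t) = tensor_lift (B v n) t"
        using extend_bilinear_form[OF B[OF v(1)] norm_ge_zero B_L1[OF v(1)]] by blast
      have "(\<lambda>F. cmod (blinfun_apply w F)) \<in> \<Phi>"
        unfolding \<Phi>_def using w(1,3) v(1,2) by blast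
      from c(2)[OF this tensor_lift_in_Htilde1] show ?thesis by (simp add: w(3))
    qed
    moreover have "(\<lambda>n. tensor_lift (B v n) t) \<longlonglongrightarrow> tensor_lift (\<lambda>h x. dual_apply (blinfun_apply v h) x) t"
      using tensor_lift_tendsto[OF cbilinear_operator[OF v(1)] operator_pairing_le
          B[OF v(1), unfolded B_def] R(3)] unfolding B_def .
    ultimately have "cmod (tensor_lift (\<lambda>h x. dual_apply (blinfun_apply v h) x) t)
        \<le> c * norm (tensor_lift H1_times t)"
      by (intro LIMSEQ_le_const2[OF tendsto_norm]) auto
    with v(3) complex_Re_le_cmod show ?thesis by (metis order_trans)
  qed
  with c(1) show thesis by (intro that[of c]) (simp add: proj_bound_def)
qed

lemma extension_const_if_proj_bound:
  assumes c: "proj_bound TYPE('a::complex_banach) c"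
  shows "extension_const TYPE('a) c"
  unfolding extension_const_def
proof
  fix v :: "H1 \<Rightarrow>\<^sub>L 'a dual" assume v: "v \<in> bounded_ops"
  let ?B = "\<lambda>h x. dual_apply (blinfun_apply v h) x"
  have B: "cbilinear ?B" by (rule cbilinear_operator[OF v])
  have c0: "0 \<le> c * norm v" using c by (simp add: proj_bound_def)
  have "cmod (tensor_lift ?B t) \<le> c * norm v * norm (tensor_lift H1_times t)" for t
  proof -
    have "cmod (tensor_lift ?B t) \<le> norm v * proj_norm t"
      by (rule norm_tensor_lift_le_const[OF B operator_pairing_le norm_ge_zero])
    also have "\<dots> \<le> norm v * (c * norm (tensor_lift H1_times t))"
      using c by (intro mult_left_mono) (auto simp: proj_bound_def)
    finally show ?thesis by (simp add: mult_ac)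
  qed
  then obtain \<Psi> :: "'a L1 \<Rightarrow>\<^sub>L complex" where \<Psi>: "\<Psi> \<in> bounded_ops" "norm \<Psi> \<le> c * norm v"
    "\<And>t. blinfun_apply \<Psi> (tensor_lift H1_times t) = tensor_lift ?B t"
    using extend_bilinear_form[OF B c0] by blast
  have B1: "cbilinear (\<lambda>f x. blinfun_apply \<Psi> (L1_times f x))"
    using cbilinear_L1_times[where 'a = 'a]
    by (simp add: cbilinear_def blinfun.add_right bounded_ops_scaleC[OF \<Psi>(1)])
  have B2: "cmod (blinfun_apply \<Psi> (L1_times f x)) \<le> c * norm v * (norm f * norm x)" for f x
  proof -
    have "cmod (blinfun_apply \<Psi> (L1_times f x)) \<le> norm \<Psi> * norm (L1_times f x)" by (rule norm_blinfun)
    also have "\<dots> \<le> c * norm v * norm (L1_times f x)" by (rule mult_right_mono[OF \<Psi>(2) norm_ge_zero])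
    finally show ?thesis by (simp add: norm_L1_times)
  qed
  obtain w :: "complex L1 \<Rightarrow>\<^sub>L 'a dual" where w: "w \<in> bounded_ops"
    "\<And>f x. dual_apply (blinfun_apply w f) x = blinfun_apply \<Psi> (L1_times f x)" "norm w \<le> c * norm v"
    using operator_of_bilinear_form[OF B1 B2 c0] by blast
  have "dual_apply (blinfun_apply w (L1_of_H1 h)) x = dual_apply (blinfun_apply v h) x" for h x
    using \<Psi>(3)[of "tensor_sum [(h, x)]"]
    by (simp add: w(2) tensor_lift_sum[OF B] tensor_lift_sum[OF cbilinear_H1_times] H1_times_def)
  then have "extends w v" unfolding extends_def by (intro allI) (rule dual_eqI)
  with w show "\<exists>w\<in>bounded_ops. extends w v \<and> norm w \<le> c * norm v" by blast
qed

text \<open>An extension \<open>w\<close> of \<open>v\<close> is composed with a multiplier \<open>V\<close> fixing the frequencies \<open>0, \<dots>, k\<close> on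
  which \<open>v\<close> lives.  At higher frequencies \<open>V\<close> acts by scalars and \<open>v\<close> vanishes, so \<open>w V\<close> still
  extends \<open>v\<close>.\<close>

lemma extension_const_fin_if_extension_const:
  assumes l: "extension_const TYPE('a::complex_banach) l" and "0 \<le> l" and e: "0 < e"
  shows "extension_const_fin TYPE('a) (l * (1 + e))"
  unfolding extension_const_fin_def
proof
  fix v :: "H1 \<Rightarrow>\<^sub>L 'a dual" assume "v \<in> H1_ops_fin"
  then obtain k where v: "v \<in> bounded_ops" "\<And>n. k < n \<Longrightarrow> blinfun_apply v (H1_exp n) = 0"
    by (auto simp: H1_ops_fin_def)
  obtain w where w: "w \<in> bounded_ops" "extends w v" "norm w \<le> l * norm v"
    using l v(1) by (auto simp: extension_const_def)
  obtain L :: nat where L: "real k / e < real L" using reals_Archimedean2 by blast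
  then have L0: "0 < L" using e by (cases "L = 0") (auto simp: divide_less_0_iff not_less)
  have kL: "real k / (2 * real L) \<le> e"
  proof -
    have "real k \<le> e * real L" using L e by (simp add: field_simps)
    also have "\<dots> \<le> e * (2 * real L)" using e by simp
    finally show ?thesis using L0 by (simp add: field_simps)
  qed
  obtain V :: "complex L1 \<Rightarrow>\<^sub>L complex L1" where V: "V \<in> bounded_ops" "norm V \<le> 1 + real k / (2 * real L)"
    "\<And>n. \<exists>c. blinfun_apply V (L1_exp n) = c *\<^sub>C L1_exp n"
    "\<And>n. n \<le> k \<Longrightarrow> blinfun_apply V (L1_exp (int n)) = L1_exp (int n)"
    "\<And>n. n \<notin> {- int (L + k)..int (L + k)} \<Longrightarrow> blinfun_apply V (L1_exp n) = 0"
    by (rule de_la_Vallee_Poussin[OF L0, of k]) blast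
  have wv: "blinfun_apply w (L1_exp (int n)) = blinfun_apply v (H1_exp n)" for n
    using w(2) by (metis extends_def H1_exp.rep_eq)
  have wV: "w o\<^sub>L V \<in> bounded_ops" by (rule bounded_ops_compose[OF w(1) V(1)])
  have "(w o\<^sub>L V) o\<^sub>L H1_embed = v"
  proof (rule H1_operator_eqI[OF bounded_ops_compose[OF wV H1_embed_bounded_ops] v(1)])
    fix n
    obtain c where c: "blinfun_apply V (L1_exp (int n)) = c *\<^sub>C L1_exp (int n)" using V(3) by blast
    have "blinfun_apply w (blinfun_apply V (L1_exp (int n))) = blinfun_apply v (H1_exp n)"
    proof (cases "n \<le> k")
      case False
      then show ?thesis by (simp add: c bounded_ops_scaleC[OF w(1)] wv v(2))
    qed (simp add: V(4) wv)
    then show "blinfun_apply ((w o\<^sub>L V) o\<^sub>L H1_embed) (H1_exp n) = blinfun_apply v (H1_exp n)"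
      by (simp add: H1_exp.rep_eq)
  qed
  then have "extends (w o\<^sub>L V) v" by (auto simp: extends_def)
  moreover have "w o\<^sub>L V \<in> L1_ops_fin"
    unfolding L1_ops_fin_def using wV L0 V(5) by (auto intro!: exI[of _ "L + k"] simp: blinfun.zero_right)
  moreover have "norm (w o\<^sub>L V) \<le> l * (1 + e) * norm v"
  proof -
    have "norm (w o\<^sub>L V) \<le> norm w * norm V" by (rule norm_blinfun_compose)
    also have "\<dots> \<le> (l * norm v) * (1 + e)"
      using w(3) V(2) kL \<open>0 \<le> l\<close> by (intro mult_mono) auto
    finally show ?thesis by (simp add: mult_ac)
  qed
  ultimately show "\<exists>w\<in>L1_ops_fin. extends w v \<and> norm w \<le> l * (1 + e) * norm v" by blast
qed

text \<open>A norming operator \<open>v\<close> is approximated by the operators \<open>v R\<^sub>n\<close>, which have finite spectrum.\<close>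

lemma proj_bound_if_extension_const_fin:
  assumes l: "extension_const_fin TYPE('a::complex_banach) l" and l0: "0 \<le> l"
  shows "proj_bound TYPE('a) l"
proof -
  obtain R :: "nat \<Rightarrow> complex L1 \<Rightarrow>\<^sub>L H1" where R: "\<And>n. R n \<in> bounded_ops"
    "\<And>n h. norm (blinfun_apply (R n) (L1_of_H1 h)) \<le> (1 + 1 / real (Suc n)) * norm h"
    "\<And>h. (\<lambda>n. blinfun_apply (R n) (L1_of_H1 h)) \<longlonglongrightarrow> h"
    "\<And>n. \<exists>N>0. \<forall>m>N. blinfun_apply (R n) (L1_of_H1 (H1_exp m)) = 0"
    by (rule H1_finite_rank_approximation) blast
  have "proj_norm t \<le> l * norm (tensor_lift H1_times t)" for t :: "(H1, 'a) tensor"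
  proof -
    obtain v :: "H1 \<Rightarrow>\<^sub>L 'a dual" where v: "v \<in> bounded_ops" "norm v \<le> 1"
      "Re (tensor_lift (\<lambda>h x. dual_apply (blinfun_apply v h) x) t) = proj_norm t"
      by (rule proj_norm_attained)
    define u where "u n = v o\<^sub>L R n o\<^sub>L H1_embed" for n
    have u: "u n \<in> bounded_ops" for n
      unfolding u_def by (intro bounded_ops_compose v R H1_embed_bounded_ops)
    have u_apply: "blinfun_apply (u n) h = blinfun_apply v (blinfun_apply (R n) (L1_of_H1 h))" for n h
      by (simp add: u_def)
    have "cmod (tensor_lift (\<lambda>h x. dual_apply (blinfun_apply (u n) h) x) t)
        \<le> l * (1 + 1 / real (Suc n)) * norm (tensor_lift H1_times t)" for n
    proof -
      have "norm (u n) \<le> 1 + 1 / real (Suc n)"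
      proof (rule norm_blinfun_bound)
        fix h
        have "norm (blinfun_apply (u n) h) \<le> norm v * norm (blinfun_apply (R n) (L1_of_H1 h))"
          unfolding u_apply by (rule norm_blinfun)
        also have "\<dots> \<le> 1 * norm (blinfun_apply (R n) (L1_of_H1 h))"
          by (rule mult_right_mono[OF v(2) norm_ge_zero])
        finally show "norm (blinfun_apply (u n) h) \<le> (1 + 1 / real (Suc n)) * norm h"
          using R(2)[of n h] by linarith
      qed simp
      then have nu: "l * norm (u n) \<le> l * (1 + 1 / real (Suc n))" by (rule mult_left_mono[OF _ l0])
      obtain N where N: "0 < N" "\<forall>m>N. blinfun_apply (R n) (L1_of_H1 (H1_exp m)) = 0" using R(4) by blast
      then have "u n \<in> H1_ops_fin"
        unfolding H1_ops_fin_def using u by (auto simp: u_apply blinfun.zero_right)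
      then obtain w where w: "w \<in> L1_ops_fin" "extends w (u n)" "norm w \<le> l * norm (u n)"
        using l by (auto simp: extension_const_fin_def)
      have wb: "w \<in> bounded_ops" using w(1) by (simp add: L1_ops_fin_def)
      have "cmod (tensor_lift (\<lambda>h x. dual_apply (blinfun_apply w (L1_of_H1 h)) x) t)
          \<le> norm w * norm (tensor_lift H1_times t)"
        by (rule tensor_lift_L1_bound[OF cbilinear_operator[OF wb] operator_pairing_le])
      moreover have "blinfun_apply w (L1_of_H1 h) = blinfun_apply (u n) h" for h
        using w(2) by (simp add: extends_def)
      moreover have "norm w * norm (tensor_lift H1_times t)
          \<le> l * (1 + 1 / real (Suc n)) * norm (tensor_lift H1_times t)"
        using w(3) nu by (intro mult_right_mono) auto
      ultimately show ?thesis by simp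
    qed
    moreover have "(\<lambda>n. tensor_lift (\<lambda>h x. dual_apply (blinfun_apply (u n) h) x) t)
        \<longlonglongrightarrow> tensor_lift (\<lambda>h x. dual_apply (blinfun_apply v h) x) t"
      using tensor_lift_tendsto[OF cbilinear_operator[OF v(1)] operator_pairing_le
          cbilinear_operator[OF u, unfolded u_apply] R(3)] unfolding u_apply .
    moreover have "(\<lambda>n. l * (1 + 1 / real (Suc n)) * norm (tensor_lift H1_times t))
        \<longlonglongrightarrow> l * (1 + 0) * norm (tensor_lift H1_times t)"
      using LIMSEQ_inverse_real_of_nat by (intro tendsto_intros) (simp add: inverse_eq_divide)
    ultimately have "cmod (tensor_lift (\<lambda>h x. dual_apply (blinfun_apply v h) x) t)
        \<le> l * (1 + 0) * norm (tensor_lift H1_times t)"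
      by (intro LIMSEQ_le[OF tendsto_norm]) auto
    with v(3) complex_Re_le_cmod[of "tensor_lift (\<lambda>h x. dual_apply (blinfun_apply v h) x) t"]
    show ?thesis by simp
  qed
  with l0 show ?thesis by (simp add: proj_bound_def)
qed

lemma proj_bound_if_extension_const:
  assumes l: "extension_const TYPE('a::complex_banach) l" and l0: "0 \<le> l"
  shows "proj_bound TYPE('a) l"
  unfolding proj_bound_def
proof (intro conjI allI l0)
  fix t :: "(H1, 'a) tensor"
  define a where "a = norm (tensor_lift H1_times t)"
  have le: "proj_norm t \<le> l * (1 + e) * a" if "0 < e" for e
    using proj_bound_if_extension_const_fin[OF extension_const_fin_if_extension_const[OF l l0 that]] l0 that
    by (simp add: proj_bound_def a_def)
  have "0 \<le> l * a" using l0 by (simp add: a_def)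
  have "proj_norm t \<le> l * a"
  proof (rule field_le_epsilon)
    fix e :: real assume e: "0 < e"
    define d where "d = e / (l * a + 1)"
    have d: "0 < d" using e \<open>0 \<le> l * a\<close> by (simp add: d_def)
    have "d * (l * a) \<le> d * (l * a + 1)" using d by (simp add: distrib_left)
    also have "\<dots> = e" using \<open>0 \<le> l * a\<close> by (simp add: d_def)
    finally have "l * (1 + d) * a \<le> l * a + e" by (simp add: algebra_simps)
    with le[OF d] show "proj_norm t \<le> l * a + e" by linarith
  qed
  then show "proj_norm t \<le> l * norm (tensor_lift H1_times t)" by (simp add: a_def)
qed

lemma \<eta>_eq_Inf_proj_bound: "\<eta> TYPE('a::complex_banach) = Inf {c. proj_bound TYPE('a) c}"
  by (simp add: \<eta>_def proj_bound_iff)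

lemma \<eta>_le:
  assumes "proj_bound TYPE('a::complex_banach) c"
  shows "\<eta> TYPE('a) \<le> c"
  unfolding \<eta>_eq_Inf_proj_bound
  by (rule cInf_lower) (use assms in \<open>auto simp: proj_bound_def intro!: bdd_belowI[of _ 0]\<close>)

lemma proj_bound_\<eta>:
  assumes "proj_bound TYPE('a::complex_banach) c"
  shows "proj_bound TYPE('a) (\<eta> TYPE('a))"
proof -
  have ne: "{c. proj_bound TYPE('a) c} \<noteq> {}" using assms by blast
  have "proj_norm t \<le> \<eta> TYPE('a) * norm (tensor_lift H1_times t)" for t :: "(H1, 'a) tensor"
  proof (cases "norm (tensor_lift H1_times t) = 0")
    \<comment> \<open>Division is impossible, but any admissible constant gives \<open>\<parallel>t\<parallel>\<^sub>\<pi> = 0\<close>.\<close>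
    case True
    then show ?thesis using assms by (simp add: proj_bound_def) (metis True mult_zero_right)
  next
    case False
    then have a: "0 < norm (tensor_lift H1_times t)" by simp
    have "proj_norm t / norm (tensor_lift H1_times t) \<le> \<eta> TYPE('a)"
      unfolding \<eta>_eq_Inf_proj_bound
      by (rule cInf_greatest[OF ne]) (use a in \<open>auto simp: proj_bound_def divide_le_eq\<close>)
    then show ?thesis using a by (simp add: divide_le_eq)
  qed
  moreover have "0 \<le> \<eta> TYPE('a)"
    unfolding \<eta>_eq_Inf_proj_bound by (rule cInf_greatest[OF ne]) (auto simp: proj_bound_def)
  ultimately show ?thesis by (simp add: proj_bound_def)
qed

lemma proj_bound_mono: "proj_bound TYPE('a::complex_banach) c \<Longrightarrow> c \<le> d \<Longrightarrow> proj_bound TYPE('a) d"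
  unfolding proj_bound_def by (meson mult_right_mono norm_ge_zero order_trans)

lemma extension_const_fin_mono:
  "extension_const_fin TYPE('a::complex_banach) l \<Longrightarrow> l \<le> m \<Longrightarrow> extension_const_fin TYPE('a) m"
  unfolding extension_const_fin_def by (meson mult_right_mono norm_ge_zero order_trans)

lemma \<eta>_eq_Inf_extension_const_fin:
  assumes c: "proj_bound TYPE('a::complex_banach) c"
  shows "\<eta> TYPE('a) = Inf {l. 0 < l \<and> extension_const_fin TYPE('a) l}"
proof (rule antisym)
  note b = proj_bound_\<eta>[OF c]
  have \<eta>0: "0 \<le> \<eta> TYPE('a)" using b by (simp add: proj_bound_def)
  have fin: "extension_const_fin TYPE('a) (\<eta> TYPE('a) + e)" if e: "0 < e" for e
  proof -
    define d where "d = e / (\<eta> TYPE('a) + 1)"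
    have d: "0 < d" using e \<eta>0 by (simp add: d_def)
    have "\<eta> TYPE('a) * d \<le> (\<eta> TYPE('a) + 1) * d" using d by (intro mult_right_mono) auto
    also have "\<dots> = e" using \<eta>0 by (simp add: d_def)
    finally have "\<eta> TYPE('a) * (1 + d) \<le> \<eta> TYPE('a) + e" by (simp add: algebra_simps)
    with extension_const_fin_if_extension_const[OF extension_const_if_proj_bound[OF b] \<eta>0 d]
    show ?thesis by (rule extension_const_fin_mono)
  qed
  show "\<eta> TYPE('a) \<le> Inf {l. 0 < l \<and> extension_const_fin TYPE('a) l}"
  proof (rule cInf_greatest)
    show "{l. 0 < l \<and> extension_const_fin TYPE('a) l} \<noteq> {}"
      using fin[of 1] \<eta>0 by (auto intro!: exI[of _ "\<eta> TYPE('a) + 1"])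
  qed (auto intro!: \<eta>_le proj_bound_if_extension_const_fin)
  show "Inf {l. 0 < l \<and> extension_const_fin TYPE('a) l} \<le> \<eta> TYPE('a)"
  proof (rule field_le_epsilon)
    fix e :: real assume e: "0 < e"
    show "Inf {l. 0 < l \<and> extension_const_fin TYPE('a) l} \<le> \<eta> TYPE('a) + e"
      by (rule cInf_lower) (use fin[OF e] e \<eta>0 in \<open>auto intro!: bdd_belowI[of _ 0]\<close>)
  qed
qed

theorem proposition2p3:
  shows "(H1_projective TYPE('x::complex_banach) \<longleftrightarrow> (\<exists>l>0. extension_const TYPE('x) l)) \<and>
    (H1_projective TYPE('x) \<longleftrightarrow> (\<exists>l>0. extension_const_fin TYPE('x) l)) \<and>
    (H1_projective TYPE('x) \<longrightarrow>
      extension_const TYPE('x) (\<eta> TYPE('x)) \<and>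
      (\<forall>l>0. extension_const TYPE('x) l \<longrightarrow> \<eta> TYPE('x) \<le> l) \<and>
      \<eta> TYPE('x) = Inf {l. 0 < l \<and> extension_const_fin TYPE('x) l})"
proof -
  have pos: "\<exists>l>0. proj_bound TYPE('x) l" if proj: "H1_projective TYPE('x)"
  proof -
    obtain c where c: "proj_bound TYPE('x) c" by (rule proj_bound_if_H1_projective[OF proj])
    then have "0 < c + 1" by (simp add: proj_bound_def)
    moreover have "proj_bound TYPE('x) (c + 1)" by (rule proj_bound_mono[OF c]) simp
    ultimately show ?thesis by blast
  qed
  have "H1_projective TYPE('x) \<longleftrightarrow> (\<exists>l>0. extension_const TYPE('x) l)"
    using pos extension_const_if_proj_bound H1_projective_if_proj_bound proj_bound_if_extension_const
    by (metis less_imp_le)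
  moreover have "H1_projective TYPE('x) \<longleftrightarrow> (\<exists>l>0. extension_const_fin TYPE('x) l)"
  proof
    assume "H1_projective TYPE('x)"
    with pos obtain l where l: "0 < l" "proj_bound TYPE('x) l" by blast
    have "extension_const_fin TYPE('x) (l * (1 + 1))"
      by (rule extension_const_fin_if_extension_const[OF extension_const_if_proj_bound[OF l(2)]])
        (use l in auto)
    moreover have "0 < l * (1 + 1)" using l by simp
    ultimately show "\<exists>l>0. extension_const_fin TYPE('x) l" by blast
  next
    assume "\<exists>l>0. extension_const_fin TYPE('x) l"
    then show "H1_projective TYPE('x)"
      using proj_bound_if_extension_const_fin H1_projective_if_proj_bound less_imp_le by metis
  qed
  moreover have "extension_const TYPE('x) (\<eta> TYPE('x)) \<and>
      (\<forall>l>0. extension_const TYPE('x) l \<longrightarrow> \<eta> TYPE('x) \<le> l) \<and>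
      \<eta> TYPE('x) = Inf {l. 0 < l \<and> extension_const_fin TYPE('x) l}"
    if proj: "H1_projective TYPE('x)"
  proof -
    obtain c where c: "proj_bound TYPE('x) c" by (rule proj_bound_if_H1_projective[OF proj])
    have "\<eta> TYPE('x) \<le> l" if "0 < l" "extension_const TYPE('x) l" for l
      using \<eta>_le[OF proj_bound_if_extension_const[OF that(2)]] that(1) by simp
    with extension_const_if_proj_bound[OF proj_bound_\<eta>[OF c]] \<eta>_eq_Inf_extension_const_fin[OF c]
    show ?thesis by blast
  qed
  ultimately show ?thesis by blast
qed

end
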